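(* Let $K=[a_1,b_1]\times\cdots\times[a_n,b_n]\supset\Gamma$, and let $f:K\to\mathbb C$ be componentwise analytic with parameter $\zeta>1$. Then there exists a constant $C_f>0$ (independent of $N$) such that the following holds. If the spaces $\mathbb Q_N$, $N\ge1$, are $\mathscr S$-invariant, then for all $N\ge1$ $$\Bigl|\mathcal Q_C^{N,n}[f]-\int_\Gamma f\,d\mu\Bigr|\le\frac{C_f\,\zeta^{-N}}{\zeta-1}\,\log^{2n-1}(N+1).$$ Otherwise, for all $N\ge1$, $$\Bigl|\mathcal Q_C^{N,n}[f]-\int_\Gamma f\,d\mu\Bigr|\le\frac{C_f\,\zeta^{-\lfloor N/n\rfloor}}{\zeta-1}\,\bigl(1+|\mathbf w_C^{N,n}|_1\bigr).$$
   Context: Affine IFS: $\mathscr S=\{S_\ell:\mathbb R^n\to\mathbb R^n\}_{\ell=1}^L$, $L\ge2$, with $S_\ell(x)=A_\ell x+b_\ell$ and spectral norm $\rho_\ell=\|A_\ell\|<1$. Its attractor $\Gamma$ is the unique nonempty compact set with $\Gamma=\bigcup_{\ell=1}^L S_\ell(\Gamma)$. Fix $\mu_1,\dots,\mu_L\in(0,1)$ with $\sum_\ell\mu_\ell=1$; $\mu$ is the unique Borel regular probability measure (on a closed ball $F$ with $\bigcup_\ell S_\ell(F)\subset F$) satisfying $\mu=\sum_\ell\mu_\ell\,\mu\circ S_\ell^{-1}$; its support is $\Gamma$. Ruelle operator: $\mathscr F[f]=\sum_{\ell=1}^L\mu_\ell\, f\circ S_\ell$. A finite-dimensional space $\mathcal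 P$ of polynomials is $\mathscr S$-invariant if it contains the constants and $\mathscr F(\mathcal P)\subset\mathcal P$. $\mathbb Q_N=\operatorname{span}\{x^{\boldsymbol\alpha}:\max_i\alpha_i\le N\}$. Chebyshev tensor-product cubature: $a_i<b_i$, and $\mathcal X=\mathcal X_1^N\times\cdots\times\mathcal X_n^N=\{x_1,\dots,x_M\}$, $M=(N+1)^n$, where $\mathcal X_i^N$ is the set of $N+1$ Chebyshev nodes on $[a_i,b_i]$, i.e. the image under the affine map $[-1,1]\to[a_i,b_i]$ of $\{\cos\frac{(2j+1)\pi}{2N+2}\}_{j=0}^N$ (first kind) or $\{\cos\frac{j\pi}{N}\}_{j=0}^N$ (second kind). These points are unisolvent for $\mathbb Q_N$, with Lagrange polynomials $\mathscr L_i\in\mathbb Q_N$, $\mathscr L_i(x_j)=\delta_{i,j}$. The weights $\mathbf w_C^{N,n}\in\mathbb R^M$ are a vector satisfying $\mathbf S^\top\mathbf w_C^{N,n}=\mathbf w_C^{N,n}$ and $\sum_i(\mathbf w_C^{N,n})_i=1$, where $\mathbf S_{i,j}=\sum_\ell\mu_\ell\,\mathscr L_j(S_\ell(x_i))$, and $\mathcal Q_C^{N,n}[f]=\sum_{i=1}^M(\mathbf w_C^{N,n})_i f(x_i)$. $|\cdot|_1$ is the $\ell^1$ norm. Componentwise analytic with parameter $\zeta>1$: for each $i$ and all $\mathbf y_i=(y_1,\dots,y_{i-1},y_{i+1},\dots,y_n)$ with $y_\ell\in[a_\ell,b_\ell]$, the function $t\mapsto f(y_1,\dots,y_{i-1},t,y_{i+1},\dots,y_n)$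 on $[a_i,b_i]$ admits an analytic extension $F_{\mathbf y_i}$ to the open Bernstein ellipse $$\mathscr E_{a_i,b_i}^\zeta=\Bigl\{\tfrac{a_i+b_i}2+\tfrac{a_i-b_i}2\,\tfrac{z+z^{-1}}2:\ 1\le|z|<\zeta\Bigr\},$$ which is additionally continuous on the closure of this ellipse.
   Formalization: The formal theorem also assumes that the extensions F_{y_i} are bounded on the closed ellipses uniformly in i and y_i; this is automatic for n=1, but without it the claim is false for n≥2. *)

theory Defs
  imports "HOL-Analysis.Analysis" "HOL-Complex_Analysis.Complex_Analysis" "HOL-Probability.Probability"
begin

section \<open>Affine iterated function systems\<close>

definition affine_map :: "real^'n^'n \<Rightarrow> real^'n \<Rightarrow> real^'n \<Rightarrow> real^'n" where
  "affine_map A b x = A *v x + b"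

definition spectral_norm :: "real^'n^'n \<Rightarrow> real" where
  "spectral_norm A = onorm ((*v) A)"

definition is_attractor :: "('l \<Rightarrow> real^'n \<Rightarrow> real^'n) \<Rightarrow> (real^'n) set \<Rightarrow> bool" where
  "is_attractor S \<Gamma> \<longleftrightarrow> compact \<Gamma> \<and> \<Gamma> \<noteq> {} \<and> \<Gamma> = (\<Union>l. S l ` \<Gamma>)"

text \<open>The invariant measure lives on a closed ball that is mapped into itself by the system. It is
  rendered as a Borel probability measure on the whole space that is concentrated on such a ball.\<close>

definition is_invariant_measure ::
  "('l::finite \<Rightarrow> real^'n \<Rightarrow> real^'n) \<Rightarrow> ('l \<Rightarrow> real) \<Rightarrow> (real^'n) measure \<Rightarrow> bool" where
  "is_invariant_measure S \<mu> M \<longleftrightarrow>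
     prob_space M \<and> sets M = sets borel \<and>
     (\<exists>c r. (\<forall>l. S l ` cball c r \<subseteq> cball c r) \<and> (AE x in M. x \<in> cball c r)) \<and>
     (\<forall>B\<in>sets borel. measure M B = (\<Sum>l\<in>UNIV. \<mu> l * measure M (S l -` B)))"

definition ruelle ::
  "('l::finite \<Rightarrow> real^'n \<Rightarrow> real^'n) \<Rightarrow> ('l \<Rightarrow> real) \<Rightarrow> (real^'n \<Rightarrow> real) \<Rightarrow> real^'n \<Rightarrow> real" where
  "ruelle S \<mu> f = (\<lambda>x. \<Sum>l\<in>UNIV. \<mu> l * f (S l x))"

definition ifs_invariant ::
  "('l::finite \<Rightarrow> real^'n \<Rightarrow> real^'n) \<Rightarrow> ('l \<Rightarrow> real) \<Rightarrow> (real^'n \<Rightarrow> real) set \<Rightarrow> bool" where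
  "ifs_invariant S \<mu> P \<longleftrightarrow> (\<forall>c. (\<lambda>x. c) \<in> P) \<and> ruelle S \<mu> ` P \<subseteq> P"

section \<open>Tensor-product Chebyshev cubature\<close>

definition monomial_fun :: "('n::finite \<Rightarrow> nat) \<Rightarrow> real^'n \<Rightarrow> real" where
  "monomial_fun \<alpha> x = (\<Prod>i\<in>UNIV. x $ i ^ \<alpha> i)"

definition Q_space :: "nat \<Rightarrow> (real^'n \<Rightarrow> real) set" where
  "Q_space N = {p. \<exists>c. p = (\<lambda>x. \<Sum>\<alpha> | \<forall>i. \<alpha> i \<le> N. c \<alpha> * monomial_fun \<alpha> x)}"

datatype cheb_kind = First_Kind | Second_Kind

definition cheb_ref_nodes :: "cheb_kind \<Rightarrow> nat \<Rightarrow> real set" where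
  "cheb_ref_nodes k N =
     (case k of
        First_Kind \<Rightarrow> (\<lambda>j. cos (real (2 * j + 1) * pi / real (2 * N + 2))) ` {0..N}
      | Second_Kind \<Rightarrow> (\<lambda>j. cos (real j * pi / real N)) ` {0..N})"

definition cheb_nodes :: "cheb_kind \<Rightarrow> nat \<Rightarrow> real \<Rightarrow> real \<Rightarrow> real set" where
  "cheb_nodes k N a b = (\<lambda>t. (a + b) / 2 + (b - a) / 2 * t) ` cheb_ref_nodes k N"

definition cheb_grid ::
  "('n::finite \<Rightarrow> cheb_kind) \<Rightarrow> nat \<Rightarrow> real^'n \<Rightarrow> real^'n \<Rightarrow> (real^'n) set" where
  "cheb_grid k N a b = {x. \<forall>i. x $ i \<in> cheb_nodes (k i) N (a $ i) (b $ i)}"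

text \<open>Lagrange polynomials, matrix entries and weights are indexed by the nodes themselves rather
  than by a numbering \<open>x\<^sub>1, \<dots>, x\<^sub>M\<close> of them.\<close>

definition lagrange_poly :: "nat \<Rightarrow> (real^'n) set \<Rightarrow> real^'n \<Rightarrow> real^'n \<Rightarrow> real" where
  "lagrange_poly N X y = (THE p. p \<in> Q_space N \<and> (\<forall>x\<in>X. p x = (if x = y then 1 else 0)))"

definition S_matrix ::
  "('l::finite \<Rightarrow> real^'n \<Rightarrow> real^'n) \<Rightarrow> ('l \<Rightarrow> real) \<Rightarrow> nat \<Rightarrow> (real^'n) set \<Rightarrow> real^'n \<Rightarrow> real^'n \<Rightarrow> real"
  where "S_matrix S \<mu> N X x y = (\<Sum>l\<in>UNIV. \<mu> l * lagrange_poly N X y (S l x))"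

definition cubature_weights ::
  "('l::finite \<Rightarrow> real^'n \<Rightarrow> real^'n) \<Rightarrow> ('l \<Rightarrow> real) \<Rightarrow> nat \<Rightarrow> (real^'n) set \<Rightarrow> (real^'n \<Rightarrow> real) \<Rightarrow> bool"
  where "cubature_weights S \<mu> N X w \<longleftrightarrow>
     (\<forall>y\<in>X. (\<Sum>x\<in>X. S_matrix S \<mu> N X x y * w x) = w y) \<and> (\<Sum>x\<in>X. w x) = 1"

definition cubature :: "(real^'n) set \<Rightarrow> (real^'n \<Rightarrow> real) \<Rightarrow> (real^'n \<Rightarrow> complex) \<Rightarrow> complex" where
  "cubature X w f = (\<Sum>x\<in>X. of_real (w x) * f x)"

definition l1_norm :: "(real^'n) set \<Rightarrow> (real^'n \<Rightarrow> real) \<Rightarrow> real" where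
  "l1_norm X w = (\<Sum>x\<in>X. \<bar>w x\<bar>)"

section \<open>Componentwise analytic functions\<close>

definition bernstein_ellipse :: "real \<Rightarrow> real \<Rightarrow> real \<Rightarrow> complex set" where
  "bernstein_ellipse a b \<zeta> =
     {of_real ((a + b) / 2) + of_real ((a - b) / 2) * ((z + inverse z) / 2) | z. 1 \<le> cmod z \<and> cmod z < \<zeta>}"

text \<open>\<open>F\<close> is the extension \<open>F\<^sub>y\<^sub>i\<close> of \<open>f\<close> in its \<open>i\<close>-th variable, the others being
  frozen at those of \<open>y\<close>; the component \<open>y $ i\<close> is irrelevant.\<close>

definition is_component_ext ::
  "(real^'n \<Rightarrow> complex) \<Rightarrow> real^'n \<Rightarrow> real^'n \<Rightarrow> real \<Rightarrow> 'n \<Rightarrow> real^'n \<Rightarrow> (complex \<Rightarrow> complex) \<Rightarrow> bool"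
  where "is_component_ext f a b \<zeta> i y F \<longleftrightarrow>
     F analytic_on bernstein_ellipse (a $ i) (b $ i) \<zeta> \<and>
     continuous_on (closure (bernstein_ellipse (a $ i) (b $ i) \<zeta>)) F \<and>
     (\<forall>t\<in>{a $ i..b $ i}. F (of_real t) = f (\<chi> j. if j = i then t else y $ j))"

definition componentwise_analytic ::
  "(real^'n \<Rightarrow> complex) \<Rightarrow> real^'n \<Rightarrow> real^'n \<Rightarrow> real \<Rightarrow> bool" where
  "componentwise_analytic f a b \<zeta> \<longleftrightarrow>
     (\<forall>i. \<forall>y\<in>cbox a b. \<exists>F. is_component_ext f a b \<zeta> i y F)"

text \<open>The extensions are bounded uniformly in the frozen variables, i.e. the maximum of
  \<open>\<bar>F\<^sub>y\<^sub>i\<bar>\<close> over \<open>i\<close>, \<open>y\<close> and the closed ellipse, on which the constant in the error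
  estimates depends, is finite. In dimension one this follows from continuity on the closed ellipse.
  In higher dimensions it does not follow from componentwise analyticity, and without it
  the estimates can fail: on \<open>[-1,1]\<^sup>2\<close> with normalised Lebesgue measure, take
  \<open>f(x,y) = \<Sum>\<^sub>j \<zeta>\<^bsup>-k\<^sub>j\<^esup> T\<^bsub>k\<^sub>j\<^esub>(x) k\<^sub>j\<^sup>5 y\<^sup>2 exp(-k\<^sub>j\<^bsup>1/2\<^esup> y\<^sup>2)\<close> for a sufficiently sparse sequence of
  even \<open>k\<^sub>j\<close>, and first-kind nodes with \<open>N = k\<^sub>j - 1\<close>.\<close>

definition uniformly_bounded_ext ::
  "(real^'n \<Rightarrow> complex) \<Rightarrow> real^'n \<Rightarrow> real^'n \<Rightarrow> real \<Rightarrow> bool" where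
  "uniformly_bounded_ext f a b \<zeta> \<longleftrightarrow>
     (\<exists>B. \<forall>i. \<forall>y\<in>cbox a b. \<forall>F. is_component_ext f a b \<zeta> i y F \<longrightarrow>
        (\<forall>z\<in>closure (bernstein_ellipse (a $ i) (b $ i) \<zeta>). cmod (F z) \<le> B))"

end

theory Submission
  imports Defs
begin

text \<open>Cauchy's formula over a Bernstein ellipse, pulled back to a circle by the Joukowski map, bounds
  the univariate best approximation errors by \<open>E \<zeta>\<^sup>-\<^sup>m\<close>. The weight equation says that cubature is invariant
  under the Ruelle operator on a polynomial space \<open>V\<close>; if \<open>V\<close> is mapped into itself, iterating the
  operator flattens polynomials to their mean, so the cubature is exact on \<open>V\<close>.
  If \<open>\<rat>\<^sub>N\<close> is invariant, the cubature error is the mean of the tensor interpolation error, which is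
  controlled by the logarithmic Lebesgue constants. In general only the polynomials of total degree at most \<open>N\<close>
  form an invariant space. To approximate from this space without logarithmic
  loss, interpolate on a much finer first-kind grid, discard all Chebyshev coefficients of total
  degree above \<open>N\<close>, and let the grid size tend to infinity: the coefficients are uniformly \<open>O(\<zeta>\<^sup>-\<^sup>u)\<close> with \<open>u\<close>
  the largest index, and the discarded tail sums to \<open>O(\<zeta>\<^sup>-\<^sup>m)\<close> with \<open>m = N div n\<close>.\<close>

section \<open>Best approximation of analytic functions\<close>

text \<open>Composition with an affine map mixes coordinates: it can raise the coordinate degrees of
  a member of \<open>Q_space N\<close>, but never its total degree. Total degree \<open>N\<close>
  only guarantees a full box of coordinate degrees up to \<open>N div CARD('n)\<close>, whence the
  weaker rate. Nothing is known about the signs of the weights. In the invariant case exactness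
  identifies each weight with the mean of a Lagrange polynomial, so the cubature of \<open>f\<close>
  is the mean of its interpolant and the l1 norm of the weights does not enter. In general the
  weights act on an approximation error, and their l1 norm appears. Joint continuity of
  \<open>f\<close>, which makes it integrable over \<open>\<Gamma>\<close>, is not part of the
  definition of componentwise analyticity; it is obtained from the uniform convergence of the
  interpolants. Tensor interpolation costs only the \<open>n\<close>-th power of the logarithm,
  \<open>n\<close> being the dimension; the exponent \<open>2 * n - 1\<close> follows because
  \<open>ln (N + 1)\<close> is bounded below.\<close>

definition joukowski :: "complex \<Rightarrow> complex" where
  "joukowski z = (z + inverse z) / 2"

text \<open>After multiplication by \<open>2 * z\<close>, the differences of
  \<open>joukowski z\<close> from the foci 1 and -1 are the squares of \<open>z - 1\<close> and
  \<open>z + 1\<close>, so the parallelogram law yields the sum.\<close>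

lemma joukowski_focal_sum:
  assumes "z \<noteq> 0"
  shows "cmod (joukowski z - 1) + cmod (joukowski z + 1) = cmod z + 1 / cmod z"
proof -
  have "joukowski z - 1 = (z - 1)^2 / (2 * z)" "joukowski z + 1 = (z + 1)^2 / (2 * z)"
    using assms by (auto simp: joukowski_def field_simps power2_eq_square)
  hence "cmod (joukowski z - 1) + cmod (joukowski z + 1)
      = ((cmod (z - 1))\<^sup>2 + (cmod (z + 1))\<^sup>2) / (2 * cmod z)"
    by (simp add: norm_divide norm_mult norm_power add_divide_distrib)
  also have "(cmod (z - 1))\<^sup>2 + (cmod (z + 1))\<^sup>2 = 2 * (cmod z)\<^sup>2 + 2"
    unfolding cmod_power2 by (simp add: power2_eq_square algebra_simps)
  also have "(2 * (cmod z)\<^sup>2 + 2) / (2 * cmod z) = cmod z + 1 / cmod z"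
    using assms by (simp add: field_simps power2_eq_square)
  finally show ?thesis .
qed

lemma add_inverse_strict_mono:
  fixes x y :: real
  assumes "1 \<le> x" "1 \<le> y"
  shows "x + 1 / x < y + 1 / y \<longleftrightarrow> x < y"
proof -
  have "(y + 1 / y) - (x + 1 / x) = (y - x) * (x * y - 1) / (x * y)"
    using assms by (simp add: field_simps)
  moreover have "(y - x) * (x * y - 1) > 0 \<longleftrightarrow> x < y"
  proof (cases "x * y = 1")
    case True
    hence "x = 1 \<and> y = 1"
      using assms mult_mono[of 1 x 1 y] by (smt (verit) mult_le_cancel_left1 mult_le_cancel_right1)
    thus ?thesis by simp
  next
    case False
    hence "x * y > 1" using assms mult_mono[of 1 x 1 y] by simp
    thus ?thesis by (simp add: zero_less_mult_iff)
  qed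
  moreover have "x * y > 0" using assms by simp
  ultimately show ?thesis by (smt (verit) zero_less_divide_iff)
qed

text \<open>The two roots of the quadratic equation for \<open>z\<close> are inverse to each other,
  so one of them lies outside the open unit disc.\<close>

lemma joukowski_surj: "\<exists>z. 1 \<le> cmod z \<and> joukowski z = u"
proof -
  define w where "w = u + csqrt (u^2 - 1)"
  have *: "w * (u - csqrt (u^2 - 1)) = 1"
  proof -
    have "w * (u - csqrt (u^2 - 1)) = u^2 - (csqrt (u^2 - 1))^2"
      by (simp add: w_def algebra_simps power2_eq_square)
    thus ?thesis by simp
  qed
  hence w0: "w \<noteq> 0" and iw: "inverse w = u - csqrt (u^2 - 1)"
    by (auto simp: inverse_unique)
  have jw: "joukowski w = u" unfolding joukowski_def iw by (simp add: w_def)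
  show ?thesis
  proof (cases "1 \<le> cmod w")
    case False
    have "joukowski (inverse w) = u" using jw by (simp add: joukowski_def add.commute)
    moreover have "1 \<le> cmod (inverse w)" using False w0 by (simp add: norm_inverse one_le_inverse)
    ultimately show ?thesis by blast
  qed (use jw in blast)
qed

text \<open>The description by focal distances makes openness and convexity of the ellipse
  immediate; Cauchy's formula is applied in its convex form.\<close>

lemma joukowski_image_annulus:
  assumes "\<zeta> > 1"
  shows "joukowski ` {z. 1 \<le> cmod z \<and> cmod z < \<zeta>} = {u. cmod (u - 1) + cmod (u + 1) < \<zeta> + 1 / \<zeta>}"
proof safe
  fix z assume "1 \<le> cmod z" "cmod z < \<zeta>"
  moreover have "z \<noteq> 0" using \<open>1 \<le> cmod z\<close> by auto
  ultimately show "cmod (joukowski z - 1) + cmod (joukowski z + 1) < \<zeta> + 1 / \<zeta>"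
    using assms by (subst joukowski_focal_sum) (auto simp: add_inverse_strict_mono)
next
  fix u assume u: "cmod (u - 1) + cmod (u + 1) < \<zeta> + 1 / \<zeta>"
  obtain z where z: "1 \<le> cmod z" "joukowski z = u" using joukowski_surj by blast
  hence "z \<noteq> 0" by auto
  hence "cmod z + 1 / cmod z < \<zeta> + 1 / \<zeta>" using u z joukowski_focal_sum by metis
  hence "cmod z < \<zeta>" using add_inverse_strict_mono z assms by auto
  thus "u \<in> joukowski ` {z. 1 \<le> cmod z \<and> cmod z < \<zeta>}" using z by auto
qed

lemma convex_ellipse: "convex {u::complex. cmod (u - 1) + cmod (u + 1) < c}"
proof -
  have "convex_on UNIV (\<lambda>u::complex. cmod (u - p))" for p
    using convex_on_dist[of "UNIV :: complex set" p] by (simp add: dist_norm norm_minus_commute)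
  from convex_on_add[OF this[of 1] this[of "-1"]]
  have cv: "convex_on UNIV (\<lambda>u::complex. cmod (u - 1) + cmod (u + 1))" by simp
  show ?thesis
  proof (rule convexI, clarify)
    fix x y :: complex and s t :: real
    assume h: "cmod (x - 1) + cmod (x + 1) < c" "cmod (y - 1) + cmod (y + 1) < c"
      "0 \<le> s" "0 \<le> t" "s + t = 1"
    have "cmod (s *\<^sub>R x + t *\<^sub>R y - 1) + cmod (s *\<^sub>R x + t *\<^sub>R y + 1)
      \<le> s * (cmod (x - 1) + cmod (x + 1)) + t * (cmod (y - 1) + cmod (y + 1))"
      using cv h unfolding convex_on_def by auto
    also have "\<dots> < c"
      using h convex_bound_lt by blast
    finally show "cmod (s *\<^sub>R x + t *\<^sub>R y - 1) + cmod (s *\<^sub>R x + t *\<^sub>R y + 1) < c" .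
  qed
qed

lemma open_ellipse: "open {u::complex. cmod (u - 1) + cmod (u + 1) < c}"
  by (intro open_Collect_less continuous_intros)

section \<open>Cosine expansion of the Cauchy kernel\<close>

lemma inverse_diff_expansion:
  fixes e z :: complex
  assumes "z \<noteq> 0" "z \<noteq> e"
  shows "1 / (z - e) = (\<Sum>k\<le>m. e ^ k / z ^ (k + 1)) + (e / z) ^ (m + 1) / (z - e)"
proof (induction m)
  case 0
  show ?case using assms by (simp add: field_simps)
next
  case (Suc m)
  have "(e / z) ^ (m + 1) / (z - e) = e ^ Suc m / z ^ (Suc m + 1) + (e / z) ^ (Suc m + 1) / (z - e)"
    using assms by (simp add: power_divide field_simps)
  thus ?case using Suc by simp
qed

text \<open>Since \<open>2 * z * (joukowski z - cos \<theta>)\<close> factors as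
  \<open>(z - cis \<theta>) * (z - cis (-\<theta>))\<close>, both sides are the logarithmic
  derivative of the same function.\<close>

lemma joukowski_log_deriv:
  fixes z :: complex and \<theta> :: real
  assumes "cmod z > 1"
  shows "deriv joukowski z / (joukowski z - of_real (cos \<theta>)) = 1 / (z - cis \<theta>) + 1 / (z - cis (-\<theta>)) - 1 / z"
proof -
  have z0: "z \<noteq> 0" using assms by auto
  have ne: "z \<noteq> cis \<theta>" "z \<noteq> cis (-\<theta>)" using assms by auto
  have "(joukowski has_field_derivative ((1 - inverse z ^ 2) / 2)) (at z)"
    unfolding joukowski_def [abs_def] using z0
    by (auto intro!: derivative_eq_intros simp: power2_eq_square)
  hence d: "deriv joukowski z = (1 - inverse z ^ 2) / 2" by (rule DERIV_imp_deriv)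
  have s: "cis \<theta> + cis (-\<theta>) = of_real (2 * cos \<theta>)" "cis \<theta> * cis (-\<theta>) = 1"
    by (auto simp: complex_eq_iff cis_mult)
  have q: "(z - cis \<theta>) * (z - cis (-\<theta>)) = 2 * z * (joukowski z - of_real (cos \<theta>))"
  proof -
    have "(z - cis \<theta>) * (z - cis (-\<theta>)) = z * z - z * (cis \<theta> + cis (-\<theta>)) + cis \<theta> * cis (-\<theta>)"
      by (simp add: algebra_simps)
    also have "\<dots> = 2 * z * (joukowski z - of_real (cos \<theta>))"
      unfolding s joukowski_def using z0 by (simp add: field_simps)
    finally show ?thesis .
  qed
  define W where "W = joukowski z - of_real (cos \<theta>)"
  have W0: "W \<noteq> 0" using q ne by (auto simp: W_def)
  have "1 / (z - cis \<theta>) + 1 / (z - cis (-\<theta>))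
      = (2 * z - (cis \<theta> + cis (-\<theta>))) / ((z - cis \<theta>) * (z - cis (-\<theta>)))"
    using ne by (simp add: field_simps)
  hence e: "1 / (z - cis \<theta>) + 1 / (z - cis (-\<theta>)) = (2 * z - of_real (2 * cos \<theta>)) / (2 * z * W)"
    unfolding q s W_def .
  have "(1 - inverse z ^ 2) / 2 = (2 * z - of_real (2 * cos \<theta>)) / (2 * z) - W / z"
    using z0 by (simp add: W_def joukowski_def field_simps power2_eq_square)
  hence "(1 - inverse z ^ 2) / 2 / W = (2 * z - of_real (2 * cos \<theta>)) / (2 * z * W) - 1 / z"
    using W0 z0 by (simp add: diff_divide_distrib)
  thus ?thesis unfolding e d W_def[symmetric] .
qed

text \<open>Both geometric expansions are cut at the same order; conjugate powers pair up to
  cosines, and the term \<open>1 / z\<close> halves the constant one. The remainder is kept exact so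
  that it can be estimated under the integral.\<close>

lemma joukowski_kernel_expansion:
  fixes z :: complex and \<theta> :: real
  assumes "cmod z > 1"
  shows "deriv joukowski z / (joukowski z - of_real (cos \<theta>))
    = (\<Sum>k\<le>m. (if k = 0 then 1 else 2) / z ^ (k + 1) * of_real (cos (real k * \<theta>)))
      + ((cis \<theta> / z) ^ (m + 1) / (z - cis \<theta>) + (cis (-\<theta>) / z) ^ (m + 1) / (z - cis (-\<theta>)))"
proof -
  have z0: "z \<noteq> 0" "z \<noteq> cis \<theta>" "z \<noteq> cis (-\<theta>)" using assms by auto
  have p: "cis \<theta> ^ k + cis (-\<theta>) ^ k = of_real (2 * cos (real k * \<theta>))" for k
  proof -
    have "cis x + cis (-x) = of_real (2 * cos x)" for x by (simp add: complex_eq_iff)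
    from this[of "real k * \<theta>"] show ?thesis
      by (simp only: Complex.DeMoivre mult_minus_right)
  qed
  have "(\<Sum>k\<le>m. cis \<theta> ^ k / z ^ (k + 1)) + (\<Sum>k\<le>m. cis (-\<theta>) ^ k / z ^ (k + 1)) - 1 / z
      = (\<Sum>k\<le>m. of_real (2 * cos (real k * \<theta>)) / z ^ (k + 1) - (if k = 0 then 1 / z else 0))"
    unfolding sum_subtractf sum.distrib[symmetric]
    by (simp add: add_divide_distrib[symmetric] p del: power_Suc of_real_mult)
  also have "\<dots> = (\<Sum>k\<le>m. (if k = 0 then 1 else 2) / z ^ (k + 1) * of_real (cos (real k * \<theta>)))"
    by (intro sum.cong) auto
  finally have *: "(\<Sum>k\<le>m. cis \<theta> ^ k / z ^ (k + 1)) + (\<Sum>k\<le>m. cis (-\<theta>) ^ k / z ^ (k + 1)) - 1 / z = \<dots>" .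
  show ?thesis
    unfolding joukowski_log_deriv[OF assms] *[symmetric]
    inverse_diff_expansion[OF z0(1,2), of m] inverse_diff_expansion[OF z0(1,3), of m]
    by simp
qed

text \<open>The approximant is the truncated Chebyshev series; its coefficients come from the partial sum
  of the kernel expansion under the Cauchy integral.\<close>

lemma bernstein_circle:
  fixes G :: "complex \<Rightarrow> complex"
  assumes "1 < r" "r < \<zeta>"
    and hol: "G holomorphic_on {u. cmod (u - 1) + cmod (u + 1) < \<zeta> + 1 / \<zeta>}"
    and bd: "\<And>u. cmod (u - 1) + cmod (u + 1) < \<zeta> + 1 / \<zeta> \<Longrightarrow> cmod (G u) \<le> B"
  shows "\<exists>c :: nat \<Rightarrow> complex. \<forall>\<theta>.
    cmod (G (of_real (cos \<theta>)) - (\<Sum>k\<le>m. c k * of_real (cos (real k * \<theta>)))) \<le> 2 * B / (r ^ m * (r - 1))"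
proof -
  define E where "E = {u::complex. cmod (u - 1) + cmod (u + 1) < \<zeta> + 1 / \<zeta>}"
  define \<gamma> where "\<gamma> = circlepath 0 r"
  \<comment> \<open>No sign is assumed for \<open>B\<close>; the centre 0 has focal sum 2 and so
    lies in the ellipse, where \<open>B\<close> bounds a norm.\<close>
  have B0: "B \<ge> 0" 
  proof -
    have "1 + 1 / 1 < \<zeta> + 1 / \<zeta>" using assms by (subst add_inverse_strict_mono) auto
    hence "cmod (G 0) \<le> B" by (intro bd) auto
    thus ?thesis using norm_ge_zero order_trans by blast
  qed
  have img: "path_image \<gamma> = {z. cmod z = r}" using assms by (auto simp: \<gamma>_def sphere_def)
  have anJ: "joukowski analytic_on (- {0})"
    unfolding joukowski_def [abs_def] by (intro analytic_intros) auto
  have holJ: "joukowski holomorphic_on (- {0})" using anJ by (rule analytic_imp_holomorphic)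
  have vp: "valid_path (joukowski \<circ> \<gamma>)"
    by (rule valid_path_compose_holomorphic[OF _ holJ]) (use assms img in \<open>auto simp: \<gamma>_def\<close>)
  have Jin: "joukowski z \<in> E" if "cmod z = r" for z
    using joukowski_image_annulus[of \<zeta>] that assms unfolding E_def by fastforce
  have Jout: "joukowski z \<noteq> of_real (cos \<theta>)" if "cmod z = r" for z \<theta>
  proof
    assume h: "joukowski z = of_real (cos \<theta>)"
    have "z \<noteq> 0" using that assms by auto
    hence "cmod (of_real (cos \<theta>) - 1) + cmod (of_real (cos \<theta>) + 1) = r + 1 / r"
      using joukowski_focal_sum h that by metis
    moreover have "cmod (of_real (cos \<theta>) - 1) + cmod (of_real (cos \<theta>) + 1) = 2"
    proof -
      have "cmod (of_real (cos \<theta>) - 1) = \<bar>cos \<theta> - 1\<bar>" "cmod (of_real (cos \<theta>) + 1) = \<bar>cos \<theta> + 1\<bar>"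
        by (metis norm_of_real of_real_1 of_real_diff of_real_add)+
      thus ?thesis using cos_le_one[of \<theta>] cos_ge_minus_one[of \<theta>] by linarith
    qed
    ultimately show False using add_inverse_strict_mono[of 1 r] assms by auto
  qed
  have inE: "of_real (cos \<theta>) \<in> E" for \<theta>
  proof -
    have "joukowski (cis \<theta>) = of_real (cos \<theta>)"
      by (simp add: joukowski_def complex_eq_iff)
    thus ?thesis using joukowski_image_annulus[of \<zeta>] assms unfolding E_def
      by (metis (mono_tags, lifting) image_eqI mem_Collect_eq norm_cis order_less_trans order_refl)
  qed
  have pth: "path_image (joukowski \<circ> \<gamma>) \<subseteq> E - {of_real (cos \<theta>)}" for \<theta>
    using Jin Jout img by (auto simp: path_image_compose)
  have clo: "pathfinish (joukowski \<circ> \<gamma>) = pathstart (joukowski \<circ> \<gamma>)"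
    by (simp add: \<gamma>_def pathfinish_compose pathstart_compose)
  have contJ: "continuous_on {z. cmod z = r} joukowski"
    by (rule continuous_on_subset[OF holomorphic_on_imp_continuous_on[OF holJ]]) (use assms in auto)
  have contG: "continuous_on {z. cmod z = r} (\<lambda>z. G (joukowski z))"
    by (rule continuous_on_compose2[OF holomorphic_on_imp_continuous_on[OF hol] contJ])
       (use Jin E_def in auto)
  have contdJ: "continuous_on {z. cmod z = r} (deriv joukowski)"
    by (rule continuous_on_subset[OF holomorphic_on_imp_continuous_on[OF holomorphic_deriv[OF holJ]]])
       (use assms in auto)
  \<comment> \<open>Pulled back to the circle, the winding integral splits into simple fractions
    whose poles \<open>cis \<theta>\<close>, \<open>cis (-\<theta>)\<close> and 0 all lie inside;
    they count \<open>1 + 1 - 1\<close>.\<close>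
  have wind: "winding_number (joukowski \<circ> \<gamma>) (of_real (cos \<theta>)) = 1" for \<theta>
  proof -
    have r1: "cmod (cis \<theta>') < r" for \<theta>' using assms by simp
    have "((\<lambda>z. 1 / (z - cis \<theta>) + 1 / (z - cis (-\<theta>)) - 1 / (z - 0)) has_contour_integral
        (2 * pi * \<i> + 2 * pi * \<i> - 2 * pi * \<i>)) \<gamma>"
    proof -
      have *: "((\<lambda>z. 1 / (z - w)) has_contour_integral (2 * pi * \<i>)) \<gamma>" if "cmod w < r" for w
        using Cauchy_integral_circlepath_simple[of "\<lambda>_. 1" 0 r w] that
        by (simp add: \<gamma>_def)
      show ?thesis
        by (intro has_contour_integral_add has_contour_integral_diff *) (use r1 assms in auto)
    qed
    hence "((\<lambda>z. deriv joukowski z * (1 / (joukowski z - of_real (cos \<theta>)))) has_contour_integral (2 * pi * \<i>)) \<gamma>"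
      by (rule has_contour_integral_eq[THEN back_subst[of "\<lambda>x. (_ has_contour_integral x) _"]])
         (use assms joukowski_log_deriv img in \<open>auto\<close>)
    hence "contour_integral \<gamma> (\<lambda>z. deriv joukowski z * (1 / (joukowski z - of_real (cos \<theta>)))) = 2 * pi * \<i>"
      by (rule contour_integral_unique)
    hence "contour_integral (joukowski \<circ> \<gamma>) (\<lambda>w. 1 / (w - of_real (cos \<theta>))) = 2 * pi * \<i>"
      by (subst contour_integral_comp_analyticW[OF anJ]) (use assms img in \<open>auto simp: \<gamma>_def\<close>)
    thus ?thesis
      by (subst winding_number_valid_path[OF vp]) (use pth[of \<theta>] in auto)
  qed
  have cauchy: "((\<lambda>z. G (joukowski z) * (deriv joukowski z / (joukowski z - of_real (cos \<theta>))))
      has_contour_integral (2 * pi * \<i> * G (of_real (cos \<theta>)))) \<gamma>" for \<theta>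
  proof -
    have "((\<lambda>w. G w / (w - of_real (cos \<theta>))) has_contour_integral
       (2 * pi * \<i> * winding_number (joukowski \<circ> \<gamma>) (of_real (cos \<theta>)) * G (of_real (cos \<theta>)))) (joukowski \<circ> \<gamma>)"
    proof (rule Cauchy_integral_formula_convex_simple)
      show "convex E" unfolding E_def by (rule convex_ellipse)
      show "of_real (cos \<theta>) \<in> interior E"
        using inE[of \<theta>] interior_open[OF open_ellipse] unfolding E_def by blast
    qed (use hol pth vp clo E_def in auto)
    hence "contour_integral (joukowski \<circ> \<gamma>) (\<lambda>w. G w / (w - of_real (cos \<theta>))) = 2 * pi * \<i> * G (of_real (cos \<theta>))"
      unfolding wind by (simp add: contour_integral_unique)
    moreover have "contour_integral (joukowski \<circ> \<gamma>) (\<lambda>w. G w / (w - of_real (cos \<theta>)))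
       = contour_integral \<gamma> (\<lambda>z. deriv joukowski z * (G (joukowski z) / (joukowski z - of_real (cos \<theta>))))"
      by (rule contour_integral_comp_analyticW[OF anJ]) (use assms img in \<open>auto simp: \<gamma>_def\<close>)
    moreover have "(\<lambda>z. G (joukowski z) * (deriv joukowski z / (joukowski z - of_real (cos \<theta>)))) contour_integrable_on \<gamma>"
      unfolding \<gamma>_def
      by (rule contour_integrable_continuous_circlepath)
         (use contG contdJ contJ Jout assms img in \<open>auto intro!: continuous_intros simp: \<gamma>_def[symmetric]\<close>)
    ultimately show ?thesis
      by (metis (no_types, lifting) contour_integral_cong has_contour_integral_integral mult.commute times_divide_eq_left)
  qed
  define I where "I k = contour_integral \<gamma> (\<lambda>z. G (joukowski z) * ((if k = 0 then 1 else 2) / z ^ (k + 1)))" for k :: nat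
  have I: "((\<lambda>z. G (joukowski z) * ((if k = 0 then 1 else 2) / z ^ (k + 1))) has_contour_integral I k) \<gamma>" for k
    unfolding I_def 
    by (rule has_contour_integral_integral, unfold \<gamma>_def, rule contour_integrable_continuous_circlepath)
       (use contG assms img in \<open>auto intro!: continuous_intros simp: \<gamma>_def[symmetric]\<close>)
  define c where "c k = I k / (2 * pi * \<i>)" for k
  show ?thesis
  proof (intro exI[of _ c] allI)
    fix \<theta>
    define R where "R z = (cis \<theta> / z) ^ (m + 1) / (z - cis \<theta>) + (cis (-\<theta>) / z) ^ (m + 1) / (z - cis (-\<theta>))" for z
    define D where "D = G (of_real (cos \<theta>)) - (\<Sum>k\<le>m. c k * of_real (cos (real k * \<theta>)))"
    have "((\<lambda>z. G (joukowski z) * (deriv joukowski z / (joukowski z - of_real (cos \<theta>)))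
         - (\<Sum>k\<le>m. of_real (cos (real k * \<theta>)) * (G (joukowski z) * ((if k = 0 then 1 else 2) / z ^ (k + 1)))))
      has_contour_integral (2 * pi * \<i> * G (of_real (cos \<theta>)) - (\<Sum>k\<le>m. of_real (cos (real k * \<theta>)) * I k))) \<gamma>"
      by (intro has_contour_integral_diff cauchy has_contour_integral_sum has_contour_integral_lmul I) auto
    also have "2 * pi * \<i> * G (of_real (cos \<theta>)) - (\<Sum>k\<le>m. of_real (cos (real k * \<theta>)) * I k) = 2 * pi * \<i> * D"
      by (simp add: D_def c_def algebra_simps sum_distrib_left sum_distrib_right)
    \<comment> \<open>Once the partial sum, integrated termwise, is subtracted, only the remainder
      of the kernel expansion survives.\<close>
    finally have int: "((\<lambda>z. G (joukowski z) * R z) has_contour_integral (2 * pi * \<i> * D)) \<gamma>"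
    proof (rule has_contour_integral_eq)
      fix z assume "z \<in> path_image \<gamma>"
      hence "cmod z > 1" using assms img by auto
      show "G (joukowski z) * (deriv joukowski z / (joukowski z - of_real (cos \<theta>)))
         - (\<Sum>k\<le>m. of_real (cos (real k * \<theta>)) * (G (joukowski z) * ((if k = 0 then 1 else 2) / z ^ (k + 1))))
         = G (joukowski z) * R z"
        unfolding joukowski_kernel_expansion[OF \<open>cmod z > 1\<close>, of \<theta> m] R_def
        by (simp add: algebra_simps sum_distrib_left)
    qed
    have "cmod (2 * pi * \<i> * D) \<le> (B * (2 / (r ^ (m + 1) * (r - 1)))) * (2 * pi * r)"
    proof (rule has_contour_integral_bound_circlepath[OF int[unfolded \<gamma>_def]])
      fix z :: complex assume "cmod (z - 0) = r"
      hence z: "cmod z = r" by simp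
      \<comment> \<open>On the circle the quotient \<open>cis \<theta>' / z\<close> has modulus
        \<open>1 / r\<close>, and the distance to the unit circle is at least \<open>r - 1\<close>.
        The length \<open>2 * pi * r\<close> later cancels one power of \<open>r\<close>.\<close>
      have t: "cmod ((cis \<theta>' / z) ^ (m + 1) / (z - cis \<theta>')) \<le> 1 / (r ^ (m + 1) * (r - 1))" for \<theta>'
      proof -
        have "r - 1 \<le> cmod (z - cis \<theta>')" using norm_triangle_ineq2[of z "cis \<theta>'"] z by simp
        hence "1 / (r ^ (m + 1) * cmod (z - cis \<theta>')) \<le> 1 / (r ^ (m + 1) * (r - 1))"
          using assms by (intro divide_left_mono mult_left_mono mult_pos_pos zero_less_power) auto
        thus ?thesis by (simp add: norm_divide norm_mult norm_power z power_divide)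
      qed
      have "cmod (R z) \<le> 2 / (r ^ (m + 1) * (r - 1))"
        unfolding R_def by (rule norm_triangle_le[OF order_trans[OF add_mono[OF t[of \<theta>] t[of "-\<theta>"]]]]) (simp add: mult_ac)
      moreover have "cmod (G (joukowski z)) \<le> B" using bd Jin[OF z] E_def by auto
      ultimately show "cmod (G (joukowski z) * R z) \<le> B * (2 / (r ^ (m + 1) * (r - 1)))"
        unfolding norm_mult using B0 by (intro mult_mono) auto
    qed (use assms B0 in auto)
    also have "(B * (2 / (r ^ (m + 1) * (r - 1)))) * (2 * pi * r) = 2 * pi * (2 * B / (r ^ m * (r - 1)))"
      using assms by simp
    finally have "2 * pi * cmod D \<le> 2 * pi * (2 * B / (r ^ m * (r - 1)))"
      by (simp add: norm_mult)
    hence "cmod D \<le> 2 * B / (r ^ m * (r - 1))" by (rule mult_left_le_imp_le) simp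
    thus "cmod (G (of_real (cos \<theta>)) - (\<Sum>k\<le>m. c k * of_real (cos (real k * \<theta>)))) \<le> 2 * B / (r ^ m * (r - 1))"
      unfolding D_def .
  qed
qed

lemma bernstein_approximation:
  fixes F :: "complex \<Rightarrow> complex" and a b \<zeta> B :: real
  assumes "a < b" "1 < \<zeta>" "0 < B"
    and an: "F analytic_on bernstein_ellipse a b \<zeta>"
    and bd: "\<And>z. z \<in> bernstein_ellipse a b \<zeta> \<Longrightarrow> cmod (F z) \<le> B"
  shows "\<exists>c :: nat \<Rightarrow> complex. \<forall>\<theta>.
    cmod (F (of_real ((a + b) / 2 + (b - a) / 2 * cos \<theta>)) - (\<Sum>k\<le>m. c k * of_real (cos (real k * \<theta>))))
      \<le> 4 * B / (\<zeta> - 1) / \<zeta> ^ m"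
proof -
  define E where "E = {u::complex. cmod (u - 1) + cmod (u + 1) < \<zeta> + 1 / \<zeta>}"
  define \<phi> where "\<phi> u = of_real ((a + b) / 2) + of_real ((b - a) / 2) * u" for u :: complex
  \<comment> \<open>\<open>bernstein_ellipse\<close> is written with the factor
    \<open>(a - b) / 2\<close>, whereas \<open>\<phi>\<close> uses \<open>(b - a) / 2\<close>; the
    symmetry of the ellipse under negation reconciles the two.\<close>
  have neg: "- u \<in> E" if "u \<in> E" for u
  proof -
    have "cmod (- u - 1) = cmod (u + 1)" "cmod (- u + 1) = cmod (u - 1)"
      using norm_minus_cancel[of "u + 1"] norm_minus_commute[of 1 u] by simp_all
    thus ?thesis using that by (simp add: E_def add.commute)
  qed
  have \<phi>: "\<phi> u \<in> bernstein_ellipse a b \<zeta>" if "u \<in> E" for u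
  proof -
    from neg[OF that] obtain z where "1 \<le> cmod z" "cmod z < \<zeta>" "joukowski z = - u"
      using joukowski_image_annulus[OF \<open>1 < \<zeta>\<close>] unfolding E_def by (metis (no_types, lifting) imageE mem_Collect_eq)
    moreover from this have "\<phi> u = of_real ((a + b) / 2) + of_real ((a - b) / 2) * ((z + inverse z) / 2)"
      by (simp add: \<phi>_def joukowski_def[symmetric] algebra_simps diff_divide_distrib)
    ultimately show ?thesis unfolding bernstein_ellipse_def by blast
  qed
  have hol: "(\<lambda>u. F (\<phi> u)) holomorphic_on E"
  proof -
    have "\<phi> holomorphic_on E" unfolding \<phi>_def by (intro holomorphic_intros)
    from holomorphic_on_compose_gen[OF this analytic_imp_holomorphic[OF an]] \<phi>
    show ?thesis by (auto simp: o_def)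
  qed
  \<comment> \<open>Analyticity is available on the open ellipse only, so the circle has some radius
    \<open>r < \<zeta>\<close>. Doubling the limit of the bounds as \<open>r\<close> tends to
    \<open>\<zeta>\<close> leaves strict room to choose \<open>r\<close>; hence the factor
    4.\<close>
  have "((\<lambda>r. 2 * B / (r ^ m * (r - 1))) \<longlongrightarrow> 2 * B / (\<zeta> ^ m * (\<zeta> - 1))) (at_left \<zeta>)"
    using assms by (intro tendsto_intros) auto
  moreover have "2 * B / (\<zeta> ^ m * (\<zeta> - 1)) < 4 * B / (\<zeta> - 1) / \<zeta> ^ m"
    using assms by (simp add: field_simps)
  ultimately have "eventually (\<lambda>r. 2 * B / (r ^ m * (r - 1)) < 4 * B / (\<zeta> - 1) / \<zeta> ^ m) (at_left \<zeta>)"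
    by (rule order_tendstoD)
  moreover have "eventually (\<lambda>r. r \<in> {1<..<\<zeta>}) (at_left \<zeta>)"
    using assms by (intro eventually_at_left_real)
  ultimately have "eventually (\<lambda>r. 2 * B / (r ^ m * (r - 1)) < 4 * B / (\<zeta> - 1) / \<zeta> ^ m \<and> r \<in> {1<..<\<zeta>}) (at_left \<zeta>)"
    by (rule eventually_conj)
  then obtain r where r: "2 * B / (r ^ m * (r - 1)) < 4 * B / (\<zeta> - 1) / \<zeta> ^ m" "1 < r" "r < \<zeta>"
    by (auto dest!: eventually_happens' [rotated])
  have "\<exists>c :: nat \<Rightarrow> complex. \<forall>\<theta>.
    cmod (F (\<phi> (of_real (cos \<theta>))) - (\<Sum>k\<le>m. c k * of_real (cos (real k * \<theta>)))) \<le> 2 * B / (r ^ m * (r - 1))"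
    by (rule bernstein_circle[OF r(2,3)]) (use hol bd \<phi> E_def in auto)
  then obtain c :: "nat \<Rightarrow> complex" where c: "\<And>\<theta>.
    cmod (F (\<phi> (of_real (cos \<theta>))) - (\<Sum>k\<le>m. c k * of_real (cos (real k * \<theta>)))) \<le> 2 * B / (r ^ m * (r - 1))"
    by blast
  have "\<phi> (of_real x) = of_real ((a + b) / 2 + (b - a) / 2 * x)" for x
    by (simp add: \<phi>_def)
  hence "cmod (F (of_real ((a + b) / 2 + (b - a) / 2 * cos \<theta>)) - (\<Sum>k\<le>m. c k * of_real (cos (real k * \<theta>))))
      \<le> 4 * B / (\<zeta> - 1) / \<zeta> ^ m" for \<theta>
    using order_trans[OF c[of \<theta>] less_imp_le[OF r(1)]] by simp
  thus ?thesis by blast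
qed

section \<open>Univariate Chebyshev interpolation\<close>

definition lagr :: "real set \<Rightarrow> real \<Rightarrow> real poly" where
  "lagr X s = (\<Prod>r\<in>X - {s}. smult (1 / (s - r)) [:- r, 1:])"

lemma degree_lagr:
  assumes "finite X" "s \<in> X"
  shows "degree (lagr X s) < card X"
proof -
  have "degree (lagr X s) \<le> (\<Sum>r\<in>X - {s}. degree (smult (1 / (s - r)) [:- r, 1:]))"
    unfolding lagr_def using assms by (intro order_trans[OF degree_prod_sum_le]) (auto simp: o_def)
  also have "\<dots> = (\<Sum>r\<in>X - {s}. 1)" by (intro sum.cong) auto
  also have "\<dots> < card X" using assms card_gt_0_iff[of X] by auto
  finally show ?thesis .
qed

lemma poly_lagr_node:
  assumes "finite X" "s \<in> X" "t \<in> X"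
  shows "poly (lagr X s) t = (if t = s then 1 else 0)"
proof (cases "t = s")
  case True
  have "poly (smult (1 / (s - r)) [:- r, 1:]) s = 1" if "r \<in> X - {s}" for r
    using that by (simp flip: diff_divide_distrib)
  thus ?thesis using True by (simp add: lagr_def poly_prod)
next
  case False
  have "poly (smult (1 / (s - t)) [:- t, 1:]) t = 0" by simp
  moreover have "t \<in> X - {s}" using False assms by simp
  ultimately have "poly (lagr X s) t = 0"
    unfolding lagr_def poly_prod using assms(1) by (intro prod_zero) blast+
  thus ?thesis using False by simp
qed

lemma lagr_interpolation:
  assumes "finite X" "degree q < card X"
  shows "poly q t = (\<Sum>s\<in>X. poly q s * poly (lagr X s) t)"
proof -
  define p where "p = (\<Sum>s\<in>X. smult (poly q s) (lagr X s))"
  have "q = p"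
  proof (rule poly_eqI_degree[of X])
    fix x assume x: "x \<in> X"
    have "poly p x = (\<Sum>s\<in>X. poly q s * (if x = s then 1 else 0))"
      using x assms by (auto simp: p_def poly_sum poly_lagr_node intro!: sum.cong)
    also have "\<dots> = poly q x" using x assms by (simp add: if_distrib cong: if_cong)
    finally show "poly q x = poly p x" ..
  next
    have "degree p \<le> card X - 1"
      unfolding p_def
  proof (rule degree_sum_le)
    fix s assume "s \<in> X"
    thus "degree (smult (poly q s) (lagr X s)) \<le> card X - 1"
      using degree_lagr[OF assms(1), of s] degree_smult_le[of "poly q s" "lagr X s"] by linarith
  qed (use assms in auto)
    thus "card X > degree p" using assms by linarith
  qed (use assms in auto)
  hence "poly q t = poly p t" by simp
  thus ?thesis by (simp add: p_def poly_sum)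
qed

lemma lagr_unique:
  assumes "finite X" "degree q < card X" "s \<in> X" "\<And>t. t \<in> X \<Longrightarrow> poly q t = (if t = s then 1 else 0)"
  shows "lagr X s = q"
  by (rule poly_eqI_degree[of X]) (use assms degree_lagr poly_lagr_node in auto)

section \<open>Chebyshev polynomials and the angles of the nodes\<close>

fun chebT :: "nat \<Rightarrow> real poly" where
  "chebT 0 = 1"
| "chebT (Suc 0) = [:0, 1:]"
| "chebT (Suc (Suc n)) = [:0, 2:] * chebT (Suc n) - chebT n"

lemma degree_chebT: "degree (chebT n) \<le> n"
proof (induction n rule: chebT.induct)
  case (3 n)
  have "degree ([:0, 2:] * chebT (Suc n)) \<le> Suc (Suc n)"
    using order_trans[OF degree_mult_le, of "[:0, 2::real:]" "chebT (Suc n)"] 3 by simp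
  thus ?case using 3 by (auto intro: degree_diff_le)
qed auto

lemma chebT_cos: "poly (chebT n) (cos \<theta>) = cos (real n * \<theta>)"
proof (induction n rule: chebT.induct)
  case (3 n)
  have "2 * cos \<theta> * cos ((real n + 1) * \<theta>) = cos ((real n + 2) * \<theta>) + cos (real n * \<theta>)"
    using cos_times_cos[of \<theta> "(real n + 1) * \<theta>"] 
    by (simp add: algebra_simps)
  thus ?case using 3 by (simp add: algebra_simps)
qed auto

definition cheb_point :: "real \<Rightarrow> real \<Rightarrow> real \<Rightarrow> real" where
  "cheb_point a b \<theta> = (a + b) / 2 + (b - a) / 2 * cos \<theta>"

definition cheb_on :: "real \<Rightarrow> real \<Rightarrow> nat \<Rightarrow> real poly" where
  "cheb_on a b k = pcompose (chebT k) [:- (a + b) / (b - a), 2 / (b - a):]"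

lemma degree_cheb_on: "degree (cheb_on a b k) \<le> k"
proof -
  have "degree (cheb_on a b k) \<le> degree (chebT k) * degree [:- (a + b) / (b - a), 2 / (b - a):]"
    unfolding cheb_on_def by (rule degree_pcompose_le)
  also have "\<dots> \<le> k * 1" using degree_chebT by (intro mult_le_mono) auto
  finally show ?thesis by simp
qed

lemma poly_cheb_on: "a < b \<Longrightarrow> poly (cheb_on a b k) (cheb_point a b \<theta>) = cos (real k * \<theta>)"
proof -
  assume ab: "a < b"
  have "- (a + b) / (b - a) + (2 / (b - a)) * cheb_point a b \<theta> = (- (a + b) + 2 * cheb_point a b \<theta>) / (b - a)"
    by (simp only: add_divide_distrib times_divide_eq_left)
  also have "- (a + b) + 2 * cheb_point a b \<theta> = (b - a) * cos \<theta>"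
    by (simp add: cheb_point_def field_simps)
  finally have "- (a + b) / (b - a) + (2 / (b - a)) * cheb_point a b \<theta> = cos \<theta>"
    using ab by simp
  thus ?thesis by (simp add: cheb_on_def poly_pcompose chebT_cos mult.commute)
qed

lemma cheb_point_surj:
  assumes "a < b" "t \<in> {a..b}"
  obtains \<theta> where "\<theta> \<in> {0..pi}" "t = cheb_point a b \<theta>"
proof
  define u where "u = (2 * t - (a + b)) / (b - a)"
  have u: "-1 \<le> u" "u \<le> 1" using assms by (auto simp: u_def field_simps)
  show "arccos u \<in> {0..pi}" using u by (auto intro: arccos_lbound arccos_ubound)
  show "t = cheb_point a b (arccos u)"
    using u assms by (simp add: cheb_point_def cos_arccos) (simp add: u_def field_simps)
qed

lemma cheb_point_in: "a < b \<Longrightarrow> cheb_point a b \<theta> \<in> {a..b}"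
proof -
  assume ab: "a < b"
  have "(b - a) / 2 * cos \<theta> \<le> (b - a) / 2 * 1" "(b - a) / 2 * (-1) \<le> (b - a) / 2 * cos \<theta>"
    using ab by (intro mult_left_mono; simp)+
  thus ?thesis by (auto simp: cheb_point_def field_simps)
qed

text \<open>With \<open>P\<close> the value defined here, first-kind nodes are the zeros of
  \<open>cos (P * \<theta>)\<close> and second-kind nodes its extrema. Neighbouring angles differ by
  \<open>pi / P\<close> in both cases, which lets the two kinds share one analysis.\<close>

definition cheb_period :: "cheb_kind \<Rightarrow> nat \<Rightarrow> nat" where
  "cheb_period k N = (case k of First_Kind \<Rightarrow> N + 1 | Second_Kind \<Rightarrow> N)"

definition cheb_angle :: "cheb_kind \<Rightarrow> nat \<Rightarrow> nat \<Rightarrow> real" where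
  "cheb_angle k N j = ((case k of First_Kind \<Rightarrow> 1 / 2 | Second_Kind \<Rightarrow> 0) + real j) * pi / real (cheb_period k N)"

lemma cheb_nodes_angle: "cheb_nodes k N a b = (\<lambda>j. cheb_point a b (cheb_angle k N j)) ` {0..N}"
proof -
  have "real (2 * j + 1) * pi / real (2 * N + 2) = (1 / 2 + real j) * pi / real (N + 1)" for j
    by (simp add: field_simps)
  thus ?thesis
    by (cases k) (auto simp: cheb_nodes_def cheb_ref_nodes_def cheb_point_def cheb_angle_def cheb_period_def image_image)
qed

lemma cheb_angle_bounds:
  assumes "N \<ge> 1" "j \<le> N"
  shows "cheb_angle k N j \<in> {0..pi}"
proof (cases k)
  case First_Kind
  have "(1 / 2 + real j) * pi \<le> (real N + 1) * pi" using assms by (intro mult_right_mono) auto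
  thus ?thesis using First_Kind by (simp add: cheb_angle_def cheb_period_def field_simps)
next
  case Second_Kind
  have "real j * pi \<le> real N * pi" using assms by (intro mult_right_mono) auto
  thus ?thesis using Second_Kind assms by (simp add: cheb_angle_def cheb_period_def field_simps)
qed

lemma cheb_period_pos: "N \<ge> 1 \<Longrightarrow> cheb_period k N \<ge> 1"
  by (cases k) (auto simp: cheb_period_def)

lemma inj_cheb_angle:
  assumes "N \<ge> 1" "a < b"
  shows "inj_on (\<lambda>j. cheb_point a b (cheb_angle k N j)) {0..N}"
proof (rule inj_onI)
  fix i j assume ij: "i \<in> {0..N}" "j \<in> {0..N}"
    and eq: "cheb_point a b (cheb_angle k N i) = cheb_point a b (cheb_angle k N j)"
  hence "cos (cheb_angle k N i) = cos (cheb_angle k N j)"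
    using assms by (simp add: cheb_point_def)
  hence "cheb_angle k N i = cheb_angle k N j"
    using cheb_angle_bounds[of N i k] cheb_angle_bounds[of N j k] assms(1) ij
      cos_inj_pi[of "cheb_angle k N i" "cheb_angle k N j"] by simp
  thus "i = j" using cheb_period_pos[OF assms(1), of k] by (simp add: cheb_angle_def)
qed

lemma card_cheb_nodes: "N \<ge> 1 \<Longrightarrow> a < b \<Longrightarrow> card (cheb_nodes k N a b) = N + 1"
  unfolding cheb_nodes_angle using card_image[OF inj_cheb_angle] by simp

lemma finite_cheb_nodes [simp]: "finite (cheb_nodes k N a b)"
  unfolding cheb_nodes_angle by simp

section \<open>The interpolation kernel and the Chebyshev coefficients of Lagrange
  polynomials\<close>

definition cheb_kernel :: "nat \<Rightarrow> real \<Rightarrow> real" where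
  "cheb_kernel P t = 1 + 2 * (\<Sum>k=1..<P. cos (real k * t)) + cos (real P * t)"

text \<open>This identifies the kernel as \<open>sin (P * t) * cot (t / 2)\<close>, the modified
  Dirichlet kernel (last term halved) of trigonometric interpolation at \<open>2 * P\<close>
  equispaced points. The sum telescopes after multiplication by \<open>sin (t / 2)\<close>, and the
  product form needs no exception at \<open>t = 0\<close>.\<close>

lemma sin_cheb_kernel:
  assumes "P \<ge> 1"
  shows "sin (t / 2) * cheb_kernel P t = sin (real P * t) * cos (t / 2)"
proof -
  have "sin (t / 2) * (1 + 2 * (\<Sum>k=1..<P. cos (real k * t))) = sin (real P * t - t / 2)"
    using assms
  proof (induction P rule: dec_induct)
    case (step n)
    have "2 * sin (t / 2) * cos (real n * t) = sin (real (Suc n) * t - t / 2) - sin (real n * t - t / 2)"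
    proof -
      have "real (Suc n) * t - t / 2 = real n * t + t / 2" by (simp add: field_simps)
      thus ?thesis by (simp add: sin_add sin_diff)
    qed
    moreover have "(\<Sum>k=1..<Suc n. cos (real k * t)) = (\<Sum>k=1..<n. cos (real k * t)) + cos (real n * t)"
      using step by simp
    ultimately show ?case using step by (simp add: algebra_simps)
  qed simp
  moreover have "sin (real P * t - t / 2) + sin (t / 2) * cos (real P * t) = sin (real P * t) * cos (t / 2)"
    by (simp add: sin_diff)
  ultimately show ?thesis by (simp add: cheb_kernel_def distrib_left algebra_simps)
qed

lemma cheb_kernel_zero:
  assumes "P \<ge> 1" "sin (real P * t) = 0" "sin (t / 2) \<noteq> 0"
  shows "cheb_kernel P t = 0"
  using sin_cheb_kernel[OF assms(1), of t] assms by simp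

lemma cheb_kernel_period:
  assumes "P \<ge> 1" "t = 0 \<or> t = 2 * pi"
  shows "cheb_kernel P t = 2 * real P"
proof -
  have "cos (real k * t) = 1" for k
    using assms cos_2npi[of k] by (auto simp: mult_ac)
  thus ?thesis using assms by (simp add: cheb_kernel_def of_nat_diff)
qed

lemma abs_cheb_kernel_le: "P \<ge> 1 \<Longrightarrow> \<bar>cheb_kernel P t\<bar> \<le> 2 * real P"
proof -
  assume P: "P \<ge> 1"
  have "\<bar>\<Sum>k=1..<P. cos (real k * t)\<bar> \<le> (\<Sum>k=1..<P. 1)"
    by (rule order_trans[OF sum_abs sum_mono]) simp
  hence "\<bar>\<Sum>k=1..<P. cos (real k * t)\<bar> \<le> real P - 1" using P by (simp add: of_nat_diff)
  moreover have "\<bar>cos (real P * t)\<bar> \<le> 1" by simp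
  ultimately show ?thesis unfolding cheb_kernel_def by linarith
qed

lemma abs_cheb_kernel_sin: "P \<ge> 1 \<Longrightarrow> \<bar>sin (t / 2)\<bar> * \<bar>cheb_kernel P t\<bar> \<le> 1"
  using sin_cheb_kernel[of P t] mult_mono[of "\<bar>sin (real P * t)\<bar>" 1 "\<bar>cos (t / 2)\<bar>" 1]
  by (simp flip: abs_mult)

text \<open>Adding the kernels for \<open>\<phi>\<close> and \<open>- \<phi>\<close> gives an even
  function of \<open>\<theta>\<close>, hence a polynomial in \<open>cos \<theta>\<close>.\<close>

lemma cheb_kernel_add:
  "cheb_kernel P (\<theta> - \<phi>) + cheb_kernel P (\<theta> + \<phi>) =
    2 * (1 + 2 * (\<Sum>k=1..<P. cos (real k * \<phi>) * cos (real k * \<theta>)) + cos (real P * \<phi>) * cos (real P * \<theta>))"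
proof -
  have c: "cos (real k * (\<theta> - \<phi>)) + cos (real k * (\<theta> + \<phi>)) = 2 * (cos (real k * \<phi>) * cos (real k * \<theta>))" for k
    by (simp add: algebra_simps cos_add cos_diff)
  have "(\<Sum>k=1..<P. cos (real k * (\<theta> - \<phi>))) + (\<Sum>k=1..<P. cos (real k * (\<theta> + \<phi>)))
     = 2 * (\<Sum>k=1..<P. cos (real k * \<phi>) * cos (real k * \<theta>))"
    unfolding sum.distrib[symmetric] c sum_distrib_left ..
  thus ?thesis using c[of P] unfolding cheb_kernel_def by simp
qed

text \<open>The matrix of a discrete cosine transform: entry \<open>k\<close>, \<open>j\<close> is
  the \<open>k\<close>-th Chebyshev coefficient of the Lagrange polynomial of node \<open>j\<close>.
  The frequencies 0 and \<open>cheb_period kd N\<close>, and for the second kind the two end nodes,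
  carry half weight.\<close>

definition cheb_coeff :: "cheb_kind \<Rightarrow> nat \<Rightarrow> nat \<Rightarrow> nat \<Rightarrow> real" where
  "cheb_coeff kd N k j =
     (if kd = Second_Kind \<and> (j = 0 \<or> j = N) then 1 / 2 else 1) / real (cheb_period kd N)
     * (if k = 0 \<or> k = cheb_period kd N then 1 else 2) * cos (real k * cheb_angle kd N j)"

lemma sum_cheb_coeff:
  assumes "N \<ge> 1" "j \<le> N"
  shows "(\<Sum>k\<le>N. cheb_coeff kd N k j * cos (real k * \<theta>))
    = (if kd = Second_Kind \<and> (j = 0 \<or> j = N) then 1 / 2 else 1) / (2 * real (cheb_period kd N))
      * (cheb_kernel (cheb_period kd N) (\<theta> - cheb_angle kd N j) + cheb_kernel (cheb_period kd N) (\<theta> + cheb_angle kd N j))"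
proof -
  define P \<phi> \<epsilon> where "P = cheb_period kd N" and "\<phi> = cheb_angle kd N j"
    and "\<epsilon> = (if kd = Second_Kind \<and> (j = 0 \<or> j = N) then 1 / 2 else (1::real))"
  have P1: "P \<ge> 1" using cheb_period_pos assms by (simp add: P_def)
  define g where "g k = cos (real k * \<phi>) * cos (real k * \<theta>)" for k
  \<comment> \<open>For the first kind the frequency \<open>P = N + 1\<close> is missing on the
    left, but its cosine vanishes at every node; for the second kind \<open>P = N\<close>.\<close>
  have "(\<Sum>k\<le>N. (if k = 0 \<or> k = P then 1 else 2) * g k) = (\<Sum>k\<le>P. (if k = 0 \<or> k = P then 1 else 2) * g k)"
  proof (cases kd)
    case First_Kind
    hence P: "P = Suc N" by (simp add: P_def cheb_period_def)
    have "real P * \<phi> = real j * pi + pi / 2"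
      using First_Kind by (simp add: P \<phi>_def cheb_angle_def cheb_period_def field_simps)
    hence "cos (real P * \<phi>) = 0" by (simp add: cos_add)
    thus ?thesis by (simp add: P g_def)
  next
    case Second_Kind
    thus ?thesis by (simp add: P_def cheb_period_def)
  qed
  also have "\<dots> = g 0 + (\<Sum>k=1..<P. 2 * g k) + g P"
  proof -
    have "{..P} = insert 0 (insert P {1..<P})" using P1 by auto
    thus ?thesis using P1 by (simp add: sum.insert_if)
  qed
  also have "\<dots> = (cheb_kernel P (\<theta> - \<phi>) + cheb_kernel P (\<theta> + \<phi>)) / 2"
    unfolding cheb_kernel_add by (simp add: g_def flip: sum_distrib_left)
  finally have *: "(\<Sum>k\<le>N. (if k = 0 \<or> k = P then 1 else 2) * g k) = \<dots>" .
  have "(\<Sum>k\<le>N. cheb_coeff kd N k j * cos (real k * \<theta>)) = \<epsilon> / real P * (\<Sum>k\<le>N. (if k = 0 \<or> k = P then 1 else 2) * g k)"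
    unfolding sum_distrib_left
    by (intro sum.cong refl) (simp add: cheb_coeff_def g_def P_def \<phi>_def \<epsilon>_def)
  thus ?thesis unfolding * by (simp add: P_def \<phi>_def \<epsilon>_def)
qed

text \<open>The kernel vanishes at every multiple of \<open>pi / P\<close> that is not a multiple of
  \<open>2 * pi\<close>, so only coincidences of node angles modulo \<open>2 * pi\<close> and sign
  count.\<close>

lemma cheb_coeff_node:
  assumes "N \<ge> 1" "i \<le> N" "j \<le> N"
  shows "(\<Sum>k\<le>N. cheb_coeff kd N k j * cos (real k * cheb_angle kd N i)) = (if i = j then 1 else 0)"
proof -
  define P where "P = cheb_period kd N"
  have P1: "P \<ge> 1" using cheb_period_pos assms by (simp add: P_def)
  have d: "cheb_angle kd N i - cheb_angle kd N j = (real i - real j) * pi / real P"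
    by (simp add: cheb_angle_def P_def diff_divide_distrib[symmetric] algebra_simps)
  have NP: "N \<le> P" by (cases kd) (auto simp: P_def cheb_period_def)
  have K1: "cheb_kernel P (cheb_angle kd N i - cheb_angle kd N j) = (if i = j then 2 * real P else 0)"
  proof (cases "i = j")
    case True
    thus ?thesis using cheb_kernel_period[OF P1] by simp
  next
    case False
    define x where "x = (real i - real j) * pi / real P / 2"
    have "\<bar>real i - real j\<bar> * pi \<le> real P * pi" using assms NP by (intro mult_right_mono) auto
    hence "\<bar>x\<bar> \<le> pi / 2" using P1 by (simp add: x_def abs_mult divide_simps mult_ac)
    hence "x > -pi" "x < pi" using pi_gt_zero by linarith+
    moreover have "x \<noteq> 0" using False P1 by (simp add: x_def)
    ultimately have "sin x \<noteq> 0" using sin_eq_0_pi by blast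
    moreover have "sin (real P * ((real i - real j) * pi / real P)) = 0"
      using P1 by (simp add: left_diff_distrib sin_diff)
    ultimately show ?thesis using cheb_kernel_zero[OF P1] False unfolding d x_def by simp
  qed
  \<comment> \<open>Two node angles add up to a multiple of \<open>2 * pi\<close> only when both
    belong to the same end node of the second kind. Then both kernels contribute
    \<open>2 * P\<close>, and the weight \<open>1 / 2\<close> restores the value 1.\<close>
  have K2: "cheb_kernel P (cheb_angle kd N i + cheb_angle kd N j)
      = (if kd = Second_Kind \<and> i = j \<and> (j = 0 \<or> j = N) then 2 * real P else 0)"
  proof (cases "kd = Second_Kind \<and> i = j \<and> (j = 0 \<or> j = N)")
    case True
    hence "cheb_angle kd N i + cheb_angle kd N j = 0 \<or> cheb_angle kd N i + cheb_angle kd N j = 2 * pi"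
      using assms by (auto simp: cheb_angle_def cheb_period_def)
    thus ?thesis using cheb_kernel_period[OF P1] True by simp
  next
    case False
    define n where "n = (case kd of First_Kind \<Rightarrow> i + j + 1 | Second_Kind \<Rightarrow> i + j)"
    have s: "cheb_angle kd N i + cheb_angle kd N j = real n * pi / real P"
      by (cases kd) (auto simp: cheb_angle_def P_def n_def add_divide_distrib[symmetric] algebra_simps)
    have n: "0 < n" "n < 2 * P"
      using False assms by (cases kd; auto simp: n_def P_def cheb_period_def)+
    have "real n * pi < 2 * real P * pi" using n by (intro mult_strict_right_mono) (simp_all flip: of_nat_less_iff)
    hence "real n * pi / real P / 2 < pi" using P1 by (simp add: field_simps)
    moreover have "0 < real n * pi / real P / 2" using n P1 by simp
    ultimately have "sin (real n * pi / real P / 2) \<noteq> 0" using sin_gt_zero by (metis less_irrefl)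
    moreover have "sin (real P * (real n * pi / real P)) = 0" using P1 by simp
    ultimately have "cheb_kernel P (real n * pi / real P) = 0" by (intro cheb_kernel_zero[OF P1])
    thus ?thesis unfolding s if_not_P[OF False] .
  qed
  show ?thesis
    unfolding sum_cheb_coeff[OF assms(1,3)] K1[unfolded P_def] K2[unfolded P_def]
    using P1 by (auto simp: P_def)
qed

lemma lagr_cheb:
  assumes "N \<ge> 1" "j \<le> N" "a < b"
  shows "lagr (cheb_nodes kd N a b) (cheb_point a b (cheb_angle kd N j))
    = (\<Sum>k\<le>N. smult (cheb_coeff kd N k j) (cheb_on a b k))"
proof (rule lagr_unique)
  have "degree (\<Sum>k\<le>N. smult (cheb_coeff kd N k j) (cheb_on a b k)) \<le> N"
    by (rule degree_sum_le) (use degree_cheb_on degree_smult_le in \<open>auto intro: order_trans\<close>)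
  thus "degree (\<Sum>k\<le>N. smult (cheb_coeff kd N k j) (cheb_on a b k)) < card (cheb_nodes kd N a b)"
    using assms by (simp add: card_cheb_nodes)
  show "cheb_point a b (cheb_angle kd N j) \<in> cheb_nodes kd N a b"
    using assms by (auto simp: cheb_nodes_angle)
  fix t assume "t \<in> cheb_nodes kd N a b"
  then obtain i where i: "i \<le> N" "t = cheb_point a b (cheb_angle kd N i)"
    by (auto simp: cheb_nodes_angle)
  moreover have "cheb_point a b (cheb_angle kd N i) = cheb_point a b (cheb_angle kd N j) \<longleftrightarrow> i = j"
    using inj_onD[OF inj_cheb_angle[OF assms(1,3)], of kd i j] i assms by auto
  ultimately show "poly (\<Sum>k\<le>N. smult (cheb_coeff kd N k j) (cheb_on a b k)) t
      = (if t = cheb_point a b (cheb_angle kd N j) then 1 else 0)"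
    using assms by (simp add: poly_sum poly_cheb_on cheb_coeff_node)
qed simp

section \<open>Logarithmic growth of the Lebesgue constant\<close>

lemma half_le_sin:
  assumes "0 \<le> x" "x \<le> pi / 2"
  shows "x / 2 \<le> sin x"
proof (cases "x \<le> pi / 3")
  case True
  have "sin 0 - 0 / 2 \<le> sin x - x / 2"
  proof (rule DERIV_nonneg_imp_nondecreasing[OF assms(1), of "\<lambda>x. sin x - x / 2"])
    fix y assume "0 \<le> y" "y \<le> x"
    hence "cos (pi / 3) \<le> cos y" using True pi_gt_zero by (intro cos_monotone_0_pi_le) auto
    hence "0 \<le> cos y - 1 / 2" by (simp add: cos_60)
    moreover have "((\<lambda>x. sin x - x / 2) has_real_derivative (cos y - 1 / 2)) (at y)"
      by (auto intro!: derivative_eq_intros)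
    ultimately show "\<exists>z. ((\<lambda>x. sin x - x / 2) has_real_derivative z) (at y) \<and> 0 \<le> z" by blast
  qed
  thus ?thesis by simp
next
  case False
  \<comment> \<open>Beyond \<open>pi / 3\<close> the monotonicity argument fails, but crude numbers
    suffice: \<open>sin x\<close> is at least 0.85, while \<open>x / 2\<close> is at most
    \<open>pi / 4\<close>, which is below 0.8.\<close>
  have "sin (pi / 3) \<le> sin x" using False assms pi_gt_zero by (intro sin_monotone_2pi_le) auto
  moreover have "17 / 10 \<le> sqrt 3" by (rule real_le_rsqrt) (simp add: power2_eq_square)
  moreover have "pi < 3.2" using pi_approx by simp
  ultimately show ?thesis using assms by (simp add: sin_60)
qed

text \<open>Comparison with distances from an integer costs a factor 3; then the sum splits into two
  harmonic sums, one on each side of that integer.\<close>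

lemma sum_inverse_dist_le_harm:
  fixes \<tau> :: real
  shows "(\<Sum>j\<le>N. 1 / max 1 \<bar>\<tau> - real j\<bar>) \<le> 6 * harm (N + 1)"
proof -
  \<comment> \<open>The floor of \<open>\<tau>\<close> clipped to \<open>{0..N}\<close>, where
    \<open>nat\<close> takes care of negative \<open>\<tau>\<close>. Distances from \<open>q\<close>
    exceed those from \<open>\<tau>\<close> by at most 1.\<close>
  define q where "q = min N (nat \<lfloor>\<tau>\<rfloor>)"
  have qN: "q \<le> N" by (simp add: q_def)
  have d: "\<bar>real q - real j\<bar> \<le> \<bar>\<tau> - real j\<bar> + 1" if "j \<le> N" for j
  proof (cases "\<tau> < 0")
    case True
    hence "q = 0" by (simp add: q_def)
    thus ?thesis using True by simp
  next
    case False
    hence f: "real (nat \<lfloor>\<tau>\<rfloor>) \<le> \<tau>" "\<tau> < real (nat \<lfloor>\<tau>\<rfloor>) + 1" by (simp_all add: of_nat_nat)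
    show ?thesis
    proof (cases "N \<le> nat \<lfloor>\<tau>\<rfloor>")
      case True
      hence "real N \<le> real (nat \<lfloor>\<tau>\<rfloor>)" by simp
      moreover have "q = N" using True by (simp add: q_def)
      ultimately show ?thesis using f that by simp
    next
      case False
      hence "q = nat \<lfloor>\<tau>\<rfloor>" by (simp add: q_def)
      thus ?thesis using f by linarith
    qed
  qed
  have h: "1 / max 1 \<bar>\<tau> - real j\<bar> \<le> 3 / (1 + \<bar>real q - real j\<bar>)" if "j \<le> N" for j
  proof -
    have "1 + \<bar>real q - real j\<bar> \<le> 3 * max 1 \<bar>\<tau> - real j\<bar>"
      using d[OF that] max.cobounded1[of 1 "\<bar>\<tau> - real j\<bar>"] max.cobounded2[of "\<bar>\<tau> - real j\<bar>" 1] by linarith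
    hence "1 / (3 * max 1 \<bar>\<tau> - real j\<bar>) \<le> 1 / (1 + \<bar>real q - real j\<bar>)"
      by (intro divide_left_mono mult_pos_pos) auto
    thus ?thesis by simp
  qed
  have "(\<Sum>j\<le>N. 1 / max 1 \<bar>\<tau> - real j\<bar>) \<le> (\<Sum>j\<le>N. 3 / (1 + \<bar>real q - real j\<bar>))"
    by (intro sum_mono h) auto
  also have "\<dots> \<le> (\<Sum>j\<le>q. 3 / (1 + \<bar>real q - real j\<bar>)) + (\<Sum>j=q..N. 3 / (1 + \<bar>real q - real j\<bar>))"
  proof -
    have "{..N} = {..q} \<union> {q..N}" using qN by auto
    moreover have "0 \<le> (\<Sum>j\<in>{..q} \<inter> {q..N}. 3 / (1 + \<bar>real q - real j\<bar>))"
      by (intro sum_nonneg) auto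
    ultimately show ?thesis by (simp add: sum_Un)
  qed
  also have "(\<Sum>j\<le>q. 3 / (1 + \<bar>real q - real j\<bar>)) = 3 * harm (q + 1)"
  proof -
    have "(\<Sum>j\<le>q. 3 / (1 + \<bar>real q - real j\<bar>)) = (\<Sum>k\<in>{1..q+1}. 3 / real k)"
      by (rule sum.reindex_bij_witness[of _ "\<lambda>k. q + 1 - k" "\<lambda>j. q + 1 - j"]) auto
    thus ?thesis by (simp add: harm_def sum_distrib_left divide_inverse)
  qed
  also have "(\<Sum>j=q..N. 3 / (1 + \<bar>real q - real j\<bar>)) = 3 * harm (N - q + 1)"
  proof -
    have "(\<Sum>j=q..N. 3 / (1 + \<bar>real q - real j\<bar>)) = (\<Sum>k\<in>{1..N-q+1}. 3 / real k)"
      by (rule sum.reindex_bij_witness[of _ "\<lambda>k. q + k - 1" "\<lambda>j. j - q + 1"]) (use qN in auto)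
    thus ?thesis by (simp add: harm_def sum_distrib_left divide_inverse)
  qed
  also have "3 * harm (q + 1) + 3 * harm (N - q + 1) \<le> 3 * harm (N + 1) + (3 * harm (N + 1) :: real)"
    using qN by (intro add_mono mult_left_mono harm_mono) auto
  finally show ?thesis by simp
qed

text \<open>The half sum lies between the half difference \<open>d\<close> and
  \<open>pi - d\<close>, where the sine is at least \<open>sin d\<close>. Thus the reflected kernel
  in \<open>\<theta> + \<phi>\<close> obeys the same bound as the one in
  \<open>\<theta> - \<phi>\<close>.\<close>

lemma abs_sin_half_sum_ge:
  assumes "\<theta> \<in> {0..pi}" "\<phi> \<in> {0..pi}"
  shows "\<bar>\<theta> - \<phi>\<bar> / 4 \<le> \<bar>sin ((\<theta> - \<phi>) / 2)\<bar>" "\<bar>\<theta> - \<phi>\<bar> / 4 \<le> \<bar>sin ((\<theta> + \<phi>) / 2)\<bar>"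
proof -
  define d where "d = \<bar>\<theta> - \<phi>\<bar> / 2"
  have d: "0 \<le> d" "d \<le> pi / 2" using assms by (auto simp: d_def)
  have *: "d / 2 \<le> sin d" using half_le_sin d by blast
  have "\<bar>sin ((\<theta> - \<phi>) / 2)\<bar> = \<bar>sin d\<bar>"
    using sin_minus[of "(\<theta> - \<phi>) / 2"] by (auto simp: d_def abs_if minus_divide_left)
  thus "\<bar>\<theta> - \<phi>\<bar> / 4 \<le> \<bar>sin ((\<theta> - \<phi>) / 2)\<bar>" using * d by (simp add: d_def)
  have "sin d \<le> sin ((\<theta> + \<phi>) / 2)"
  proof (cases "(\<theta> + \<phi>) / 2 \<le> pi / 2")
    case True
    thus ?thesis using assms d by (intro sin_monotone_2pi_le) (auto simp: d_def)
  next
    case False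
    have "sin d \<le> sin (pi - (\<theta> + \<phi>) / 2)"
      using assms False by (intro sin_monotone_2pi_le) (simp_all add: d_def field_simps abs_if)
    thus ?thesis by simp
  qed
  thus "\<bar>\<theta> - \<phi>\<bar> / 4 \<le> \<bar>sin ((\<theta> + \<phi>) / 2)\<bar>" using * d by (simp add: d_def)
qed

text \<open>Near the node the trivial kernel bound \<open>2 * P\<close> is used, away from it the
  bound by the reciprocal of \<open>sin (t / 2)\<close>. The factor \<open>P / pi\<close> measures
  angular distance in units of the node spacing.\<close>

lemma abs_lagr_cheb_le:
  fixes kd :: cheb_kind
  assumes "N \<ge> 1" "j \<le> N" "a < b" "\<theta> \<in> {0..pi}"
  defines "P \<equiv> real (cheb_period kd N)"
  shows "\<bar>poly (lagr (cheb_nodes kd N a b) (cheb_point a b (cheb_angle kd N j))) (cheb_point a b \<theta>)\<bar>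
    \<le> 2 / max 1 (P / pi * \<bar>\<theta> - cheb_angle kd N j\<bar>)"
proof -
  define \<phi> where "\<phi> = cheb_angle kd N j"
  have \<phi>: "\<phi> \<in> {0..pi}" using cheb_angle_bounds assms by (simp add: \<phi>_def)
  define n where "n = cheb_period kd N"
  have n1: "n \<ge> 1" using cheb_period_pos assms by (simp add: n_def)
  define m where "m = max 1 (P / pi * \<bar>\<theta> - \<phi>\<bar>)"
  have K: "\<bar>cheb_kernel n t\<bar> \<le> 2 * P / m" if t: "\<bar>\<theta> - \<phi>\<bar> / 4 \<le> \<bar>sin (t / 2)\<bar>" for t
  proof (cases "P / pi * \<bar>\<theta> - \<phi>\<bar> \<le> 1")
    case True
    thus ?thesis using abs_cheb_kernel_le[OF n1, of t] by (simp add: m_def P_def n_def)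
  next
    case False
    hence m: "m = P / pi * \<bar>\<theta> - \<phi>\<bar>" by (simp add: m_def)
    have pos: "\<bar>\<theta> - \<phi>\<bar> > 0" using False by (metis abs_ge_zero less_eq_real_def mult_zero_right zero_le_one not_less)
    have "\<bar>\<theta> - \<phi>\<bar> / 4 * \<bar>cheb_kernel n t\<bar> \<le> 1"
      using mult_right_mono[OF t, of "\<bar>cheb_kernel n t\<bar>"] abs_cheb_kernel_sin[OF n1, of t] by linarith
    hence "\<bar>cheb_kernel n t\<bar> \<le> 4 / \<bar>\<theta> - \<phi>\<bar>" using pos by (simp add: field_simps)
    also have "\<dots> \<le> 2 * pi / \<bar>\<theta> - \<phi>\<bar>" using pos pi_ge_two by (intro divide_right_mono) auto
    also have "\<dots> = 2 * P / m" using n1 by (simp add: m P_def n_def)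
    finally show ?thesis .
  qed
  have "poly (lagr (cheb_nodes kd N a b) (cheb_point a b \<phi>)) (cheb_point a b \<theta>)
     = (if kd = Second_Kind \<and> (j = 0 \<or> j = N) then 1 / 2 else 1) / (2 * P) * (cheb_kernel n (\<theta> - \<phi>) + cheb_kernel n (\<theta> + \<phi>))"
    unfolding \<phi>_def P_def n_def lagr_cheb[OF assms(1-3)] sum_cheb_coeff[OF assms(1,2), symmetric]
    using assms by (simp add: poly_sum poly_cheb_on)
  hence "\<bar>poly (lagr (cheb_nodes kd N a b) (cheb_point a b \<phi>)) (cheb_point a b \<theta>)\<bar>
      = (if kd = Second_Kind \<and> (j = 0 \<or> j = N) then 1 / 2 else 1) / (2 * P) * \<bar>cheb_kernel n (\<theta> - \<phi>) + cheb_kernel n (\<theta> + \<phi>)\<bar>"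
    by (simp add: abs_mult P_def)
  also have "\<dots> \<le> 1 / (2 * P) * (2 * P / m + 2 * P / m)"
    by (intro mult_mono divide_right_mono order_trans[OF abs_triangle_ineq] add_mono K
         abs_sin_half_sum_ge[OF assms(4) \<phi>]) (auto simp: P_def)
  also have "\<dots> = 2 / m" using n1 by (simp add: P_def n_def)
  finally show ?thesis unfolding m_def \<phi>_def .
qed

lemma lebesgue_constant_cheb:
  assumes "N \<ge> 1" "a < b" "t \<in> {a..b}"
  shows "(\<Sum>s\<in>cheb_nodes kd N a b. \<bar>poly (lagr (cheb_nodes kd N a b) s) t\<bar>) \<le> 36 * ln (real (N + 1))"
proof -
  obtain \<theta> where \<theta>: "\<theta> \<in> {0..pi}" "t = cheb_point a b \<theta>" using cheb_point_surj[OF assms(2,3)] by blast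
  define P where "P = real (cheb_period kd N)"
  have P1: "P \<ge> 1" using cheb_period_pos[OF assms(1), of kd] by (simp add: P_def)
  \<comment> \<open>In units of the angular spacing the nodes are consecutive integers, up to the
    offset \<open>1 / 2\<close> of the first kind; \<open>\<tau>\<close> is the position of
    \<open>t\<close> on this scale.\<close>
  define \<tau> where "\<tau> = P / pi * \<theta> - (case kd of First_Kind \<Rightarrow> 1 / 2 | Second_Kind \<Rightarrow> 0)"
  have \<tau>: "P / pi * \<bar>\<theta> - cheb_angle kd N j\<bar> = \<bar>\<tau> - real j\<bar>" for j
  proof -
    have "P / pi * (\<theta> - cheb_angle kd N j) = \<tau> - real j"
      using P1 by (simp add: \<tau>_def cheb_angle_def P_def field_simps)
    hence "\<bar>P / pi\<bar> * \<bar>\<theta> - cheb_angle kd N j\<bar> = \<bar>\<tau> - real j\<bar>" by (metis abs_mult)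
    thus ?thesis using P1 by simp
  qed
  have "(\<Sum>s\<in>cheb_nodes kd N a b. \<bar>poly (lagr (cheb_nodes kd N a b) s) t\<bar>)
      = (\<Sum>j\<le>N. \<bar>poly (lagr (cheb_nodes kd N a b) (cheb_point a b (cheb_angle kd N j))) t\<bar>)"
    by (subst (1) cheb_nodes_angle, subst sum.reindex[OF inj_cheb_angle[OF assms(1,2)]]) (simp add: atMost_atLeast0)
  also have "\<dots> \<le> (\<Sum>j\<le>N. 2 * (1 / max 1 \<bar>\<tau> - real j\<bar>))"
  proof (rule sum_mono)
    fix j assume "j \<in> {..N}"
    thus "\<bar>poly (lagr (cheb_nodes kd N a b) (cheb_point a b (cheb_angle kd N j))) t\<bar> \<le> 2 * (1 / max 1 \<bar>\<tau> - real j\<bar>)"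
      using abs_lagr_cheb_le[OF assms(1) _ assms(2) \<theta>(1), of j kd] unfolding P_def[symmetric] \<tau> \<theta>(2) by simp
  qed
  also have "\<dots> \<le> 2 * (6 * harm (N + 1))"
    unfolding sum_distrib_left[symmetric] by (intro mult_left_mono sum_inverse_dist_le_harm) auto
  \<comment> \<open>The constant 36 is \<open>2 * 6 * 3\<close>: the kernel bound, the harmonic
    sums, and the comparison of \<open>harm (N + 1)\<close> with the logarithm, where
    \<open>N \<ge> 1\<close> lets the additive 1 be absorbed.\<close>
  also have "harm (N + 1) \<le> ln (real (N + 1)) + 1"
    using decseqD[OF decseq_harm_diff_ln, of 0 N] by (simp add: harm_Suc harm_expand(1))
  also have "\<dots> \<le> 3 * ln (real (N + 1))"
  proof -
    have "ln 2 \<le> ln (real (N + 1))" using assms by (subst ln_le_cancel_iff) auto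
    thus ?thesis using ln2_ge_two_thirds by linarith
  qed
  finally show ?thesis by simp
qed

section \<open>Discrete orthogonality on first-kind nodes\<close>

lemma sum_cos_first_kind:
  assumes "0 < m" "m < 2 * (N + 1)"
  shows "(\<Sum>j\<le>N. cos (real m * cheb_angle First_Kind N j)) = 0"
proof -
  define h where "h = real m * pi / (2 * real (N + 1))"
  have ang: "real m * cheb_angle First_Kind N j = (2 * real j + 1) * h" for j
    by (simp add: h_def cheb_angle_def cheb_period_def field_simps)
  have "2 * sin h * (\<Sum>j\<le>n. cos ((2 * real j + 1) * h)) = sin (2 * real (Suc n) * h)" for n
  proof (induction n)
    case 0
    show ?case using sin_double[of h] by simp
  next
    case (Suc n)
    have "sin (2 * real (Suc (Suc n)) * h) - sin (2 * real (Suc n) * h) = 2 * sin h * cos ((2 * real (Suc n) + 1) * h)"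
    proof -
      have "2 * real (Suc (Suc n)) * h = (2 * real (Suc n) + 1) * h + h"
        "2 * real (Suc n) * h = (2 * real (Suc n) + 1) * h - h" by (simp_all add: algebra_simps)
      thus ?thesis by (simp only: sin_add sin_diff) simp
    qed
    thus ?case using Suc by (simp add: distrib_left)
  qed
  from this[of N] have "2 * sin h * (\<Sum>j\<le>N. cos ((2 * real j + 1) * h)) = sin (2 * real (Suc N) * h)" .
  also have "2 * real (Suc N) * h = real m * pi" by (simp add: h_def)
  finally have "2 * sin h * (\<Sum>j\<le>N. cos ((2 * real j + 1) * h)) = sin (real m * pi)" .
  \<comment> \<open>The upper bound on \<open>m\<close> excludes aliasing: at frequency
    \<open>2 * (N + 1)\<close> the cosine is constant on the nodes.\<close>
  moreover have "sin h \<noteq> 0"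
  proof -
    have "real m * pi < (2 * real (N + 1)) * pi" using assms by (intro mult_strict_right_mono) (simp_all flip: of_nat_less_iff)
    hence "h < pi" by (simp add: h_def field_simps)
    moreover have "h > 0" using assms by (simp add: h_def)
    ultimately show ?thesis using sin_gt_zero by (metis less_irrefl)
  qed
  ultimately show ?thesis unfolding ang by simp
qed

text \<open>This lets a cosine sum of degree below \<open>k\<close> be subtracted without changing
  the \<open>k\<close>-th coefficient. By the product formula only the frequencies
  \<open>k - l\<close> and \<open>k + l\<close> occur, and both stay in the alias-free
  range.\<close>

lemma cheb_coeff_orthogonal:
  assumes "l < k" "k \<le> N"
  shows "(\<Sum>j\<le>N. cheb_coeff First_Kind N k j * cos (real l * cheb_angle First_Kind N j)) = 0"
proof -
  have "(\<Sum>j\<le>N. cos (real k * cheb_angle First_Kind N j) * cos (real l * cheb_angle First_Kind N j))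
     = ((\<Sum>j\<le>N. cos (real (k - l) * cheb_angle First_Kind N j)) + (\<Sum>j\<le>N. cos (real (k + l) * cheb_angle First_Kind N j))) / 2"
    unfolding sum.distrib[symmetric] sum_divide_distrib using assms
    by (intro sum.cong refl) (simp add: cos_times_cos of_nat_diff algebra_simps)
  also have "\<dots> = 0" using assms sum_cos_first_kind[of "k - l" N] sum_cos_first_kind[of "k + l" N] by simp
  finally have "(\<Sum>j\<le>N. cos (real k * cheb_angle First_Kind N j) * cos (real l * cheb_angle First_Kind N j)) = 0" .
  thus ?thesis by (simp add: cheb_coeff_def mult.assoc flip: sum_distrib_left sum_divide_distrib)
qed

text \<open>The bound is uniform in the grid size, unlike the Lebesgue constant: extracting a
  coefficient costs no logarithm.\<close>

lemma sum_abs_cheb_coeff_first_kind: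
  "(\<Sum>j\<le>N. \<bar>cheb_coeff First_Kind N k j\<bar>) \<le> 2"
proof -
  have "(\<Sum>j\<le>N. \<bar>cheb_coeff First_Kind N k j\<bar>) \<le> (\<Sum>j\<le>N. 2 / (real N + 1))"
  proof (rule sum_mono)
    fix j
    have "\<bar>cheb_coeff First_Kind N k j\<bar> = 1 / (real N + 1) * (if k = 0 \<or> k = N + 1 then 1 else 2) * \<bar>cos (real k * cheb_angle First_Kind N j)\<bar>"
      by (simp add: cheb_coeff_def abs_mult cheb_period_def)
    also have "\<dots> \<le> 1 / (real N + 1) * 2 * 1"
      by (intro mult_mono) auto
    finally show "\<bar>cheb_coeff First_Kind N k j\<bar> \<le> 2 / (real N + 1)" by simp
  qed
  also have "\<dots> = 2" by (simp add: field_simps)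
  finally show ?thesis .
qed

section \<open>Tensor-product interpolation\<close>

definition upd :: "real^'n \<Rightarrow> 'n \<Rightarrow> real \<Rightarrow> real^'n" where
  "upd x j t = (\<chi> i. if i = j then t else x $ i)"

definition merge :: "'n set \<Rightarrow> ('n \<Rightarrow> real) \<Rightarrow> real^'n \<Rightarrow> real^'n" where
  "merge J y x = (\<chi> i. if i \<in> J then y i else x $ i)"

text \<open>Univariate functionals with weights \<open>W i\<close> act in the coordinates of
  \<open>J\<close>, the others staying at those of \<open>x\<close>. Lagrange values as weights give
  interpolation at \<open>x\<close>, Chebyshev weights give coefficients; partial sets
  \<open>J\<close> permit induction over the coordinates.\<close>

definition tensor_sum ::
  "('n::finite \<Rightarrow> real \<Rightarrow> real) \<Rightarrow> ('n \<Rightarrow> real set) \<Rightarrow> 'n set \<Rightarrow> (real^'n \<Rightarrow> 'b::real_normed_vector) \<Rightarrow> real^'n \<Rightarrow> 'b" where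
  "tensor_sum W X J f x = (\<Sum>y\<in>PiE J X. (\<Prod>i\<in>J. W i (y i)) *\<^sub>R f (merge J y x))"

definition grid :: "('n \<Rightarrow> real set) \<Rightarrow> (real^'n) set" where
  "grid X = {x. \<forall>i. x $ i \<in> X i}"

lemma upd_same [simp]: "upd x j (x $ j) = x"
  by (simp add: upd_def vec_eq_iff)

lemma upd_nth [simp]: "upd x j t $ i = (if i = j then t else x $ i)"
  by (simp add: upd_def)

lemma upd_mem_cbox: "x \<in> cbox a b \<Longrightarrow> t \<in> {a $ j..b $ j} \<Longrightarrow> upd x j t \<in> cbox a b"
  by (auto simp: mem_box_cart)

lemma merge_nth [simp]: "merge J y x $ i = (if i \<in> J then y i else x $ i)"
  by (simp add: merge_def)

lemma tensor_sum_empty [simp]: "tensor_sum W X {} f x = f x"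
  by (simp add: tensor_sum_def merge_def)

text \<open>Peeling off one coordinate reduces a multivariate estimate to a univariate one inside a
  tensor sum over the rest.\<close>

lemma tensor_sum_insert:
  assumes "j \<notin> J"
  shows "tensor_sum W X (insert j J) f x = tensor_sum W X J (\<lambda>z. \<Sum>s\<in>X j. W j s *\<^sub>R f (upd z j s)) x"
proof -
  have "tensor_sum W X (insert j J) f x
     = (\<Sum>(s, y)\<in>X j \<times> PiE J X. (\<Prod>i\<in>insert j J. W i ((y(j := s)) i)) *\<^sub>R f (merge (insert j J) (y(j := s)) x))"
    unfolding tensor_sum_def PiE_insert_eq
    by (subst sum.reindex[OF inj_combinator[OF assms]]) (simp add: case_prod_unfold)
  also have "\<dots> = (\<Sum>(s, y)\<in>X j \<times> PiE J X. (\<Prod>i\<in>J. W i (y i)) *\<^sub>R W j s *\<^sub>R f (upd (merge J y x) j s))"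
  proof (intro sum.cong refl, clarify)
    fix s y
    have "(\<Prod>i\<in>insert j J. W i ((y(j := s)) i)) = W j s * (\<Prod>i\<in>J. W i (y i))"
      using assms by (subst prod.insert) (auto intro!: prod.cong)
    moreover have "merge (insert j J) (y(j := s)) x = upd (merge J y x) j s"
      using assms by (auto simp: vec_eq_iff)
    ultimately show "(\<Prod>i\<in>insert j J. W i ((y(j := s)) i)) *\<^sub>R f (merge (insert j J) (y(j := s)) x)
       = (\<Prod>i\<in>J. W i (y i)) *\<^sub>R W j s *\<^sub>R f (upd (merge J y x) j s)" by (simp add: mult.commute)
  qed
  also have "\<dots> = (\<Sum>y\<in>PiE J X. \<Sum>s\<in>X j. (\<Prod>i\<in>J. W i (y i)) *\<^sub>R W j s *\<^sub>R f (upd (merge J y x) j s))"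
    by (subst sum.cartesian_product[symmetric]) (rule sum.swap)
  finally show ?thesis by (simp add: tensor_sum_def scaleR_sum_right)
qed

lemma tensor_sum_cong:
  assumes "\<And>y. y \<in> PiE J X \<Longrightarrow> f (merge J y x) = g (merge J y x)"
  shows "tensor_sum W X J f x = tensor_sum W X J g x"
  using assms by (simp add: tensor_sum_def)

lemma tensor_sum_diff: "tensor_sum W X J (\<lambda>z. f z - g z) x = tensor_sum W X J f x - tensor_sum W X J g x"
  by (simp add: tensor_sum_def scaleR_diff_right sum_subtractf)

lemma norm_tensor_sum_le:
  assumes "\<And>i. finite (X i)" "\<And>y. y \<in> PiE J X \<Longrightarrow> norm (f (merge J y x)) \<le> c"
  shows "norm (tensor_sum W X J f x) \<le> (\<Prod>i\<in>J. \<Sum>s\<in>X i. \<bar>W i s\<bar>) * c"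
proof -
  have "norm (tensor_sum W X J f x) \<le> (\<Sum>y\<in>PiE J X. \<bar>\<Prod>i\<in>J. W i (y i)\<bar> * c)"
    unfolding tensor_sum_def
    by (rule order_trans[OF norm_sum]) (intro sum_mono, simp add: assms mult_left_mono)
  also have "\<dots> = (\<Prod>i\<in>J. \<Sum>s\<in>X i. \<bar>W i s\<bar>) * c"
    by (subst prod_sum_PiE) (auto simp: assms abs_prod sum_distrib_right)
  finally show ?thesis .
qed

lemma tensor_sum_UNIV:
  "tensor_sum W X UNIV f x = (\<Sum>z\<in>grid X. (\<Prod>i\<in>UNIV. W i (z $ i)) *\<^sub>R f z)"
  unfolding tensor_sum_def grid_def
  by (rule sum.reindex_bij_witness[of _ vec_nth vec_lambda]) (auto simp: merge_def PiE_UNIV_domain)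

lemma finite_grid:
  assumes "\<And>i. finite (X i)"
  shows "finite (grid X)"
proof -
  have "grid X = (\<lambda>y. \<chi> i. y i) ` PiE UNIV X"
  proof safe
    fix z assume "z \<in> grid X"
    hence "(\<lambda>i. z $ i) \<in> PiE UNIV X" by (auto simp: grid_def)
    thus "z \<in> (\<lambda>y. \<chi> i. y i) ` PiE UNIV X" by (intro image_eqI[of _ _ "\<lambda>i. z $ i"]) auto
  qed (auto simp: grid_def PiE_UNIV_domain)
  thus ?thesis using assms by (simp add: finite_PiE)
qed

text \<open>A criterion free of multivariate coefficients: coordinatewise interpolation only sees
  restrictions to lines parallel to the axes. It is easily checked both for \<open>Q_space N\<close>
  and for total degree at most \<open>N\<close>.\<close>

definition coord_poly :: "nat \<Rightarrow> (real^'n \<Rightarrow> real) \<Rightarrow> bool" where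
  "coord_poly N p \<longleftrightarrow> (\<forall>j x. \<exists>q. degree q \<le> N \<and> (\<forall>t. p (upd x j t) = poly q t))"

definition tensor_lagr :: "('n::finite \<Rightarrow> real set) \<Rightarrow> real^'n \<Rightarrow> real^'n \<Rightarrow> real" where
  "tensor_lagr X z x = (\<Prod>i\<in>UNIV. poly (lagr (X i) (z $ i)) (x $ i))"

lemma tensor_sum_interpolation:
  assumes X: "\<And>i. finite (X i)" "\<And>i. card (X i) = N + 1" and p: "coord_poly N p"
  shows "tensor_sum (\<lambda>i s. poly (lagr (X i) s) (x $ i)) X J p x = p x"
proof (induction J rule: finite_induct[OF finite])
  case (2 j J)
  have "tensor_sum (\<lambda>i s. poly (lagr (X i) s) (x $ i)) X (insert j J) p x
      = tensor_sum (\<lambda>i s. poly (lagr (X i) s) (x $ i)) X J p x"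
    unfolding tensor_sum_insert[OF 2(2)]
  proof (rule tensor_sum_cong)
    fix y
    let ?z = "merge J y x"
    obtain q where q: "degree q \<le> N" "\<And>t. p (upd ?z j t) = poly q t"
      using p[unfolded coord_poly_def, rule_format, of ?z j] by blast
    have "(\<Sum>s\<in>X j. poly (lagr (X j) s) (x $ j) *\<^sub>R p (upd ?z j s)) = poly q (x $ j)"
      using lagr_interpolation[of "X j" q "x $ j"] X q by (simp add: mult.commute)
    also have "\<dots> = p ?z"
    proof -
      \<comment> \<open>The weights are Lagrange values at \<open>x $ j\<close>, while
        \<open>p\<close> is restricted to a line through \<open>?z\<close>. As \<open>j\<close> is
        not in \<open>J\<close>, the two points share this coordinate.\<close>
      have "?z $ j = x $ j" using 2 by simp
      hence "upd ?z j (x $ j) = ?z" by (metis upd_same)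
      thus ?thesis using q(2)[of "x $ j"] by simp
    qed
    finally show "(\<Sum>s\<in>X j. poly (lagr (X j) s) (x $ j) *\<^sub>R p (upd ?z j s)) = p ?z" .
  qed
  thus ?case using 2 by simp
qed simp

lemma tensor_lagr_interpolation:
  fixes x :: "real^'n::finite"
  assumes "\<And>i. finite (X i)" "\<And>i. card (X i) = N + 1" "coord_poly N p"
  shows "p x = (\<Sum>z\<in>grid X. p z * tensor_lagr X z x)"
  using tensor_sum_interpolation[OF assms, where x = x and J = UNIV, symmetric]
  by (simp add: tensor_sum_UNIV tensor_lagr_def mult.commute)

lemma coord_poly_Q_space:
  fixes p :: "real^'n::finite \<Rightarrow> real"
  assumes "p \<in> Q_space N"
  shows "coord_poly N p"
  unfolding coord_poly_def
proof (intro allI)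
  fix j :: 'n and x :: "real^'n"
  obtain c where p: "p = (\<lambda>x. \<Sum>\<alpha> | \<forall>i. \<alpha> i \<le> N. c \<alpha> * monomial_fun \<alpha> x)"
    using assms by (auto simp: Q_space_def)
  define q where "q = (\<Sum>\<alpha> | \<forall>i. \<alpha> i \<le> N. monom (c \<alpha> * (\<Prod>i\<in>UNIV - {j}. x $ i ^ \<alpha> i)) (\<alpha> j))"
  have fin: "finite {\<alpha> :: 'n \<Rightarrow> nat. \<forall>i. \<alpha> i \<le> N}"
  proof -
    have "{\<alpha> :: 'n \<Rightarrow> nat. \<forall>i. \<alpha> i \<le> N} = PiE UNIV (\<lambda>_. {..N})" by (auto simp: PiE_UNIV_domain)
    thus ?thesis by (simp add: finite_PiE)
  qed
  have "degree q \<le> N"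
    unfolding q_def using fin by (intro degree_sum_le) (auto intro: order_trans[OF degree_monom_le])
  moreover have "p (upd x j t) = poly q t" for t
  proof -
    have "monomial_fun \<alpha> (upd x j t) = (\<Prod>i\<in>UNIV - {j}. x $ i ^ \<alpha> i) * t ^ \<alpha> j" for \<alpha>
      unfolding monomial_fun_def by (subst prod.remove[of _ j]) (auto intro!: prod.cong)
    thus ?thesis by (simp add: p q_def poly_sum poly_monom mult.assoc)
  qed
  ultimately show "\<exists>q. degree q \<le> N \<and> (\<forall>t. p (upd x j t) = poly q t)" by blast
qed

lemma continuous_on_Q_space: "p \<in> Q_space N \<Longrightarrow> continuous_on UNIV p"
  unfolding Q_space_def monomial_fun_def by (auto intro!: continuous_intros)

lemma prod_poly_in_Q_space:
  fixes q :: "'n::finite \<Rightarrow> real poly"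
  assumes "\<And>i. degree (q i) \<le> N"
  shows "(\<lambda>x. \<Prod>i\<in>UNIV. poly (q i) (x $ i)) \<in> Q_space N"
proof -
  have P: "PiE UNIV (\<lambda>_. {..N}) = {\<alpha> :: 'n \<Rightarrow> nat. \<forall>i. \<alpha> i \<le> N}" by (auto simp: PiE_UNIV_domain)
  have e: "poly (q i) t = (\<Sum>k\<le>N. coeff (q i) k * t ^ k)" for i t
    unfolding poly_altdef using assms[of i] by (intro sum.mono_neutral_left) (auto simp: coeff_eq_0 not_le)
  have "(\<Prod>i\<in>UNIV. poly (q i) (x $ i))
      = (\<Sum>\<alpha> | \<forall>i. \<alpha> i \<le> N. (\<Prod>i\<in>UNIV. coeff (q i) (\<alpha> i)) * monomial_fun \<alpha> x)" for x :: "real^'n"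
    unfolding e by (subst prod_sum_PiE) (simp_all add: P prod.distrib monomial_fun_def)
  thus ?thesis unfolding Q_space_def
    by (intro CollectI exI[of _ "\<lambda>\<alpha>. \<Prod>i\<in>UNIV. coeff (q i) (\<alpha> i)"] ext)
qed

lemma tensor_lagr_in_Q_space:
  assumes "\<And>i. finite (X i)" "\<And>i. card (X i) = N + 1" "z \<in> grid X"
  shows "tensor_lagr X z \<in> Q_space N"
  unfolding tensor_lagr_def [abs_def]
proof (rule prod_poly_in_Q_space)
  fix i show "degree (lagr (X i) (z $ i)) \<le> N"
    using degree_lagr[of "X i" "z $ i"] assms by (auto simp: grid_def)
qed

lemma tensor_lagr_node:
  assumes "\<And>i. finite (X i)" "z \<in> grid X" "x \<in> grid X"
  shows "tensor_lagr X z x = (if x = z then 1 else 0)"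
proof -
  have "tensor_lagr X z x = (\<Prod>i\<in>UNIV. if x $ i = z $ i then 1 else 0)"
    unfolding tensor_lagr_def using assms by (intro prod.cong) (auto simp: grid_def poly_lagr_node)
  also have "\<dots> = (if x = z then 1 else 0)"
    by (auto simp: vec_eq_iff intro!: prod_zero)
  finally show ?thesis .
qed

text \<open>Interpolation reproduces every member of \<open>Q_space N\<close>, so its nodal values
  determine it. This is unisolvence, and it justifies the definite description in
  \<open>lagrange_poly\<close>.\<close>

lemma lagrange_poly_eq:
  assumes "\<And>i. finite (X i)" "\<And>i. card (X i) = N + 1" "y \<in> grid X"
  shows "lagrange_poly N (grid X) y = tensor_lagr X y"
  unfolding lagrange_poly_def
proof (rule the_equality)
  show "tensor_lagr X y \<in> Q_space N \<and> (\<forall>x\<in>grid X. tensor_lagr X y x = (if x = y then 1 else 0))"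
    using tensor_lagr_in_Q_space[OF assms] tensor_lagr_node[OF assms(1,3)] by blast
  fix p assume p: "p \<in> Q_space N \<and> (\<forall>x\<in>grid X. p x = (if x = y then 1 else 0))"
  show "p = tensor_lagr X y"
  proof
    fix x
    have "p x = (\<Sum>z\<in>grid X. p z * tensor_lagr X z x)"
      using p coord_poly_Q_space by (intro tensor_lagr_interpolation[OF assms(1,2)]) blast
    also have "\<dots> = (\<Sum>z\<in>grid X. (if z = y then 1 else 0) * tensor_lagr X z x)"
      using p by (intro sum.cong) auto
    also have "\<dots> = tensor_lagr X y x"
      using assms(3) finite_grid[of X, OF assms(1)] by (simp add: if_distrib[of "\<lambda>c. c * _"] sum.delta cong: if_cong)
    finally show "p x = tensor_lagr X y x" .
  qed
qed

section \<open>Interpolation error on Chebyshev grids\<close>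

lemma cheb_grid_eq: "cheb_grid k N a b = grid (\<lambda>i. cheb_nodes (k i) N (a $ i) (b $ i))"
  by (simp add: cheb_grid_def grid_def)

lemma cheb_nodes_subset: "N \<ge> 1 \<Longrightarrow> a < b \<Longrightarrow> cheb_nodes k N a b \<subseteq> {a..b}"
  unfolding cheb_nodes_angle using cheb_point_in by blast

lemma cheb_grid_subset_cbox:
  fixes a b :: "real^'n::finite"
  assumes "N \<ge> 1" "\<And>i. a $ i < b $ i"
  shows "cheb_grid k N a b \<subseteq> cbox a b"
proof
  fix x assume x: "x \<in> cheb_grid k N a b"
  have "x $ i \<in> {a $ i..b $ i}" for i
    using x cheb_nodes_subset[OF assms(1) assms(2)[of i], of "k i"] by (auto simp: cheb_grid_def)
  thus "x \<in> cbox a b" by (auto simp: mem_box_cart)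
qed

text \<open>Lebesgue's lemma: interpolation reproduces the cosine sum, a polynomial of degree at
  most \<open>N\<close>, so only the deviation from it counts, once directly and once through the
  Lebesgue constant.\<close>

lemma cheb_interpolation_error:
  fixes g :: "real \<Rightarrow> complex"
  assumes "N \<ge> 1" "a < b" "t \<in> {a..b}"
    and g: "\<And>\<theta>. cmod (g (cheb_point a b \<theta>) - (\<Sum>k\<le>N. c k * of_real (cos (real k * \<theta>)))) \<le> e"
  shows "cmod (g t - (\<Sum>s\<in>cheb_nodes kd N a b. poly (lagr (cheb_nodes kd N a b) s) t *\<^sub>R g s)) \<le> (1 + 36 * ln (real (N + 1))) * e"
proof -
  define X where "X = cheb_nodes kd N a b"
  define p where "p u = (\<Sum>k\<le>N. c k * of_real (poly (cheb_on a b k) u))" for u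
  have gp: "cmod (g u - p u) \<le> e" if u: "u \<in> {a..b}" for u
  proof -
    obtain \<theta> where "u = cheb_point a b \<theta>" using cheb_point_surj[OF assms(2) u] by blast
    thus ?thesis using g[of \<theta>] assms by (simp add: p_def poly_cheb_on)
  qed
  have "p t = (\<Sum>s\<in>X. poly (lagr X s) t *\<^sub>R p s)"
  proof -
    have "poly (cheb_on a b k) t = (\<Sum>s\<in>X. poly (cheb_on a b k) s * poly (lagr X s) t)" if "k \<le> N" for k
      using that assms degree_cheb_on[of a b k] by (intro lagr_interpolation) (auto simp: X_def card_cheb_nodes)
    hence "p t = (\<Sum>k\<le>N. \<Sum>s\<in>X. c k * of_real (poly (cheb_on a b k) s * poly (lagr X s) t))"
      unfolding p_def by (intro sum.cong refl) (simp add: sum_distrib_left)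
    also have "\<dots> = (\<Sum>s\<in>X. \<Sum>k\<le>N. c k * of_real (poly (cheb_on a b k) s * poly (lagr X s) t))"
      by (rule sum.swap)
    finally show ?thesis by (simp add: p_def scaleR_conv_of_real sum_distrib_left mult_ac)
  qed
  hence "g t - (\<Sum>s\<in>X. poly (lagr X s) t *\<^sub>R g s) = (g t - p t) - (\<Sum>s\<in>X. poly (lagr X s) t *\<^sub>R (g s - p s))"
    by (simp add: scaleR_diff_right sum_subtractf)
  also have "cmod \<dots> \<le> e + (\<Sum>s\<in>X. \<bar>poly (lagr X s) t\<bar> * e)"
  proof (rule order_trans[OF norm_triangle_ineq4], rule add_mono)
    show "cmod (g t - p t) \<le> e" using gp assms by blast
    have "cmod (g s - p s) \<le> e" if "s \<in> X" for s
      using gp[OF subsetD[OF cheb_nodes_subset[OF assms(1,2)]]] that by (simp add: X_def)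
    thus "cmod (\<Sum>s\<in>X. poly (lagr X s) t *\<^sub>R (g s - p s)) \<le> (\<Sum>s\<in>X. \<bar>poly (lagr X s) t\<bar> * e)"
      by (intro order_trans[OF norm_sum] sum_mono) (simp add: mult_left_mono)
  qed
  also have "\<dots> = (1 + (\<Sum>s\<in>X. \<bar>poly (lagr X s) t\<bar>)) * e"
    by (simp add: sum_distrib_right distrib_right)
  also have "\<dots> \<le> (1 + 36 * ln (real (N + 1))) * e"
    using lebesgue_constant_cheb[OF assms(1-3), of kd] order_trans[OF norm_ge_zero g]
    by (intro mult_right_mono) (auto simp: X_def)
  finally show ?thesis unfolding X_def .
qed

definition cheb_approximable :: "(real^'n \<Rightarrow> complex) \<Rightarrow> real^'n \<Rightarrow> real^'n \<Rightarrow> nat \<Rightarrow> real \<Rightarrow> bool" where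
  "cheb_approximable f a b m e \<longleftrightarrow> (\<forall>j. \<forall>y\<in>cbox a b. \<exists>c. \<forall>\<theta>.
     cmod (f (upd y j (cheb_point (a $ j) (b $ j) \<theta>)) - (\<Sum>k\<le>m. c k * of_real (cos (real k * \<theta>)))) \<le> e)"

lemma tensor_cheb_interpolation_error:
  fixes f :: "real^'n::finite \<Rightarrow> complex" and a b x :: "real^'n" and k :: "'n \<Rightarrow> cheb_kind"
  assumes "N \<ge> 1" "\<And>i. a $ i < b $ i" "cheb_approximable f a b N e" "e \<ge> 0" "x \<in> cbox a b"
  defines "X \<equiv> \<lambda>i. cheb_nodes (k i) N (a $ i) (b $ i)"
  shows "cmod (f x - tensor_sum (\<lambda>i s. poly (lagr (X i) s) (x $ i)) X J f x)
    \<le> real (card J) * (36 * ln (real (N + 1))) ^ card J * (2 * e)"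
proof -
  define L where "L = 36 * ln (real (N + 1))"
  define W where "W = (\<lambda>i s. poly (lagr (X i) s) (x $ i))"
  have L1: "1 \<le> L"
  proof -
    have "ln 2 \<le> ln (real (N + 1))" using assms by (subst ln_le_cancel_iff) auto
    hence "1 \<le> 36 * ln (real (N + 1))" using ln2_ge_two_thirds by linarith
    thus ?thesis by (simp only: L_def)
  qed
  have xi: "x $ i \<in> {a $ i..b $ i}" for i using assms by (auto simp: mem_box_cart)
  have leb: "(\<Sum>s\<in>X i. \<bar>W i s\<bar>) \<le> L" for i
    unfolding W_def X_def L_def by (rule lebesgue_constant_cheb[OF assms(1,2) xi])
  have "cmod (f x - tensor_sum W X J f x) \<le> real (card J) * L ^ card J * (2 * e)"
  proof (induction J rule: finite_induct[OF finite])
    case (2 j J)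
    \<comment> \<open>Interpolating in coordinate \<open>j\<close> as well changes the result by the
      tensor sum over \<open>J\<close> of the univariate error \<open>h\<close>, which is amplified
      by \<open>L\<close> once for each coordinate in \<open>J\<close>.\<close>
    define h where "h z = f z - (\<Sum>s\<in>X j. W j s *\<^sub>R f (upd z j s))" for z
    have h: "cmod (h (merge J y x)) \<le> 2 * L * e" if y: "y \<in> PiE J X" for y
    proof -
      let ?z = "merge J y x"
      have z: "?z \<in> cbox a b"
      proof -
        have "?z $ i \<in> {a $ i..b $ i}" for i
          using xi[of i] PiE_mem[OF y, of i] cheb_nodes_subset[OF assms(1,2), of "k i" i]
          by (cases "i \<in> J") (auto simp: X_def)
        thus ?thesis by (auto simp: mem_box_cart)
      qed
      from assms(3) z obtain c where c: "\<And>\<theta>. cmod (f (upd ?z j (cheb_point (a $ j) (b $ j) \<theta>)) - (\<Sum>k\<le>N. c k * of_real (cos (real k * \<theta>)))) \<le> e"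
        unfolding cheb_approximable_def by blast
      have zj: "?z $ j = x $ j" using 2 by simp
      have "h ?z = f (upd ?z j (x $ j)) - (\<Sum>s\<in>X j. W j s *\<^sub>R f (upd ?z j s))"
        using upd_same[of ?z j] unfolding zj by (simp add: h_def)
      also have "cmod \<dots> \<le> (1 + L) * e"
        unfolding W_def X_def L_def
        by (rule cheb_interpolation_error[OF assms(1,2) xi, where g = "\<lambda>t. f (upd ?z j t)", OF c])
      also have "\<dots> \<le> 2 * L * e" using L1 assms(4) by (intro mult_right_mono) auto
      finally show ?thesis .
    qed
    have "tensor_sum W X J h x = tensor_sum W X J f x - tensor_sum W X (insert j J) f x"
      unfolding h_def tensor_sum_diff tensor_sum_insert[OF 2(2)] ..
    hence "f x - tensor_sum W X (insert j J) f x = (f x - tensor_sum W X J f x) + tensor_sum W X J h x"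
      by simp
    also have "cmod \<dots> \<le> real (card J) * L ^ card J * (2 * e) + L ^ card J * (2 * L * e)"
    proof (rule order_trans[OF norm_triangle_ineq], rule add_mono)
      have "cmod (tensor_sum W X J h x) \<le> (\<Prod>i\<in>J. \<Sum>s\<in>X i. \<bar>W i s\<bar>) * (2 * L * e)"
        by (rule norm_tensor_sum_le) (use h in \<open>auto simp: X_def\<close>)
      also have "\<dots> \<le> (\<Prod>i\<in>J. L) * (2 * L * e)"
        using leb L1 assms(4) by (intro mult_right_mono prod_mono) (auto intro: sum_nonneg)
      finally show "cmod (tensor_sum W X J h x) \<le> L ^ card J * (2 * L * e)" by simp
    qed (use 2 in blast)
    also have "\<dots> \<le> real (card J) * L ^ Suc (card J) * (2 * e) + L ^ card J * (2 * L * e)"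
      using L1 assms(4) by (intro add_mono mult_right_mono mult_left_mono power_increasing) auto
    also have "\<dots> = real (card (insert j J)) * L ^ card (insert j J) * (2 * e)"
      using 2 by (simp add: algebra_simps)
    finally show ?case .
  qed simp
  thus ?thesis unfolding L_def W_def .
qed

section \<open>Invariant measures and exactness\<close>

lemma ruelle_oscillation_le:
  fixes S :: "'l::finite \<Rightarrow> real^'n \<Rightarrow> real^'n"
  assumes \<mu>: "\<And>l. 0 \<le> \<mu> l" "(\<Sum>l\<in>UNIV. \<mu> l) = 1" and "\<And>l. \<bar>p (S l x) - p (S l y)\<bar> \<le> e"
  shows "\<bar>ruelle S \<mu> p x - ruelle S \<mu> p y\<bar> \<le> e"
proof -
  have "ruelle S \<mu> p x - ruelle S \<mu> p y = (\<Sum>l\<in>UNIV. \<mu> l * (p (S l x) - p (S l y)))"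
    by (simp add: ruelle_def sum_subtractf right_diff_distrib)
  also have "\<bar>\<dots>\<bar> \<le> (\<Sum>l\<in>UNIV. \<mu> l * e)"
    by (rule order_trans[OF sum_abs], rule sum_mono) (use assms in \<open>simp add: abs_mult mult_left_mono\<close>)
  also have "\<dots> = e" using \<mu> by (simp flip: sum_distrib_right)
  finally show ?thesis .
qed

lemma invariant_measure_nn_integral:
  fixes M :: "(real^'n) measure"
  assumes inv: "is_invariant_measure S \<mu> M" and \<mu>: "\<And>l. 0 \<le> \<mu> l"
    and S: "\<And>l. S l \<in> borel_measurable borel" and f: "f \<in> borel_measurable borel"
  shows "(\<integral>\<^sup>+x. f x \<partial>M) = (\<Sum>l\<in>UNIV. ennreal (\<mu> l) * (\<integral>\<^sup>+x. f (S l x) \<partial>M))"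
  using f
proof (induction f rule: borel_measurable_induct)
  interpret prob_space M using inv by (simp add: is_invariant_measure_def)
  have sets [measurable_cong]: "sets M = sets borel" using inv by (simp add: is_invariant_measure_def)
  note S [measurable]
  have [measurable]: "S l \<in> borel_measurable M" for l by simp
  {
    case (cong f g)
    thus ?case by simp
  next
    case (set A)
    have "S l -` A \<in> sets M" for l
      using measurable_sets[OF S set, of l] by (simp add: sets)
    moreover have "(\<lambda>x. indicator A (S l x)) = (indicator (S l -` A) :: _ \<Rightarrow> ennreal)" for l
      by (auto simp: indicator_def)
    moreover have "measure M A = (\<Sum>l\<in>UNIV. \<mu> l * measure M (S l -` A))"
      using inv set by (simp add: is_invariant_measure_def)
    ultimately show ?case using set \<mu>
      by (simp add: sets emeasure_eq_measure sum_nonneg ennreal_mult[symmetric] sum_ennreal)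
  next
    case (mult u c)
    thus ?case by (simp add: nn_integral_cmult sum_distrib_left mult_ac)
  next
    case (add u v)
    thus ?case by (simp add: nn_integral_add sum.distrib distrib_left)
  next
    case (seq U)
    have m [measurable]: "U i \<in> borel_measurable borel" for i using seq by simp
    have "(\<integral>\<^sup>+x. (SUP i. U i x) \<partial>M) = (SUP i. \<integral>\<^sup>+x. U i x \<partial>M)"
      using seq by (intro nn_integral_monotone_convergence_SUP) auto
    also have "\<dots> = (SUP i. \<Sum>l\<in>UNIV. ennreal (\<mu> l) * (\<integral>\<^sup>+x. U i (S l x) \<partial>M))"
      using seq by simp
    also have "\<dots> = (\<Sum>l\<in>UNIV. SUP i. ennreal (\<mu> l) * (\<integral>\<^sup>+x. U i (S l x) \<partial>M))"
      using seq by (intro ennreal_SUP_sum) (auto simp: incseq_def le_fun_def intro!: mult_left_mono nn_integral_mono)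
    also have "\<dots> = (\<Sum>l\<in>UNIV. ennreal (\<mu> l) * (SUP i. \<integral>\<^sup>+x. U i (S l x) \<partial>M))"
      by (simp add: SUP_mult_left_ennreal)
    also have "\<dots> = (\<Sum>l\<in>UNIV. ennreal (\<mu> l) * (\<integral>\<^sup>+x. (SUP i. U i (S l x)) \<partial>M))"
    proof -
      have "(\<integral>\<^sup>+x. (SUP i. U i (S l x)) \<partial>M) = (SUP i. \<integral>\<^sup>+x. U i (S l x) \<partial>M)" for l
        using seq by (intro nn_integral_monotone_convergence_SUP) (auto simp: incseq_def le_fun_def)
      thus ?thesis by simp
    qed
    finally show ?case by (simp add: SUP_apply image_comp)
  }
qed

lemma invariant_measure_integrable:
  fixes g :: "real^'n \<Rightarrow> 'b::{banach, second_countable_topology}"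
  assumes inv: "is_invariant_measure S \<mu> M" and g: "continuous_on UNIV g"
  shows "integrable M g"
proof -
  interpret prob_space M using inv by (simp add: is_invariant_measure_def)
  obtain c r where "AE x in M. x \<in> cball c r" using inv by (auto simp: is_invariant_measure_def)
  moreover have "bounded (g ` cball c r)"
    using g by (intro compact_imp_bounded compact_continuous_image continuous_on_subset[OF g]) auto
  then obtain B where "\<And>x. x \<in> cball c r \<Longrightarrow> norm (g x) \<le> B" by (auto simp: bounded_iff simp del: mem_cball)
  ultimately have "AE x in M. norm (g x) \<le> B" by auto
  moreover have "g \<in> borel_measurable M"
    using borel_measurable_continuous_onI[OF g] inv
    by (simp add: is_invariant_measure_def cong: measurable_cong_sets)
  ultimately show ?thesis by (rule integrable_const_bound)
qed

lemma invariant_measure_ruelle: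
  fixes p :: "real^'n \<Rightarrow> real"
  assumes inv: "is_invariant_measure S \<mu> M" and \<mu>: "\<And>l. 0 \<le> \<mu> l" "(\<Sum>l\<in>UNIV. \<mu> l) = 1"
    and S: "\<And>l. continuous_on UNIV (S l)" and p: "continuous_on UNIV p"
  shows "(\<integral>x. ruelle S \<mu> p x \<partial>M) = (\<integral>x. p x \<partial>M)"
proof -
  interpret prob_space M using inv by (simp add: is_invariant_measure_def)
  obtain c r where ball: "\<And>l. S l ` cball c r \<subseteq> cball c r" "AE x in M. x \<in> cball c r"
    using inv by (auto simp: is_invariant_measure_def)
  have "bounded (p ` cball c r)"
    using p by (intro compact_imp_bounded compact_continuous_image continuous_on_subset[OF p]) auto
  then obtain B where B: "\<And>x. x \<in> cball c r \<Longrightarrow> \<bar>p x\<bar> \<le> B" by (auto simp: bounded_iff simp del: mem_cball)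
  have pS: "continuous_on UNIV (\<lambda>x. p (S l x))" for l
    by (rule continuous_on_compose2[OF p S]) auto
  note int = invariant_measure_integrable[OF inv]
  \<comment> \<open>The shift by \<open>B\<close> makes the function nonnegative almost everywhere,
    also after composition with \<open>S l\<close>, because the ball is mapped into itself. This
    reduces the claim to nonnegative integrals.\<close>
  have pB: "0 \<le> p x + B" if "x \<in> cball c r" for x
    using B[OF that] by linarith
  have ae: "AE x in M. 0 \<le> p x + B" "AE x in M. 0 \<le> p (S l x) + B" for l
    by (rule eventually_mono[OF ball(2)], rule pB, assumption)
       (rule eventually_mono[OF ball(2)], rule pB, use ball(1) in blast)
  note nn = integral_nonneg_AE[OF ae(1)] integral_nonneg_AE[OF ae(2)]
  have "ennreal (\<integral>x. p x + B \<partial>M) = (\<integral>\<^sup>+x. ennreal (p x + B) \<partial>M)"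
    by (intro nn_integral_eq_integral[symmetric] int continuous_intros p ae)
  also have "\<dots> = (\<Sum>l\<in>UNIV. ennreal (\<mu> l) * (\<integral>\<^sup>+x. ennreal (p (S l x) + B) \<partial>M))"
    using borel_measurable_continuous_onI[OF p] borel_measurable_continuous_onI[OF S]
    by (intro invariant_measure_nn_integral[OF inv \<mu>(1)]) auto
  also have "\<dots> = (\<Sum>l\<in>UNIV. ennreal (\<mu> l) * ennreal (\<integral>x. p (S l x) + B \<partial>M))"
  proof (intro sum.cong refl)
    fix l
    have "(\<integral>\<^sup>+x. ennreal (p (S l x) + B) \<partial>M) = ennreal (\<integral>x. p (S l x) + B \<partial>M)"
      by (intro nn_integral_eq_integral int continuous_intros pS ae)
    thus "ennreal (\<mu> l) * (\<integral>\<^sup>+x. ennreal (p (S l x) + B) \<partial>M) = ennreal (\<mu> l) * ennreal (\<integral>x. p (S l x) + B \<partial>M)"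
      by simp
  qed
  also have "\<dots> = ennreal (\<Sum>l\<in>UNIV. \<mu> l * (\<integral>x. p (S l x) + B \<partial>M))"
    using \<mu> nn by (simp add: ennreal_mult[symmetric] sum_ennreal)
  finally have "(\<integral>x. p x + B \<partial>M) = (\<Sum>l\<in>UNIV. \<mu> l * (\<integral>x. p (S l x) + B \<partial>M))"
    using \<mu> nn by (subst (asm) ennreal_inj) (auto intro!: sum_nonneg)
  moreover have "(\<integral>x. p x + B \<partial>M) = (\<integral>x. p x \<partial>M) + B"
    using int[OF p] by (simp add: prob_space)
  moreover have "(\<integral>x. p (S l x) + B \<partial>M) = (\<integral>x. p (S l x) \<partial>M) + B" for l
    using int[OF pS] by (simp add: prob_space)
  moreover have "(\<Sum>l\<in>UNIV. \<mu> l * ((\<integral>x. p (S l x) \<partial>M) + B)) = (\<Sum>l\<in>UNIV. \<mu> l * (\<integral>x. p (S l x) \<partial>M)) + B"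
    using \<mu>(2) by (simp add: distrib_left sum.distrib flip: sum_distrib_right)
  moreover have "(\<integral>x. ruelle S \<mu> p x \<partial>M) = (\<Sum>l\<in>UNIV. \<mu> l * (\<integral>x. p (S l x) \<partial>M))"
    unfolding ruelle_def using int[OF pS] by simp
  ultimately show ?thesis by simp
qed

text \<open>The mean of the distance to \<open>\<Gamma>\<close> is preserved by the Ruelle operator,
  yet it shrinks at least by the factor \<open>\<rho>\<close>, as each \<open>S l\<close> maps
  \<open>\<Gamma>\<close> into itself; so it is 0. Hence integrals over \<open>\<Gamma>\<close> are
  full means.\<close>

lemma invariant_measure_attractor:
  fixes S :: "'l::finite \<Rightarrow> real^'n \<Rightarrow> real^'n"
  assumes inv: "is_invariant_measure S \<mu> M" and \<mu>: "\<And>l. 0 \<le> \<mu> l" "(\<Sum>l\<in>UNIV. \<mu> l) = 1"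
    and \<rho>: "0 \<le> \<rho>" "\<rho> < 1" "\<And>l x y. dist (S l x) (S l y) \<le> \<rho> * dist x y"
    and att: "is_attractor S \<Gamma>"
  shows "AE x in M. x \<in> \<Gamma>"
proof -
  have \<Gamma>: "compact \<Gamma>" "\<Gamma> \<noteq> {}" "\<Gamma> = (\<Union>l. S l ` \<Gamma>)" using att by (auto simp: is_attractor_def)
  have S: "continuous_on UNIV (S l)" for l
    using \<rho> by (intro lipschitz_on_continuous_on[OF lipschitz_onI]) auto
  define p where "p x = infdist x \<Gamma>" for x
  have p: "continuous_on UNIV p" unfolding p_def by (intro continuous_intros)
  have cS: "continuous_on UNIV (ruelle S \<mu> p)"
    unfolding ruelle_def by (intro continuous_intros continuous_on_compose2[OF p S]) auto
  note int = invariant_measure_integrable[OF inv]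
  have pS: "p (S l x) \<le> \<rho> * p x" for l x
  proof -
    obtain y where y: "y \<in> \<Gamma>" "infdist x \<Gamma> = dist x y"
      using infdist_attains_inf[OF compact_imp_closed[OF \<Gamma>(1)] \<Gamma>(2)] by metis
    have "S l y \<in> \<Gamma>" using y(1) \<Gamma>(3) by blast
    hence "p (S l x) \<le> dist (S l x) (S l y)" unfolding p_def by (rule infdist_le)
    also have "\<dots> \<le> \<rho> * dist x y" by (rule \<rho>)
    finally show ?thesis using y by (simp add: p_def)
  qed
  have "ruelle S \<mu> p x \<le> \<rho> * p x" for x
  proof -
    have "ruelle S \<mu> p x \<le> (\<Sum>l\<in>UNIV. \<mu> l * (\<rho> * p x))"
      unfolding ruelle_def using pS \<mu> by (intro sum_mono mult_left_mono) auto
    thus ?thesis using \<mu> by (simp flip: sum_distrib_right)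
  qed
  hence "(\<integral>x. ruelle S \<mu> p x \<partial>M) \<le> (\<integral>x. \<rho> * p x \<partial>M)"
    using int[OF p] int[OF cS] by (intro integral_mono) auto
  hence "(\<integral>x. p x \<partial>M) \<le> \<rho> * (\<integral>x. p x \<partial>M)"
    using invariant_measure_ruelle[OF inv \<mu> S p] by simp
  moreover have "0 \<le> (\<integral>x. p x \<partial>M)" by (intro integral_nonneg_AE) (auto simp: p_def infdist_nonneg)
  moreover have "(\<integral>x. p x \<partial>M) * (1 - \<rho>) \<le> 0 \<Longrightarrow> (\<integral>x. p x \<partial>M) \<le> 0"
    using \<rho>(2) by (simp add: mult_le_0_iff)
  ultimately have "(\<integral>x. p x \<partial>M) = 0" by (simp add: algebra_simps)
  moreover have "AE x in M. 0 \<le> p x" by (simp add: p_def infdist_nonneg)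
  ultimately have "AE x in M. p x = 0"
    using integral_nonneg_eq_0_iff_AE[OF int[OF p]] by blast
  thus ?thesis
    using in_closed_iff_infdist_zero[OF compact_imp_closed[OF \<Gamma>(1)] \<Gamma>(2)]
    by (auto elim!: eventually_mono simp: p_def)
qed

text \<open>The iterate averages \<open>p\<close> over images under \<open>m\<close>-fold
  compositions, which contract by \<open>\<rho> ^ m\<close>; so it is almost constant on bounded
  sets. Its mean never changes, hence the constant is close to the mean of \<open>p\<close>.\<close>

lemma ruelle_iterate_tendsto:
  fixes S :: "'l::finite \<Rightarrow> real^'n \<Rightarrow> real^'n" and p :: "real^'n \<Rightarrow> real"
  assumes inv: "is_invariant_measure S \<mu> M" and \<mu>: "\<And>l. 0 \<le> \<mu> l" "(\<Sum>l\<in>UNIV. \<mu> l) = 1"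
    and \<rho>: "0 < \<rho>" "\<rho> < 1" "\<And>l x y. dist (S l x) (S l y) \<le> \<rho> * dist x y"
    and p: "continuous_on UNIV p" and K: "bounded K" and e: "e > 0"
  shows "\<exists>m. \<forall>x\<in>K. \<bar>(ruelle S \<mu> ^^ m) p x - (\<integral>x. p x \<partial>M)\<bar> \<le> e"
proof -
  interpret prob_space M using inv by (simp add: is_invariant_measure_def)
  have S: "continuous_on UNIV (S l)" for l
    using \<rho> by (intro lipschitz_on_continuous_on[OF lipschitz_onI]) auto
  obtain c r where ball: "AE x in M. x \<in> cball c r" using inv by (auto simp: is_invariant_measure_def)
  obtain R0 where R0: "\<And>x. x \<in> K \<Longrightarrow> norm x \<le> R0" using K by (auto simp: bounded_iff)
  define V where "V = (\<Sum>l\<in>UNIV. norm (S l 0))"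
  \<comment> \<open>The ball \<open>D\<close> has to contain \<open>K\<close>, carry the measure and
    be mapped into itself. The ball that comes with the measure need not contain \<open>K\<close>; a
    radius of at least \<open>V / (1 - \<rho>)\<close> secures the invariance of
    \<open>D\<close>.\<close>
  define R where "R = max (max R0 (norm c + r)) (V / (1 - \<rho>))"
  define D where "D = cball (0::real^'n) R"
  have KD: "K \<subseteq> D" using R0 by (force simp: D_def R_def)
  have "cball c r \<subseteq> D"
  proof
    fix x assume "x \<in> cball c r"
    hence "norm x \<le> norm c + r"
      using norm_triangle_ineq[of c "x - c"] by (simp add: dist_norm norm_minus_commute)
    thus "x \<in> D" by (simp add: D_def R_def)
  qed
  hence MD: "AE x in M. x \<in> D" using ball by (auto elim!: eventually_mono)
  have SD: "S l x \<in> D" if "x \<in> D" for l x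
  proof -
    have "norm (S l x) \<le> dist (S l x) (S l 0) + norm (S l 0)"
      by (metis dist_norm norm_triangle_sub add.commute)
    also have "\<dots> \<le> \<rho> * norm x + V"
      using \<rho>(3)[of l x 0] by (intro add_mono) (auto simp: V_def intro: member_le_sum)
    also have "\<dots> \<le> \<rho> * R + (1 - \<rho>) * R"
    proof (rule add_mono)
      have "V / (1 - \<rho>) \<le> R" by (simp add: R_def)
      thus "V \<le> (1 - \<rho>) * R" using \<rho> by (simp add: field_simps)
    qed (use that \<rho> in \<open>auto simp: D_def\<close>)
    finally show ?thesis by (simp add: D_def algebra_simps)
  qed
  have "uniformly_continuous_on D p"
    by (rule compact_uniformly_continuous[OF continuous_on_subset[OF p]]) (auto simp: D_def)
  then obtain \<delta> where \<delta>: "\<delta> > 0" "\<And>x y. x \<in> D \<Longrightarrow> y \<in> D \<Longrightarrow> dist x y < \<delta> \<Longrightarrow> \<bar>p x - p y\<bar> < e"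
    using e unfolding uniformly_continuous_on_def dist_real_def by metis
  \<comment> \<open>Peeling off the outermost operator replaces \<open>x\<close> and
    \<open>y\<close> by \<open>S l x\<close> and \<open>S l y\<close>, whose distance is smaller by
    \<open>\<rho>\<close>; the premise for \<open>Suc m\<close> becomes the one for
    \<open>m\<close>.\<close>
  have osc: "\<bar>(ruelle S \<mu> ^^ m) p x - (ruelle S \<mu> ^^ m) p y\<bar> \<le> e"
    if "x \<in> D" "y \<in> D" "\<rho> ^ m * dist x y < \<delta>" for m x y
    using that
  proof (induction m arbitrary: x y)
    case 0
    thus ?case using \<delta>(2)[of x y] by simp
  next
    case (Suc m)
    have "\<bar>(ruelle S \<mu> ^^ m) p (S l x) - (ruelle S \<mu> ^^ m) p (S l y)\<bar> \<le> e" for l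
    proof (rule Suc.IH)
      have "\<rho> ^ m * dist (S l x) (S l y) \<le> \<rho> ^ m * (\<rho> * dist x y)"
        using \<rho> by (intro mult_left_mono) auto
      thus "\<rho> ^ m * dist (S l x) (S l y) < \<delta>" using Suc.prems(3) by (simp add: mult_ac)
    qed (use SD Suc.prems in auto)
    hence "\<bar>ruelle S \<mu> ((ruelle S \<mu> ^^ m) p) x - ruelle S \<mu> ((ruelle S \<mu> ^^ m) p) y\<bar> \<le> e"
      by (rule ruelle_oscillation_le[OF \<mu>])
    thus ?case by simp
  qed
  have cont: "continuous_on UNIV ((ruelle S \<mu> ^^ m) p)" for m
  proof (induction m)
    case (Suc m)
    have "continuous_on UNIV (ruelle S \<mu> ((ruelle S \<mu> ^^ m) p))"
      by (subst ruelle_def) (intro continuous_intros continuous_on_compose2[OF Suc S]; simp)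
    thus ?case by simp
  qed (use p in simp)
  have int: "(\<integral>x. (ruelle S \<mu> ^^ m) p x \<partial>M) = (\<integral>x. p x \<partial>M)" for m
    by (induction m) (simp_all add: invariant_measure_ruelle[OF inv \<mu> S cont])
  have "(\<lambda>m. \<rho> ^ m * (2 * R)) \<longlonglongrightarrow> 0 * (2 * R)"
    using \<rho> by (intro tendsto_intros LIMSEQ_power_zero) auto
  hence "eventually (\<lambda>m. \<rho> ^ m * (2 * R) < \<delta>) sequentially"
    using \<delta>(1) by (intro order_tendstoD(2)[of _ 0]) auto
  then obtain m where m: "\<rho> ^ m * (2 * R) < \<delta>" by (auto simp: eventually_sequentially)
  have "\<bar>(ruelle S \<mu> ^^ m) p x - (\<integral>x. p x \<partial>M)\<bar> \<le> e" if "x \<in> K" for x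
  proof -
    let ?g = "(ruelle S \<mu> ^^ m) p"
    note ig = invariant_measure_integrable[OF inv cont[of m]]
    have xD: "x \<in> D" using that KD by blast
    have "AE y in M. norm (?g x - ?g y) \<le> e"
      using MD
    proof (rule eventually_mono)
      fix y assume y: "y \<in> D"
      have "dist x y \<le> 2 * R"
        using dist_triangle2[of x y 0] xD y by (simp add: D_def dist_norm)
      hence "\<rho> ^ m * dist x y \<le> \<rho> ^ m * (2 * R)" using \<rho> by (intro mult_left_mono) auto
      thus "norm (?g x - ?g y) \<le> e" using osc[OF xD y] m by simp
    qed
    hence "norm (\<integral>y. ?g x - ?g y \<partial>M) \<le> (\<integral>y. e \<partial>M)"
      using ig by (intro order_trans[OF integral_norm_bound] integral_mono_AE) auto
    moreover have "(\<integral>y. ?g x - ?g y \<partial>M) = ?g x - (\<integral>x. p x \<partial>M)"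
      using ig by (simp add: prob_space int)
    ultimately show ?thesis by (simp add: prob_space)
  qed
  thus ?thesis by blast
qed

text \<open>The abstract class \<open>V\<close> serves both \<open>Q_space N\<close> and the
  polynomials of total degree at most \<open>N\<close>. The matrix interpolates on the whole grid in
  either case; what counts is that this reproduces the members of \<open>V\<close>.\<close>

lemma cubature_exact:
  fixes S :: "'l::finite \<Rightarrow> real^'n \<Rightarrow> real^'n" and p :: "real^'n \<Rightarrow> real"
  assumes inv: "is_invariant_measure S \<mu> M" and \<mu>: "\<And>l. 0 \<le> \<mu> l" "(\<Sum>l\<in>UNIV. \<mu> l) = 1"
    and \<rho>: "0 < \<rho>" "\<rho> < 1" "\<And>l x y. dist (S l x) (S l y) \<le> \<rho> * dist x y"
    and X: "\<And>i. finite (X i)" "\<And>i. card (X i) = N + 1"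
    and w: "cubature_weights S \<mu> N (grid X) w"
    and V: "\<And>p. p \<in> V \<Longrightarrow> coord_poly N p" "\<And>p. p \<in> V \<Longrightarrow> ruelle S \<mu> p \<in> V"
    and p: "p \<in> V" "continuous_on UNIV p"
  shows "(\<Sum>x\<in>grid X. w x * p x) = (\<integral>x. p x \<partial>M)"
proof -
  have fin: "finite (grid X)" using X(1) by (rule finite_grid)
  have step: "(\<Sum>x\<in>grid X. w x * ruelle S \<mu> q x) = (\<Sum>x\<in>grid X. w x * q x)" if q: "q \<in> V" for q
  proof -
    have "ruelle S \<mu> q x = (\<Sum>y\<in>grid X. S_matrix S \<mu> N (grid X) x y * q y)" for x
    proof -
      have "ruelle S \<mu> q x = (\<Sum>l\<in>UNIV. \<Sum>y\<in>grid X. \<mu> l * (q y * tensor_lagr X y (S l x)))"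
        unfolding ruelle_def sum_distrib_left[symmetric]
        using tensor_lagr_interpolation[OF X V(1)[OF q]] by (intro sum.cong refl) simp
      also have "\<dots> = (\<Sum>y\<in>grid X. \<Sum>l\<in>UNIV. \<mu> l * (q y * tensor_lagr X y (S l x)))"
        by (rule sum.swap)
      also have "\<dots> = (\<Sum>y\<in>grid X. S_matrix S \<mu> N (grid X) x y * q y)"
        unfolding S_matrix_def sum_distrib_right
        by (intro sum.cong refl) (simp add: lagrange_poly_eq[OF X])
      finally show ?thesis .
    qed
    hence "(\<Sum>x\<in>grid X. w x * ruelle S \<mu> q x) = (\<Sum>x\<in>grid X. \<Sum>y\<in>grid X. w x * (S_matrix S \<mu> N (grid X) x y * q y))"
      by (simp add: sum_distrib_left)
    also have "\<dots> = (\<Sum>y\<in>grid X. \<Sum>x\<in>grid X. w x * (S_matrix S \<mu> N (grid X) x y * q y))" by (rule sum.swap)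
    also have "\<dots> = (\<Sum>y\<in>grid X. (\<Sum>x\<in>grid X. S_matrix S \<mu> N (grid X) x y * w x) * q y)"
      by (simp add: sum_distrib_right sum_distrib_left mult_ac)
    also have "\<dots> = (\<Sum>y\<in>grid X. w y * q y)"
      using w by (simp add: cubature_weights_def)
    finally show ?thesis .
  qed
  have iterate: "(ruelle S \<mu> ^^ m) p \<in> V \<and> (\<Sum>x\<in>grid X. w x * (ruelle S \<mu> ^^ m) p x) = (\<Sum>x\<in>grid X. w x * p x)" for m
    by (induction m) (simp_all add: p V step)
  define I where "I = (\<integral>x. p x \<partial>M)"
  have "\<bar>(\<Sum>x\<in>grid X. w x * p x) - I\<bar> \<le> 0 + e" if "e > 0" for e
  proof -
    define W where "W = (\<Sum>x\<in>grid X. \<bar>w x\<bar>) + 1"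
    have W: "W > 0" unfolding W_def using sum_nonneg[of "grid X" "\<lambda>x. \<bar>w x\<bar>"] by linarith
    have "0 < e / W" using W that by simp
    from ruelle_iterate_tendsto[OF inv \<mu> \<rho> p(2) finite_imp_bounded[OF fin] this]
    obtain m where m: "\<forall>x\<in>grid X. \<bar>(ruelle S \<mu> ^^ m) p x - I\<bar> \<le> e / W"
      unfolding I_def by blast
    \<comment> \<open>The constant \<open>I\<close> may be moved inside because the weights sum to
      1. The l1 norm of the weights is arbitrary but independent of the number \<open>m\<close> of
      iterations, so the tolerance \<open>e / W\<close> pays for it in advance.\<close>
    have "(\<Sum>x\<in>grid X. w x * p x) - I = (\<Sum>x\<in>grid X. w x * ((ruelle S \<mu> ^^ m) p x - I))"
      using w iterate[of m] by (simp add: cubature_weights_def right_diff_distrib sum_subtractf flip: sum_distrib_right)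
    also have "\<bar>\<dots>\<bar> \<le> (\<Sum>x\<in>grid X. \<bar>w x\<bar> * (e / W))"
      by (rule order_trans[OF sum_abs], rule sum_mono) (use m in \<open>auto simp: abs_mult simp del: times_divide_eq_right intro!: mult_left_mono\<close>)
    also have "\<dots> = (W - 1) * (e / W)" unfolding sum_distrib_right[symmetric] by (simp add: W_def)
    also have "\<dots> \<le> W * (e / W)" using W that by (intro mult_right_mono) auto
    finally show ?thesis using W by simp
  qed
  hence "\<bar>(\<Sum>x\<in>grid X. w x * p x) - I\<bar> \<le> 0" by (rule field_le_epsilon)
  thus ?thesis by (simp add: I_def)
qed

section \<open>Polynomials of bounded total degree\<close>

inductive tdeg :: "nat \<Rightarrow> (real^'n::finite \<Rightarrow> real) \<Rightarrow> bool" where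
  const: "tdeg d (\<lambda>x. c)"
| scale: "tdeg d p \<Longrightarrow> tdeg d (\<lambda>x. c * p x)"
| add: "tdeg d p \<Longrightarrow> tdeg d q \<Longrightarrow> tdeg d (\<lambda>x. p x + q x)"
| coord: "tdeg d p \<Longrightarrow> tdeg (Suc d) (\<lambda>x. x $ i * p x)"

lemma tdeg_Suc: "tdeg d p \<Longrightarrow> tdeg (Suc d) p"
  by (induction rule: tdeg.induct) (auto intro: tdeg.intros)

lemma tdeg_mono:
  assumes "tdeg d p" "d \<le> e"
  shows "tdeg e p"
  using assms(2,1) by (induction rule: dec_induct) (auto intro: tdeg_Suc)

lemma tdeg_sum: "(\<And>i. i \<in> I \<Longrightarrow> tdeg d (p i)) \<Longrightarrow> tdeg d (\<lambda>x. \<Sum>i\<in>I. p i x)"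
  by (induction I rule: infinite_finite_induct) (auto intro: tdeg.const tdeg.add)

text \<open>A coordinate of the affine image is an affine combination of coordinates, so it still
  raises the degree by one only. The inductive form of \<open>tdeg\<close> turns the substitution
  into a plain rule induction.\<close>

lemma tdeg_affine: "tdeg d p \<Longrightarrow> tdeg d (\<lambda>x. p (affine_map A v x))"
proof (induction rule: tdeg.induct)
  case (coord d p i)
  have "tdeg (Suc d) (\<lambda>x. (\<Sum>j\<in>UNIV. A $ i $ j * (x $ j * p (affine_map A v x))) + v $ i * p (affine_map A v x))"
    using coord by (intro tdeg.add tdeg_sum tdeg.scale tdeg.coord) (auto intro: tdeg_Suc)
  also have "(\<lambda>x. (\<Sum>j\<in>UNIV. A $ i $ j * (x $ j * p (affine_map A v x))) + v $ i * p (affine_map A v x))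
      = (\<lambda>x. affine_map A v x $ i * p (affine_map A v x))"
    by (simp add: affine_map_def matrix_vector_mult_def distrib_right sum_distrib_right mult.assoc)
  finally show ?case .
qed (auto intro: tdeg.intros)

lemma tdeg_ruelle: "tdeg d p \<Longrightarrow> tdeg d (ruelle (\<lambda>l. affine_map (A l) (v l)) \<mu> p)"
  unfolding ruelle_def by (intro tdeg_sum tdeg.scale tdeg_affine)

lemma coord_poly_tdeg: "tdeg d p \<Longrightarrow> coord_poly d p"
  unfolding coord_poly_def
proof (induction rule: tdeg.induct)
  case (const d c)
  show ?case by (auto intro!: exI[of _ "[:c:]"])
next
  case (scale d p c)
  show ?case
  proof (intro allI)
    fix j x
    obtain q where "degree q \<le> d" "\<forall>t. p (upd x j t) = poly q t" using scale by blast
    thus "\<exists>q. degree q \<le> d \<and> (\<forall>t. c * p (upd x j t) = poly q t)"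
      by (intro exI[of _ "smult c q"]) (auto intro: order_trans[OF degree_smult_le])
  qed
next
  case (add d p q)
  show ?case
  proof (intro allI)
    fix j x
    obtain r s where "degree r \<le> d" "\<forall>t. p (upd x j t) = poly r t" "degree s \<le> d" "\<forall>t. q (upd x j t) = poly s t"
      using add by meson
    thus "\<exists>r. degree r \<le> d \<and> (\<forall>t. p (upd x j t) + q (upd x j t) = poly r t)"
      by (intro exI[of _ "r + s"]) (auto intro: degree_add_le)
  qed
next
  case (coord d p i)
  show ?case
  proof (intro allI)
    fix j x
    obtain q where q: "degree q \<le> d" "\<forall>t. p (upd x j t) = poly q t" using coord by blast
    show "\<exists>r. degree r \<le> Suc d \<and> (\<forall>t. upd x j t $ i * p (upd x j t) = poly r t)"
    proof (cases "i = j")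
      case True
      thus ?thesis using q by (intro exI[of _ "pCons 0 q"]) (auto simp: degree_pCons_eq_if)
    next
      case False
      thus ?thesis using q
        by (intro exI[of _ "smult (x $ i) q"]) (auto intro: order_trans[OF degree_smult_le])
    qed
  qed
qed

lemma tdeg_poly_mult:
  assumes "tdeg d p" "degree q \<le> e"
  shows "tdeg (e + d) (\<lambda>x. poly q (x $ i) * p x)"
  using assms(2)
proof (induction q arbitrary: e)
  case 0
  show ?case by (simp add: tdeg.const)
next
  case (pCons a q)
  show ?case
  proof (cases "q = 0")
    case True
    thus ?thesis using tdeg_mono[OF tdeg.scale[OF assms(1)], of "e + d" a] by simp
  next
    case False
    then obtain e' where e: "e = Suc e'" "degree q \<le> e'" using pCons(3) by (cases e) auto
    have "tdeg (Suc (e' + d)) (\<lambda>x. a * p x + x $ i * (poly q (x $ i) * p x))"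
      using tdeg_mono[OF tdeg.scale[OF assms(1)], of "Suc (e' + d)" a] pCons.IH[OF e(2)]
      by (intro tdeg.add tdeg.coord) auto
    thus ?thesis by (simp add: e algebra_simps)
  qed
qed

lemma tdeg_prod_poly:
  assumes "\<And>i. i \<in> I \<Longrightarrow> degree (q i) \<le> \<alpha> i"
  shows "tdeg (\<Sum>i\<in>I. \<alpha> i) (\<lambda>x. \<Prod>i\<in>I. poly (q i) (x $ i))"
  using assms
proof (induction I rule: infinite_finite_induct)
  case (insert i I)
  thus ?case using tdeg_poly_mult[of "\<Sum>i\<in>I. \<alpha> i" _ "q i" "\<alpha> i" i] by simp
qed (auto intro: tdeg.const)

section \<open>Total-degree truncation\<close>

text \<open>A two-sided geometric series centred at \<open>m\<close>. The bound does not involve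
  \<open>P\<close>, the grid size that is later sent to infinity.\<close>

lemma sum_geometric_dist_le:
  fixes q :: real
  assumes "0 < q" "q < 1"
  shows "(\<Sum>k\<le>P. q ^ nat \<bar>int k - int m\<bar>) \<le> 2 / (1 - q)"
proof -
  have "(\<Sum>k\<le>P. q ^ nat \<bar>int k - int m\<bar>) \<le> (\<Sum>k\<in>{..m} \<union> {m..m + P}. q ^ nat \<bar>int k - int m\<bar>)"
    using assms by (intro sum_mono2) auto
  also have "\<dots> \<le> (\<Sum>k\<le>m. q ^ nat \<bar>int k - int m\<bar>) + (\<Sum>k=m..m + P. q ^ nat \<bar>int k - int m\<bar>)"
    using assms by (subst sum_Un) (auto intro!: sum_nonneg)
  also have "(\<Sum>k\<le>m. q ^ nat \<bar>int k - int m\<bar>) = (\<Sum>k\<le>m. q ^ k)"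
    by (rule sum.reindex_bij_witness[of _ "\<lambda>k. m - k" "\<lambda>k. m - k"]) (auto intro!: arg_cong[of _ _ "\<lambda>n. q ^ n"])
  also have "(\<Sum>k=m..m + P. q ^ nat \<bar>int k - int m\<bar>) = (\<Sum>k\<le>P. q ^ k)"
    by (rule sum.reindex_bij_witness[of _ "\<lambda>k. k + m" "\<lambda>k. k - m"]) (auto intro!: arg_cong[of _ _ "\<lambda>n. q ^ n"])
  also have g: "(\<Sum>k\<le>n. q ^ k) \<le> 1 / (1 - q)" for n
  proof -
    have "(\<Sum>k\<le>n. q ^ k) = (1 - q ^ Suc n) / (1 - q)"
      using assms sum_gp_basic[of q n] by (simp add: field_simps)
    also have "\<dots> \<le> 1 / (1 - q)" using assms by (intro divide_right_mono) auto
    finally show ?thesis .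
  qed
  hence "(\<Sum>k\<le>m. q ^ k) + (\<Sum>k\<le>P. q ^ k) \<le> 1 / (1 - q) + 1 / (1 - q)"
    by (intro add_mono)
  finally show ?thesis by simp
qed

text \<open>If \<open>u\<close> is the largest entry of a multi-index \<open>\<alpha>\<close> with \<open>|\<alpha>| \<ge> n m\<close>, then the entries
  below \<open>m\<close> are compensated by those above, so that \<open>\<Sum>|\<alpha>\<^sub>i - m| \<le> 2 n (u - m)\<close>. This turns the
  decay in \<open>u\<close> into a product of one-dimensional decays away from \<open>m\<close>.\<close>

lemma multi_index_decay:
  fixes \<alpha> :: "'n::finite \<Rightarrow> nat" and q :: real
  assumes q: "0 < q" "q < 1" and \<alpha>: "CARD('n) * m \<le> (\<Sum>i\<in>UNIV. \<alpha> i)" and t: "0 \<le> t"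
    and c: "\<And>i. c \<le> t * (q ^ (2 * CARD('n))) ^ \<alpha> i"
  shows "c \<le> t * ((q ^ (2 * CARD('n))) ^ m * (\<Prod>i\<in>UNIV. q ^ nat \<bar>int (\<alpha> i) - int m\<bar>))"
proof -
  define n where "n = CARD('n)"
  define u where "u = Max (range \<alpha>)"
  have ub: "\<alpha> i \<le> u" for i by (simp add: u_def)
  have "u \<in> range \<alpha>" unfolding u_def by (rule Max_in) auto
  then obtain j where j: "u = \<alpha> j" by auto
  have "(\<Sum>i\<in>UNIV. \<alpha> i) \<le> (\<Sum>i\<in>(UNIV::'n set). u)" by (intro sum_mono ub)
  also have "\<dots> = n * u" by (simp add: n_def)
  finally have "n * m \<le> n * u" using \<alpha> unfolding n_def by linarith
  hence mu: "m \<le> u" by (simp add: n_def)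
  \<comment> \<open>The signed corrections subtracted on the right add up to the excess of the total
    degree over \<open>n * m\<close>, which the hypothesis makes nonnegative.\<close>
  have "(\<Sum>i\<in>UNIV. \<bar>int (\<alpha> i) - int m\<bar>) \<le> (\<Sum>i\<in>(UNIV::'n set). 2 * (int u - int m) - (int (\<alpha> i) - int m))"
  proof (rule sum_mono)
    fix i show "\<bar>int (\<alpha> i) - int m\<bar> \<le> 2 * (int u - int m) - (int (\<alpha> i) - int m)"
    proof -
      have "int (\<alpha> i) \<le> int u" "int m \<le> int u" using ub[of i] mu by simp_all
      moreover have "\<bar>x - y\<bar> \<le> 2 * (z - y) - (x - y)" if "x \<le> z" "y \<le> z" for x y z :: int
        using that by presburger
      ultimately show ?thesis by blast
    qed
  qed
  also have "\<dots> = 2 * int n * (int u - int m) - (int (\<Sum>i\<in>UNIV. \<alpha> i) - int (n * m))"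
    by (simp add: sum_subtractf sum.distrib n_def algebra_simps)
  also have "\<dots> \<le> 2 * int n * (int u - int m)"
    using \<alpha> by (simp add: n_def del: of_nat_sum of_nat_mult)
  finally have s: "(\<Sum>i\<in>UNIV. \<bar>int (\<alpha> i) - int m\<bar>) \<le> 2 * int n * (int u - int m)" .
  have "int (2 * n * m + (\<Sum>i\<in>UNIV. nat \<bar>int (\<alpha> i) - int m\<bar>)) \<le> int (2 * n * u)"
    using s by (simp add: algebra_simps)
  hence le: "2 * n * m + (\<Sum>i\<in>UNIV. nat \<bar>int (\<alpha> i) - int m\<bar>) \<le> 2 * n * u" by (simp only: of_nat_le_iff)
  have "c \<le> t * (q ^ (2 * n)) ^ u" using c[of j] by (simp add: j n_def)
  also have "(q ^ (2 * n)) ^ u = q ^ (2 * n * u)" by (simp add: power_mult)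
  also have "\<dots> \<le> q ^ (2 * n * m + (\<Sum>i\<in>UNIV. nat \<bar>int (\<alpha> i) - int m\<bar>))"
    using q le by (intro power_decreasing) auto
  also have "\<dots> = (q ^ (2 * n)) ^ m * (\<Prod>i\<in>UNIV. q ^ nat \<bar>int (\<alpha> i) - int m\<bar>)"
    by (simp add: power_add power_mult power_sum)
  finally show ?thesis using t by (simp add: n_def mult_left_mono)
qed

text \<open>\<open>cheb_coeff\<close> for first-kind nodes, with the node itself in place of its
  index, as \<open>tensor_sum\<close> requires. For \<open>k \<le> P\<close> the frequency never
  equals the period \<open>P + 1\<close>, so only \<open>k = 0\<close> is special.\<close>

definition cheb_weight :: "real \<Rightarrow> real \<Rightarrow> nat \<Rightarrow> nat \<Rightarrow> real \<Rightarrow> real" where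
  "cheb_weight a b P k s = (if k = 0 then 1 else 2) / real (P + 1) * poly (cheb_on a b k) s"

lemma cheb_weight_angle:
  assumes "a < b" "k \<le> P"
  shows "cheb_weight a b P k (cheb_point a b (cheb_angle First_Kind P j)) = cheb_coeff First_Kind P k j"
  using assms by (simp add: cheb_weight_def cheb_coeff_def poly_cheb_on cheb_period_def)

lemma sum_cheb_nodes:
  assumes "N \<ge> 1" "a < b"
  shows "(\<Sum>s\<in>cheb_nodes kd N a b. h s) = (\<Sum>j\<le>N. h (cheb_point a b (cheb_angle kd N j)))"
  unfolding cheb_nodes_angle by (subst sum.reindex[OF inj_cheb_angle[OF assms]]) (simp add: atMost_atLeast0)

lemma lagr_cheb_weight:
  assumes "P \<ge> 1" "a < b" "s \<in> cheb_nodes First_Kind P a b"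
  shows "poly (lagr (cheb_nodes First_Kind P a b) s) t = (\<Sum>k\<le>P. cheb_weight a b P k s * poly (cheb_on a b k) t)"
proof -
  obtain j where "j \<le> P" "s = cheb_point a b (cheb_angle First_Kind P j)"
    using assms(3) by (auto simp: cheb_nodes_angle)
  thus ?thesis using assms by (simp add: lagr_cheb poly_sum cheb_weight_angle)
qed

lemma sum_abs_cheb_weight_le:
  assumes "P \<ge> 1" "a < b" "k \<le> P"
  shows "(\<Sum>s\<in>cheb_nodes First_Kind P a b. \<bar>cheb_weight a b P k s\<bar>) \<le> 2"
  using assms sum_abs_cheb_coeff_first_kind[of P k] by (simp add: sum_cheb_nodes cheb_weight_angle)

text \<open>The discrete coefficients inherit the decay of the best approximation errors, because they
  annihilate cosine sums of lower degree.\<close>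

lemma cheb_weight_decay:
  fixes g :: "real \<Rightarrow> complex"
  assumes "P \<ge> 1" "a < b" "k \<le> P" "0 < E" "1 < \<zeta>"
    and bd: "\<And>t. t \<in> {a..b} \<Longrightarrow> cmod (g t) \<le> E"
    and ap: "\<And>m. \<exists>c. \<forall>\<theta>. cmod (g (cheb_point a b \<theta>) - (\<Sum>k\<le>m. c k * of_real (cos (real k * \<theta>)))) \<le> E / \<zeta> ^ m"
  shows "cmod (\<Sum>s\<in>cheb_nodes First_Kind P a b. cheb_weight a b P k s *\<^sub>R g s) \<le> 2 * (E * \<zeta> / \<zeta> ^ k)"
proof -
  let ?\<phi> = "cheb_angle First_Kind P"
  let ?w = "cheb_coeff First_Kind P k"
  have e: "(\<Sum>s\<in>cheb_nodes First_Kind P a b. cheb_weight a b P k s *\<^sub>R g s) = (\<Sum>j\<le>P. ?w j *\<^sub>R g (cheb_point a b (?\<phi> j)))"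
    using assms by (simp add: sum_cheb_nodes cheb_weight_angle)
  \<comment> \<open>The extra factor \<open>\<zeta>\<close> is an index shift: coefficient
    \<open>k\<close> annihilates sums of degree at most \<open>k - 1\<close>, so it inherits the
    error \<open>E / \<zeta> ^ (k - 1)\<close>. For \<open>k = 0\<close> nothing can be subtracted,
    and \<open>E\<close> bounds \<open>g\<close>.\<close>
  define D where "D = E * \<zeta> / \<zeta> ^ k"
  have D0: "0 \<le> D" using assms(4,5) by (simp add: D_def)
  have bound: "cmod (\<Sum>j\<le>P. ?w j *\<^sub>R h j) \<le> 2 * (D)" if h: "\<And>j. cmod (h j) \<le> D" for h
  proof -
    have "cmod (\<Sum>j\<le>P. ?w j *\<^sub>R h j) \<le> (\<Sum>j\<le>P. \<bar>?w j\<bar> * (D))"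
      by (intro order_trans[OF norm_sum] sum_mono) (simp add: h mult_left_mono)
    also have "\<dots> = (\<Sum>j\<le>P. \<bar>?w j\<bar>) * (D)" by (simp add: sum_distrib_right)
    also have "\<dots> \<le> 2 * (D)"
      using D0 by (intro mult_right_mono sum_abs_cheb_coeff_first_kind)
    finally show ?thesis .
  qed
  show ?thesis
  proof (cases k)
    case 0
    have "cmod (g (cheb_point a b \<theta>)) \<le> D" for \<theta>
    proof -
      have "E * 1 \<le> E * \<zeta>" using assms(4,5) by (intro mult_left_mono) auto
      thus ?thesis using bd[OF cheb_point_in[OF assms(2), of \<theta>]] 0 by (simp add: D_def)
    qed
    thus ?thesis unfolding e D_def[symmetric] by (rule bound)
  next
    case (Suc m)
    obtain c where c: "\<And>\<theta>. cmod (g (cheb_point a b \<theta>) - (\<Sum>k\<le>m. c k * of_real (cos (real k * \<theta>)))) \<le> E / \<zeta> ^ m"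
      using ap by blast
    have "(\<Sum>j\<le>P. ?w j *\<^sub>R (\<Sum>l\<le>m. c l * of_real (cos (real l * ?\<phi> j))))
       = (\<Sum>j\<le>P. \<Sum>l\<le>m. c l * of_real (?w j * cos (real l * ?\<phi> j)))"
      by (simp add: scaleR_conv_of_real sum_distrib_left mult_ac)
    also have "\<dots> = (\<Sum>l\<le>m. \<Sum>j\<le>P. c l * of_real (?w j * cos (real l * ?\<phi> j)))" by (rule sum.swap)
    also have "\<dots> = (\<Sum>l\<le>m. c l * of_real (\<Sum>j\<le>P. ?w j * cos (real l * ?\<phi> j)))"
      by (simp only: sum_distrib_left of_real_sum)
    also have "\<dots> = 0"
      using cheb_coeff_orthogonal[OF _ assms(3)] Suc by (intro sum.neutral) auto
    finally have z: "(\<Sum>j\<le>P. ?w j *\<^sub>R (\<Sum>l\<le>m. c l * of_real (cos (real l * ?\<phi> j)))) = 0" .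
    have "(\<Sum>j\<le>P. ?w j *\<^sub>R g (cheb_point a b (?\<phi> j)))
       = (\<Sum>j\<le>P. ?w j *\<^sub>R (g (cheb_point a b (?\<phi> j)) - (\<Sum>l\<le>m. c l * of_real (cos (real l * ?\<phi> j)))))"
      unfolding scaleR_diff_right sum_subtractf z by simp
    also have "cmod \<dots> \<le> 2 * (D)"
      by (rule bound) (use c Suc assms(5) in \<open>simp add: D_def\<close>)
    finally show ?thesis unfolding e D_def .
  qed
qed

lemma abs_poly_cheb_on_le:
  assumes "a < b" "t \<in> {a..b}"
  shows "\<bar>poly (cheb_on a b k) t\<bar> \<le> 1"
proof -
  obtain \<theta> where "t = cheb_point a b \<theta>" using cheb_point_surj[OF assms] by blast
  thus ?thesis using assms by (simp add: poly_cheb_on)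
qed

definition cheb_prod :: "real^'n \<Rightarrow> real^'n \<Rightarrow> ('n::finite \<Rightarrow> nat) \<Rightarrow> real^'n \<Rightarrow> real" where
  "cheb_prod a b \<alpha> x = (\<Prod>i\<in>UNIV. poly (cheb_on (a $ i) (b $ i) (\<alpha> i)) (x $ i))"

lemma tdeg_cheb_prod: "(\<Sum>i\<in>UNIV. \<alpha> i) \<le> N \<Longrightarrow> tdeg N (cheb_prod a b \<alpha>)"
  unfolding cheb_prod_def [abs_def] by (rule tdeg_mono[OF tdeg_prod_poly[OF degree_cheb_on]])

text \<open>The functional in coordinate \<open>j\<close> supplies the decay, the remaining ones
  only cost a factor 2 each. As \<open>j\<close> is free, the largest index can be used.\<close>

lemma tensor_cheb_coefficient_decay:
  fixes f :: "real^'n::finite \<Rightarrow> complex" and a b x :: "real^'n"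
  assumes "P \<ge> 1" "\<And>i. a $ i < b $ i" "0 < E" "1 < \<zeta>" "x \<in> cbox a b" "\<And>i. \<alpha> i \<le> P"
    and bd: "\<And>y. y \<in> cbox a b \<Longrightarrow> cmod (f y) \<le> E"
    and ap: "\<And>m. cheb_approximable f a b m (E / \<zeta> ^ m)"
  defines "X \<equiv> \<lambda>i. cheb_nodes First_Kind P (a $ i) (b $ i)"
  shows "cmod (tensor_sum (\<lambda>i. cheb_weight (a $ i) (b $ i) P (\<alpha> i)) X UNIV f x)
    \<le> 2 ^ CARD('n) * (E * \<zeta>) * (1 / \<zeta>) ^ \<alpha> j"
proof -
  let ?W = "\<lambda>i. cheb_weight (a $ i) (b $ i) P (\<alpha> i)"
  define J where "J = UNIV - {j}"
  define h where "h z = (\<Sum>s\<in>X j. ?W j s *\<^sub>R f (upd z j s))" for z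
  have J: "j \<notin> J" "insert j J = UNIV" by (auto simp: J_def)
  have xi: "x $ i \<in> {a $ i..b $ i}" for i using assms(5) by (auto simp: mem_box_cart)
  have "tensor_sum ?W X UNIV f x = tensor_sum ?W X J h x"
    unfolding h_def J(2)[symmetric] by (rule tensor_sum_insert[OF J(1)])
  also have "cmod \<dots> \<le> (\<Prod>i\<in>J. \<Sum>s\<in>X i. \<bar>?W i s\<bar>) * (2 * (E * \<zeta> / \<zeta> ^ \<alpha> j))"
  proof (rule norm_tensor_sum_le)
    fix y assume y: "y \<in> PiE J X"
    let ?z = "merge J y x"
    have z: "?z \<in> cbox a b"
    proof -
      have "?z $ i \<in> {a $ i..b $ i}" for i
        using xi[of i] PiE_mem[OF y, of i] cheb_nodes_subset[OF assms(1,2), of First_Kind i]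
        by (cases "i \<in> J") (auto simp: X_def)
      thus ?thesis by (auto simp: mem_box_cart)
    qed
    show "cmod (h ?z) \<le> 2 * (E * \<zeta> / \<zeta> ^ \<alpha> j)"
      unfolding h_def X_def
    proof (rule cheb_weight_decay)
      fix t assume "t \<in> {a $ j..b $ j}"
      thus "cmod (f (upd ?z j t)) \<le> E" using bd upd_mem_cbox[OF z] by blast
    next
      fix m show "\<exists>c. \<forall>\<theta>. cmod (f (upd ?z j (cheb_point (a $ j) (b $ j) \<theta>)) - (\<Sum>k\<le>m. c k * of_real (cos (real k * \<theta>)))) \<le> E / \<zeta> ^ m"
        using ap[of m] z unfolding cheb_approximable_def by blast
    qed (use assms in auto)
  qed (simp add: X_def)
  also have "\<dots> \<le> (\<Prod>i\<in>J. 2) * (2 * (E * \<zeta> / \<zeta> ^ \<alpha> j))"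
    using assms(1-4,6) by (intro mult_right_mono prod_mono) (auto simp: X_def intro!: sum_abs_cheb_weight_le sum_nonneg)
  also have "(\<Prod>i\<in>J. 2) * (2 * (E * \<zeta> / \<zeta> ^ \<alpha> j)) = 2 ^ Suc (card J) * (E * \<zeta>) * (1 / \<zeta>) ^ \<alpha> j"
    by (simp add: power_one_over)
  also have "Suc (card J) = CARD('n)" using card.insert_remove[of UNIV j] by (simp add: J_def card_Diff_singleton)
  finally show ?thesis .
qed

text \<open>The sums over nodes and frequencies are exchanged. Since the coefficient functionals act
  in all coordinates, their value is independent of the base point \<open>x0\<close>.\<close>

lemma tensor_cheb_expansion:
  fixes f :: "real^'n::finite \<Rightarrow> complex" and a b x :: "real^'n"
  assumes "P \<ge> 1" "\<And>i. a $ i < b $ i"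
  defines "X \<equiv> \<lambda>i. cheb_nodes First_Kind P (a $ i) (b $ i)"
  shows "tensor_sum (\<lambda>i s. poly (lagr (X i) s) (x $ i)) X UNIV f x
    = (\<Sum>\<alpha>\<in>PiE UNIV (\<lambda>_. {..P}). cheb_prod a b \<alpha> x *\<^sub>R tensor_sum (\<lambda>i. cheb_weight (a $ i) (b $ i) P (\<alpha> i)) X UNIV f x0)"
proof -
  have "(\<Prod>i\<in>UNIV. poly (lagr (X i) (z $ i)) (x $ i))
     = (\<Sum>\<alpha>\<in>PiE UNIV (\<lambda>_. {..P}). cheb_prod a b \<alpha> x * (\<Prod>i\<in>UNIV. cheb_weight (a $ i) (b $ i) P (\<alpha> i) (z $ i)))"
    if "z \<in> grid X" for z
  proof -
    have "(\<Prod>i\<in>UNIV. poly (lagr (X i) (z $ i)) (x $ i))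
      = (\<Prod>i\<in>UNIV. \<Sum>k\<le>P. cheb_weight (a $ i) (b $ i) P k (z $ i) * poly (cheb_on (a $ i) (b $ i) k) (x $ i))"
      using that assms by (intro prod.cong refl) (auto simp: X_def grid_def intro!: lagr_cheb_weight)
    also have "\<dots> = (\<Sum>\<alpha>\<in>PiE UNIV (\<lambda>_. {..P}). \<Prod>i\<in>UNIV. cheb_weight (a $ i) (b $ i) P (\<alpha> i) (z $ i) * poly (cheb_on (a $ i) (b $ i) (\<alpha> i)) (x $ i))"
      by (rule prod_sum_PiE) auto
    finally show ?thesis by (simp add: cheb_prod_def prod.distrib mult.commute)
  qed
  hence "tensor_sum (\<lambda>i s. poly (lagr (X i) s) (x $ i)) X UNIV f x
     = (\<Sum>z\<in>grid X. \<Sum>\<alpha>\<in>PiE UNIV (\<lambda>_. {..P}). cheb_prod a b \<alpha> x *\<^sub>R (\<Prod>i\<in>UNIV. cheb_weight (a $ i) (b $ i) P (\<alpha> i) (z $ i)) *\<^sub>R f z)"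
    by (simp add: tensor_sum_UNIV scaleR_sum_left)
  also have "\<dots> = (\<Sum>\<alpha>\<in>PiE UNIV (\<lambda>_. {..P}). \<Sum>z\<in>grid X. cheb_prod a b \<alpha> x *\<^sub>R (\<Prod>i\<in>UNIV. cheb_weight (a $ i) (b $ i) P (\<alpha> i) (z $ i)) *\<^sub>R f z)"
    by (rule sum.swap)
  finally show ?thesis by (simp add: tensor_sum_UNIV scaleR_sum_right)
qed

text \<open>\<open>P\<close> is absent from the bound, so the grid can be refined while the
  truncation degree \<open>N\<close> stays fixed.\<close>

lemma total_degree_truncation_error:
  fixes f :: "real^'n::finite \<Rightarrow> complex" and a b x :: "real^'n"
  assumes "P \<ge> 1" "\<And>i. a $ i < b $ i" "0 < E" "1 < \<zeta>" "x \<in> cbox a b" "x0 \<in> cbox a b"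
    and bd: "\<And>y. y \<in> cbox a b \<Longrightarrow> cmod (f y) \<le> E"
    and ap: "\<And>m. cheb_approximable f a b m (E / \<zeta> ^ m)"
  defines "X \<equiv> \<lambda>i. cheb_nodes First_Kind P (a $ i) (b $ i)"
  defines "c \<equiv> \<lambda>\<alpha>. tensor_sum (\<lambda>i. cheb_weight (a $ i) (b $ i) P (\<alpha> i)) X UNIV f x0"
  defines "q \<equiv> \<zeta> powr (- 1 / (2 * real CARD('n)))"
  shows "cmod (tensor_sum (\<lambda>i s. poly (lagr (X i) s) (x $ i)) X UNIV f x
      - (\<Sum>\<alpha> | (\<forall>i. \<alpha> i \<le> P) \<and> (\<Sum>i\<in>UNIV. \<alpha> i) \<le> N. cheb_prod a b \<alpha> x *\<^sub>R c \<alpha>))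
    \<le> 2 ^ CARD('n) * (E * \<zeta>) * (2 / (1 - q)) ^ CARD('n) * (1 / \<zeta>) ^ (N div CARD('n))"
proof -
  define n where "n = CARD('n)"
  define m where "m = N div n"
  define A where "A = PiE (UNIV::'n set) (\<lambda>_. {..P})"
  define T where "T = 2 ^ n * (E * \<zeta>)"
  have n0: "n > 0" by (simp add: n_def)
  have finA: "finite A" by (simp add: A_def finite_PiE)
  have T0: "T \<ge> 0" using assms(3,4) by (simp add: T_def)
  have q: "0 < q" "q < 1"
    using assms(4) n0 powr_less_mono[of "- 1 / (2 * real n)" 0 \<zeta>] by (simp_all add: q_def n_def)
  \<comment> \<open>The exponent in \<open>q\<close> is chosen for this:
    \<open>multi_index_decay\<close> spreads a decay by \<open>q ^ (2 * n)\<close> in the largest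
    index over all \<open>n\<close> coordinates.\<close>
  have qn: "q ^ (2 * n) = 1 / \<zeta>"
  proof -
    have "q ^ (2 * n) = q powr real (2 * n)" using q powr_realpow[of q "2 * n"] by simp
    also have "\<dots> = \<zeta> powr (- 1)" using n0 by (simp add: q_def n_def powr_powr)
    finally show ?thesis using assms(4) by (simp add: powr_minus_divide)
  qed
  define B where "B = {\<alpha> :: 'n \<Rightarrow> nat. (\<forall>i. \<alpha> i \<le> P) \<and> (\<Sum>i\<in>UNIV. \<alpha> i) \<le> N}"
  have BA: "B \<subseteq> A" by (auto simp: A_def B_def PiE_UNIV_domain)
  have "tensor_sum (\<lambda>i s. poly (lagr (X i) s) (x $ i)) X UNIV f x - (\<Sum>\<alpha>\<in>B. cheb_prod a b \<alpha> x *\<^sub>R c \<alpha>)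
      = (\<Sum>\<alpha>\<in>A - B. cheb_prod a b \<alpha> x *\<^sub>R c \<alpha>)"
    unfolding X_def c_def A_def[symmetric] tensor_cheb_expansion[OF assms(1,2), of x f x0]
    by (rule sum_diff[OF finA BA, symmetric])
  also have "cmod \<dots> \<le> (\<Sum>\<alpha>\<in>A - B. T * ((1 / \<zeta>) ^ m * (\<Prod>i\<in>UNIV. q ^ nat \<bar>int (\<alpha> i) - int m\<bar>)))"
  proof (rule order_trans[OF norm_sum], rule sum_mono)
    fix \<alpha> assume \<alpha>: "\<alpha> \<in> A - B"
    hence le: "\<And>i. \<alpha> i \<le> P" by (auto simp: A_def PiE_UNIV_domain)
    hence "N < (\<Sum>i\<in>UNIV. \<alpha> i)" using \<alpha> by (auto simp: B_def)
    moreover have "n * m \<le> N" by (simp add: m_def)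
    ultimately have nm: "n * m \<le> (\<Sum>i\<in>UNIV. \<alpha> i)" by linarith
    have "\<bar>cheb_prod a b \<alpha> x\<bar> \<le> 1"
      unfolding cheb_prod_def abs_prod using assms(2,5)
      by (intro prod_le_1 conjI abs_poly_cheb_on_le) (auto simp: mem_box_cart)
    hence "cmod (cheb_prod a b \<alpha> x *\<^sub>R c \<alpha>) \<le> cmod (c \<alpha>)"
      by (simp add: mult_left_le_one_le)
    also have "\<dots> \<le> T * ((q ^ (2 * CARD('n))) ^ m * (\<Prod>i\<in>UNIV. q ^ nat \<bar>int (\<alpha> i) - int m\<bar>))"
    proof (rule multi_index_decay[OF q])
      show "cmod (c \<alpha>) \<le> T * (q ^ (2 * CARD('n))) ^ \<alpha> i" for i
        unfolding qn[unfolded n_def] T_def n_def c_def X_def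
        by (rule tensor_cheb_coefficient_decay[OF assms(1-4,6) le bd ap])
    qed (use nm T0 n_def in auto)
    finally show "cmod (cheb_prod a b \<alpha> x *\<^sub>R c \<alpha>)
      \<le> T * ((1 / \<zeta>) ^ m * (\<Prod>i\<in>UNIV. q ^ nat \<bar>int (\<alpha> i) - int m\<bar>))" unfolding qn[unfolded n_def] .
  qed
  also have "\<dots> \<le> (\<Sum>\<alpha>\<in>A. T * ((1 / \<zeta>) ^ m * (\<Prod>i\<in>UNIV. q ^ nat \<bar>int (\<alpha> i) - int m\<bar>)))"
    using finA T0 q assms(4) by (intro sum_mono2) (auto intro!: mult_nonneg_nonneg prod_nonneg)
  also have "\<dots> = T * (1 / \<zeta>) ^ m * (\<Sum>\<alpha>\<in>A. \<Prod>i\<in>UNIV. q ^ nat \<bar>int (\<alpha> i) - int m\<bar>)"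
    by (simp add: sum_distrib_left mult.assoc)
  also have "(\<Sum>\<alpha>\<in>A. \<Prod>i\<in>UNIV. q ^ nat \<bar>int (\<alpha> i) - int m\<bar>) = (\<Prod>i\<in>(UNIV::'n set). \<Sum>k\<le>P. q ^ nat \<bar>int k - int m\<bar>)"
    unfolding A_def by (rule prod_sum_PiE[symmetric]) auto
  also have "T * (1 / \<zeta>) ^ m * \<dots> \<le> T * (1 / \<zeta>) ^ m * (\<Prod>i\<in>(UNIV::'n set). 2 / (1 - q))"
    using T0 q assms(4) by (intro mult_left_mono prod_mono conjI sum_geometric_dist_le sum_nonneg) auto
  finally show ?thesis by (simp add: B_def T_def m_def n_def mult_ac)
qed

section \<open>Error estimates\<close>

lemma of_real_in_bernstein_ellipse:
  assumes "a < b" "1 < \<zeta>" "t \<in> {a..b}"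
  shows "of_real t \<in> bernstein_ellipse a b \<zeta>"
proof -
  obtain \<theta> where \<theta>: "t = cheb_point a b \<theta>" using cheb_point_surj[OF assms(1,3)] by blast
  \<comment> \<open>The sign compensates for the factor \<open>(a - b) / 2\<close> in the
    parametrisation; the unit circle covers the interval.\<close>
  define z where "z = - cis \<theta>"
  have "(z + inverse z) / 2 = of_real (- cos \<theta>)"
    by (simp add: z_def complex_eq_iff)
  hence "of_real t = of_real ((a + b) / 2) + of_real ((a - b) / 2) * ((z + inverse z) / 2)"
    unfolding \<theta> cheb_point_def by (simp add: algebra_simps)
  moreover have "cmod z = 1" by (simp add: z_def)
  ultimately show ?thesis unfolding bernstein_ellipse_def using assms by auto
qed

lemma componentwise_analytic_cheb_approximable:
  fixes f :: "real^'n::finite \<Rightarrow> complex" and a b :: "real^'n"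
  assumes ab: "\<And>i. a $ i < b $ i" and \<zeta>: "1 < \<zeta>"
    and an: "componentwise_analytic f a b \<zeta>" and bd: "uniformly_bounded_ext f a b \<zeta>"
  shows "\<exists>E>0. (\<forall>y\<in>cbox a b. cmod (f y) \<le> E) \<and> (\<forall>m. cheb_approximable f a b m (E / \<zeta> ^ m))"
proof -
  obtain B0 where B0: "\<And>i y F z. y \<in> cbox a b \<Longrightarrow> is_component_ext f a b \<zeta> i y F \<Longrightarrow>
      z \<in> closure (bernstein_ellipse (a $ i) (b $ i) \<zeta>) \<Longrightarrow> cmod (F z) \<le> B0"
    using bd unfolding uniformly_bounded_ext_def by blast
  define B where "B = max B0 1"
  have B: "B > 0" "B0 \<le> B" by (auto simp: B_def)
  \<comment> \<open>One constant dominates both the size of \<open>f\<close> and the factor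
    \<open>4 * B / (\<zeta> - 1)\<close> of the approximation error.\<close>
  define E where "E = B + 4 * B / (\<zeta> - 1)"
  have E: "E > 0" "B \<le> E" "4 * B / (\<zeta> - 1) \<le> E" using B \<zeta> by (auto simp: E_def intro!: add_pos_nonneg)
  have ext: "\<exists>F. F analytic_on bernstein_ellipse (a $ j) (b $ j) \<zeta> \<and>
      (\<forall>z\<in>bernstein_ellipse (a $ j) (b $ j) \<zeta>. cmod (F z) \<le> B) \<and>
      (\<forall>t\<in>{a $ j..b $ j}. F (of_real t) = f (upd y j t))" if y: "y \<in> cbox a b" for j y
  proof -
    obtain F where F: "is_component_ext f a b \<zeta> j y F"
      using an y unfolding componentwise_analytic_def by blast
    have "cmod (F z) \<le> B" if "z \<in> bernstein_ellipse (a $ j) (b $ j) \<zeta>" for z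
      using B0[OF y F, of z] closure_subset that B(2) by fastforce
    thus ?thesis using F unfolding is_component_ext_def upd_def by blast
  qed
  have "cmod (f y) \<le> E" if y: "y \<in> cbox a b" for y
  proof -
    \<comment> \<open>Any coordinate will do: \<open>f y\<close> is a value of the extension in that
      coordinate.\<close>
    define j where "j = (undefined :: 'n)"
    obtain F where F: "\<And>z. z \<in> bernstein_ellipse (a $ j) (b $ j) \<zeta> \<Longrightarrow> cmod (F z) \<le> B"
      "\<And>t. t \<in> {a $ j..b $ j} \<Longrightarrow> F (of_real t) = f (upd y j t)" using ext[OF y, of j] by blast
    have yj: "y $ j \<in> {a $ j..b $ j}" using y by (auto simp: mem_box_cart)
    have "cmod (F (of_real (y $ j))) \<le> B"
      by (rule F(1)[OF of_real_in_bernstein_ellipse[OF ab \<zeta> yj]])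
    thus ?thesis using F(2)[OF yj] E(2) by simp
  qed
  moreover have "cheb_approximable f a b m (E / \<zeta> ^ m)" for m
    unfolding cheb_approximable_def
  proof (intro allI ballI)
    fix j y assume y: "y \<in> cbox a b"
    obtain F where F: "F analytic_on bernstein_ellipse (a $ j) (b $ j) \<zeta>"
      "\<And>z. z \<in> bernstein_ellipse (a $ j) (b $ j) \<zeta> \<Longrightarrow> cmod (F z) \<le> B"
      "\<And>t. t \<in> {a $ j..b $ j} \<Longrightarrow> F (of_real t) = f (upd y j t)" using ext[OF y, of j] by blast
    obtain c :: "nat \<Rightarrow> complex" where c: "\<And>\<theta>. cmod (F (of_real (cheb_point (a $ j) (b $ j) \<theta>)) - (\<Sum>k\<le>m. c k * of_real (cos (real k * \<theta>))))
      \<le> 4 * B / (\<zeta> - 1) / \<zeta> ^ m"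
      using bernstein_approximation[OF ab \<zeta> B(1) F(1,2), of m] unfolding cheb_point_def by blast
    have "4 * B / (\<zeta> - 1) / \<zeta> ^ m \<le> E / \<zeta> ^ m" using E(3) \<zeta> by (intro divide_right_mono) auto
    hence "cmod (f (upd y j (cheb_point (a $ j) (b $ j) \<theta>)) - (\<Sum>k\<le>m. c k * of_real (cos (real k * \<theta>)))) \<le> E / \<zeta> ^ m" for \<theta>
      using c[of \<theta>] F(3)[OF cheb_point_in[OF ab]] by simp
    thus "\<exists>c. \<forall>\<theta>. cmod (f (upd y j (cheb_point (a $ j) (b $ j) \<theta>)) - (\<Sum>k\<le>m. c k * of_real (cos (real k * \<theta>)))) \<le> E / \<zeta> ^ m"
      by blast
  qed
  ultimately show ?thesis using E(1) by blast
qed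

text \<open>Splitting \<open>1 / \<zeta> ^ P\<close> evenly into \<open>n\<close> factors leaves one
  exponential \<open>q ^ P\<close> to beat each logarithm.\<close>

lemma interpolation_bound_tendsto_0:
  fixes \<zeta> c d :: real
  assumes "1 < \<zeta>" "n > 0"
  shows "(\<lambda>P. c * (36 * ln (real (P + 1))) ^ n * (2 * (d / \<zeta> ^ P))) \<longlonglongrightarrow> 0"
proof -
  define q where "q = \<zeta> powr (- 1 / real n)"
  have q: "0 < q" "q < 1"
    using assms powr_less_mono[of "- 1 / real n" 0 \<zeta>] by (simp_all add: q_def)
  have "q ^ n = q powr real n" using q by (simp add: powr_realpow)
  also have "\<dots> = \<zeta> powr (- 1)" using assms by (simp add: q_def powr_powr)
  finally have qn: "q ^ n = 1 / \<zeta>" using assms by (simp add: powr_minus_divide)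
  have "(\<lambda>P. real P * q ^ P) \<longlonglongrightarrow> 0"
    using powser_times_n_limit_0[of q] q by simp
  hence "(\<lambda>P. ln (real (P + 1)) * q ^ P) \<longlonglongrightarrow> 0"
  proof (rule Lim_null_comparison[rotated], intro always_eventually allI)
    fix P
    have "ln (real (P + 1)) \<le> real P" using ln_le_minus_one[of "real (P + 1)"] by simp
    thus "norm (ln (real (P + 1)) * q ^ P) \<le> real P * q ^ P"
      using q by (simp add: abs_mult mult_right_mono)
  qed
  hence "(\<lambda>P. c * 36 ^ n * (2 * d) * (ln (real (P + 1)) * q ^ P) ^ n) \<longlonglongrightarrow> c * 36 ^ n * (2 * d) * 0 ^ n"
    by (intro tendsto_intros)
  moreover have "c * 36 ^ n * (2 * d) * (ln (real (P + 1)) * q ^ P) ^ n = c * (36 * ln (real (P + 1))) ^ n * (2 * (d / \<zeta> ^ P))" for P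
  proof -
    have "(q ^ P) ^ n = (q ^ n) ^ P" by (simp add: mult.commute flip: power_mult)
    hence "(q ^ P) ^ n = 1 / \<zeta> ^ P" by (simp add: qn power_one_over)
    thus ?thesis by (simp add: power_mult_distrib)
  qed
  ultimately show ?thesis by (simp add: zero_power[OF assms(2)])
qed

lemma continuous_on_cheb_prod: "continuous_on A (cheb_prod a b \<alpha>)"
  unfolding cheb_prod_def [abs_def] by (intro continuous_intros)

text \<open>The approximability is separate in the coordinates, but the tensor interpolation error
  is uniform on the box, so \<open>f\<close> is a uniform limit of polynomials.\<close>

lemma cheb_approximable_continuous_on:
  fixes f :: "real^'n::finite \<Rightarrow> complex" and a b :: "real^'n"
  assumes ab: "\<And>i. a $ i < b $ i" and \<zeta>: "1 < \<zeta>" and E: "0 < E"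
    and ap: "\<And>m. cheb_approximable f a b m (E / \<zeta> ^ m)"
  shows "continuous_on (cbox a b) f"
proof -
  define X where "X P i = cheb_nodes First_Kind P (a $ i) (b $ i)" for P i
  define p where "p P x = tensor_sum (\<lambda>i s. poly (lagr (X P i) s) (x $ i)) (X P) UNIV f x" for P x
  define e where "e P = real CARD('n) * (36 * ln (real (P + 1))) ^ CARD('n) * (2 * (E / \<zeta> ^ P))" for P
  have e0: "e \<longlonglongrightarrow> 0" unfolding e_def by (rule interpolation_bound_tendsto_0[OF \<zeta>]) simp
  have err: "cmod (f x - p P x) \<le> e P" if "P \<ge> 1" "x \<in> cbox a b" for P x
    unfolding p_def e_def X_def
    by (rule tensor_cheb_interpolation_error[OF that(1) ab ap _ that(2), of "\<lambda>_. First_Kind" UNIV]) (use E \<zeta> in simp)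
  show ?thesis
  proof (rule uniform_limit_theorem[of _ p sequentially])
    have "eventually (\<lambda>P. P \<ge> 1) sequentially" by (rule eventually_ge_at_top)
    thus "\<forall>\<^sub>F P in sequentially. continuous_on (cbox a b) (p P)"
    proof (rule eventually_mono)
      fix P :: nat assume P: "P \<ge> 1"
      show "continuous_on (cbox a b) (p P)"
        unfolding p_def X_def tensor_cheb_expansion[OF P ab, of _ f 0]
        by (intro continuous_intros continuous_on_cheb_prod)
    qed
    show "uniform_limit (cbox a b) p f sequentially"
      unfolding uniform_limit_iff
    proof (intro allI impI)
      fix d :: real assume "d > 0"
      hence "eventually (\<lambda>P. e P < d) sequentially" by (rule order_tendstoD(2)[OF e0])
      moreover have "eventually (\<lambda>P. P \<ge> 1) sequentially" by (rule eventually_ge_at_top)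
      ultimately show "\<forall>\<^sub>F P in sequentially. \<forall>x\<in>cbox a b. dist (p P x) (f x) < d"
      proof eventually_elim
        case (elim P)
        show ?case
        proof
          fix x assume "x \<in> cbox a b"
          from err[OF elim(2) this] elim(1) show "dist (p P x) (f x) < d"
            by (simp add: dist_norm norm_minus_commute)
        qed
      qed
    qed
  qed simp
qed

text \<open>Regularity of \<open>f\<close> is known on \<open>K\<close> only, so the comparison runs
  through \<open>f\<close> cut off outside \<open>\<Gamma>\<close>, which is measurable and agrees
  with \<open>f\<close> almost everywhere.\<close>

lemma invariant_integral_diff_le:
  fixes f p :: "real^'n \<Rightarrow> complex"
  assumes inv: "is_invariant_measure S \<mu> M" and \<Gamma>: "AE x in M. x \<in> \<Gamma>" "compact \<Gamma>" "\<Gamma> \<subseteq> K"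
    and f: "continuous_on K f" and p: "continuous_on UNIV p"
    and e: "\<And>x. x \<in> K \<Longrightarrow> cmod (f x - p x) \<le> e"
  shows "cmod ((\<integral>x. p x \<partial>M) - (LINT x:\<Gamma>|M. f x)) \<le> e"
proof -
  interpret prob_space M using inv by (simp add: is_invariant_measure_def)
  have sets: "sets M = sets borel" using inv by (simp add: is_invariant_measure_def)
  define g where "g x = indicator \<Gamma> x *\<^sub>R f x" for x
  have fc: "continuous_on \<Gamma> f" using f \<Gamma>(3) by (rule continuous_on_subset)
  have "g \<in> borel_measurable borel"
    unfolding g_def using \<Gamma>(2) fc by (intro borel_measurable_continuous_on_indicator borel_compact)
  hence gm: "g \<in> borel_measurable M" using sets by (simp cong: measurable_cong_sets)
  have "bounded (f ` \<Gamma>)" by (rule compact_imp_bounded[OF compact_continuous_image[OF fc \<Gamma>(2)]])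
  then obtain B where B: "\<And>x. x \<in> \<Gamma> \<Longrightarrow> norm (f x) \<le> B" by (auto simp: bounded_iff)
  have gi: "integrable M g"
  proof (rule integrable_const_bound[OF _ gm])
    show "AE x in M. norm (g x) \<le> B"
      using \<Gamma>(1) by (rule eventually_mono) (simp add: g_def B)
  qed
  have pi: "integrable M p" by (rule invariant_measure_integrable[OF inv p])
  have "(\<integral>x. p x \<partial>M) - (LINT x:\<Gamma>|M. f x) = (\<integral>x. p x - g x \<partial>M)"
    unfolding set_lebesgue_integral_def g_def[symmetric] using pi gi by simp
  also have "norm \<dots> \<le> (\<integral>x. norm (p x - g x) \<partial>M)" by (rule integral_norm_bound)
  also have "\<dots> \<le> (\<integral>x. e \<partial>M)"
  proof (rule integral_mono_AE)
    show "AE x in M. norm (p x - g x) \<le> e"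
      using \<Gamma>(1)
    proof (rule eventually_mono)
      fix x assume "x \<in> \<Gamma>"
      thus "norm (p x - g x) \<le> e" using e[of x] \<Gamma>(3) by (auto simp: g_def norm_minus_commute)
    qed
  qed (use pi gi in auto)
  finally show ?thesis by (simp add: prob_space)
qed

lemma affine_map_contraction:
  fixes A :: "'l::finite \<Rightarrow> real^'n^'n"
  assumes "\<And>l. spectral_norm (A l) < 1"
  shows "\<exists>\<rho>. 0 < \<rho> \<and> \<rho> < 1 \<and> (\<forall>l x y. dist (affine_map (A l) (v l) x) (affine_map (A l) (v l) y) \<le> \<rho> * dist x y)"
proof -
  \<comment> \<open>The entry \<open>1 / 2\<close> keeps the common contraction factor positive even
    if every \<open>A l\<close> is zero.\<close>
  define \<rho> where "\<rho> = Max (insert (1 / 2) (range (\<lambda>l. spectral_norm (A l))))"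
  have "1 / 2 \<le> \<rho>" unfolding \<rho>_def by (rule Max_ge) auto
  moreover have "\<rho> < 1" unfolding \<rho>_def using assms by (subst Max_less_iff) auto
  moreover have "dist (affine_map (A l) (v l) x) (affine_map (A l) (v l) y) \<le> \<rho> * dist x y" for l x y
  proof -
    have "dist (affine_map (A l) (v l) x) (affine_map (A l) (v l) y) = norm (A l *v (x - y))"
      by (simp add: affine_map_def dist_norm matrix_vector_mult_diff_distrib)
    also have "\<dots> \<le> spectral_norm (A l) * norm (x - y)"
      unfolding spectral_norm_def by (rule onorm[OF matrix_vector_mul_bounded_linear])
    also have "\<dots> \<le> \<rho> * norm (x - y)"
      unfolding \<rho>_def by (intro mult_right_mono Max_ge) auto
    finally show ?thesis by (simp add: dist_norm)
  qed
  ultimately show ?thesis by (intro exI[of _ \<rho>]) auto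
qed

theorem theorem5p14:
  fixes A :: "'l::finite \<Rightarrow> real^'n^'n" and v :: "'l \<Rightarrow> real^'n" and \<mu> :: "'l \<Rightarrow> real"
    and S :: "'l \<Rightarrow> real^'n \<Rightarrow> real^'n"
    and \<Gamma> :: "(real^'n) set" and M :: "(real^'n) measure"
    and a b :: "real^'n" and f :: "real^'n \<Rightarrow> complex" and \<zeta> :: real
  defines "S \<equiv> \<lambda>l. affine_map (A l) (v l)"
  assumes "CARD('l) \<ge> 2"
    and "\<forall>l. spectral_norm (A l) < 1"
    and "is_attractor S \<Gamma>"
    and "\<forall>l. 0 < \<mu> l \<and> \<mu> l < 1" and "(\<Sum>l\<in>UNIV. \<mu> l) = 1"
    and "is_invariant_measure S \<mu> M"
    and "\<forall>i. a $ i < b $ i" and "\<Gamma> \<subseteq> cbox a b"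
    and "\<zeta> > 1"
    and "componentwise_analytic f a b \<zeta>"
    and "uniformly_bounded_ext f a b \<zeta>"
  shows "\<exists>C>0.
    ((\<forall>N\<ge>1. ifs_invariant S \<mu> (Q_space N)) \<longrightarrow>
      (\<forall>N\<ge>1. \<forall>k w. cubature_weights S \<mu> N (cheb_grid k N a b) w \<longrightarrow>
        cmod (cubature (cheb_grid k N a b) w f - (LINT x:\<Gamma>|M. f x))
          \<le> C * \<zeta> powi (- int N) / (\<zeta> - 1) * ln (real (N + 1)) ^ (2 * CARD('n) - 1))) \<and>
    (\<not> (\<forall>N\<ge>1. ifs_invariant S \<mu> (Q_space N)) \<longrightarrow>
      (\<forall>N\<ge>1. \<forall>k w. cubature_weights S \<mu> N (cheb_grid k N a b) w \<longrightarrow>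
        cmod (cubature (cheb_grid k N a b) w f - (LINT x:\<Gamma>|M. f x))
          \<le> C * \<zeta> powi (- int (N div CARD('n))) / (\<zeta> - 1)
              * (1 + l1_norm (cheb_grid k N a b) w)))"
proof -
  define n where "n = CARD('n)"
  have n0: "n > 0" by (simp add: n_def)
  have ab: "\<And>i. a $ i < b $ i" and \<zeta>: "1 < \<zeta>" and inv: "is_invariant_measure S \<mu> M"
    and \<mu>: "\<And>l. 0 \<le> \<mu> l" "(\<Sum>l\<in>UNIV. \<mu> l) = 1"
    using assms by (auto intro: less_imp_le)
  obtain \<rho> where \<rho>: "0 < \<rho>" "\<rho> < 1" "\<And>l x y. dist (S l x) (S l y) \<le> \<rho> * dist x y"
    using affine_map_contraction[of A v] assms(3) unfolding S_def by blast
  have \<Gamma>: "compact \<Gamma>" using assms(4) by (simp add: is_attractor_def)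
  have AE\<Gamma>: "AE x in M. x \<in> \<Gamma>"
    by (rule invariant_measure_attractor[OF inv \<mu> less_imp_le[OF \<rho>(1)] \<rho>(2,3) assms(4)])
  obtain E where E: "E > 0" and fE: "\<And>y. y \<in> cbox a b \<Longrightarrow> cmod (f y) \<le> E"
    and ap: "\<And>m. cheb_approximable f a b m (E / \<zeta> ^ m)"
    using componentwise_analytic_cheb_approximable[OF ab \<zeta> assms(11,12)] by blast
  have cont: "continuous_on (cbox a b) f"
    by (rule cheb_approximable_continuous_on[OF ab \<zeta> E ap])
  note diff = invariant_integral_diff_le[OF inv AE\<Gamma> \<Gamma> assms(9) cont]
  define err where "err P = real n * (36 * ln (real (P + 1))) ^ n * (2 * (E / \<zeta> ^ P))" for P
  have interp: "cmod (f x - tensor_sum (\<lambda>i s. poly (lagr (cheb_nodes (k i) P (a $ i) (b $ i)) s) (x $ i))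
      (\<lambda>i. cheb_nodes (k i) P (a $ i) (b $ i)) UNIV f x) \<le> err P"
    if "P \<ge> 1" "x \<in> cbox a b" for P x k
    unfolding err_def n_def
    by (rule tensor_cheb_interpolation_error[OF that(1) ab ap _ that(2), of k UNIV]) (use E \<zeta> in simp)
  have dim: "\<And>i. finite (cheb_nodes (k i) N (a $ i) (b $ i))" "\<And>i. card (cheb_nodes (k i) N (a $ i) (b $ i)) = N + 1"
    if "N \<ge> 1" for N k
    using card_cheb_nodes[OF that ab] by auto
  define q where "q = \<zeta> powr (- 1 / (2 * real CARD('n)))"
  define T where "T = 2 ^ n * (E * \<zeta>) * (2 / (1 - q)) ^ n"
  have "q < 1" using \<zeta> n0 powr_less_mono[of "- 1 / (2 * real n)" 0 \<zeta>] by (simp add: q_def n_def)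
  hence T0: "T > 0" using E \<zeta> by (simp add: T_def)
  \<comment> \<open>The factor \<open>\<zeta> - 1\<close> cancels the denominator of the claim, and
    \<open>(3 / 2) ^ (n - 1)\<close> pays for raising the power of the logarithm from
    \<open>n\<close> to \<open>2 * n - 1\<close>.\<close>
  define C1 where "C1 = real n * 36 ^ n * (2 * E) * (\<zeta> - 1) * (3 / 2) ^ (n - 1)"
  define C2 where "C2 = T * (\<zeta> - 1)"
  have C1: "C1 > 0" and C2: "C2 > 0" using n0 E \<zeta> T0 by (simp_all add: C1_def C2_def)

  have invariant_case: "cmod (cubature (cheb_grid k N a b) w f - (LINT x:\<Gamma>|M. f x)) \<le> err N"
    if N: "N \<ge> 1" and Q: "ifs_invariant S \<mu> (Q_space N)" and w: "cubature_weights S \<mu> N (cheb_grid k N a b) w"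
    for N k w
  proof -
    define X where "X = (\<lambda>i. cheb_nodes (k i) N (a $ i) (b $ i))"
    have X: "\<And>i. finite (X i)" "\<And>i. card (X i) = N + 1" using dim[OF N] by (auto simp: X_def)
    have G: "cheb_grid k N a b = grid X" by (simp add: cheb_grid_eq X_def)
    define p where "p x = (\<Sum>z\<in>grid X. tensor_lagr X z x *\<^sub>R f z)" for x
    have cL: "continuous_on UNIV (tensor_lagr X z)" if "z \<in> grid X" for z
      by (rule continuous_on_Q_space[OF tensor_lagr_in_Q_space[OF X that]])
    have "cmod (f x - p x) \<le> err N" if "x \<in> cbox a b" for x
      using interp[OF N that, of k] by (simp add: p_def tensor_sum_UNIV tensor_lagr_def X_def)
    moreover have "continuous_on UNIV p" unfolding p_def using cL by (intro continuous_intros)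
    ultimately have "cmod ((\<integral>x. p x \<partial>M) - (LINT x:\<Gamma>|M. f x)) \<le> err N" by (intro diff)
    moreover have "(\<integral>x. p x \<partial>M) = cubature (cheb_grid k N a b) w f"
    proof -
      have "w z = (\<integral>x. tensor_lagr X z x \<partial>M)" if z: "z \<in> grid X" for z
      proof -
        have "(\<Sum>x\<in>grid X. w x * tensor_lagr X z x) = (\<integral>x. tensor_lagr X z x \<partial>M)"
          by (rule cubature_exact[OF inv \<mu> \<rho> X w[unfolded G], where V = "Q_space N"])
             (use Q coord_poly_Q_space tensor_lagr_in_Q_space[OF X z] cL[OF z] in \<open>auto simp: ifs_invariant_def\<close>)
        moreover have "(\<Sum>x\<in>grid X. w x * tensor_lagr X z x) = (\<Sum>x\<in>grid X. if x = z then w x else 0)"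
          using z X by (intro sum.cong refl) (simp add: tensor_lagr_node)
        moreover have "\<dots> = w z" using z finite_grid[of X, OF X(1)] by simp
        ultimately show ?thesis by simp
      qed
      moreover have "(\<integral>x. p x \<partial>M) = (\<Sum>z\<in>grid X. (\<integral>x. tensor_lagr X z x \<partial>M) *\<^sub>R f z)"
        unfolding p_def using invariant_measure_integrable[OF inv cL] by (simp add: Bochner_Integration.integral_sum)
      ultimately show ?thesis by (simp add: cubature_def G scaleR_conv_of_real)
    qed
    ultimately show ?thesis by simp
  qed

  have general_case: "cmod (cubature (cheb_grid k N a b) w f - (LINT x:\<Gamma>|M. f x))
      \<le> (1 + l1_norm (cheb_grid k N a b) w) * (T * (1 / \<zeta>) ^ (N div n))"
    if N: "N \<ge> 1" and w: "cubature_weights S \<mu> N (cheb_grid k N a b) w"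
    for N k w
  proof -
    define X where "X = (\<lambda>i. cheb_nodes (k i) N (a $ i) (b $ i))"
    have X: "\<And>i. finite (X i)" "\<And>i. card (X i) = N + 1" using dim[OF N] by (auto simp: X_def)
    have G: "cheb_grid k N a b = grid X" by (simp add: cheb_grid_eq X_def)
    have sub: "grid X \<subseteq> cbox a b" using cheb_grid_subset_cbox[OF N ab, of k] by (simp add: G)
    define W where "W = l1_norm (grid X) w"
    have W0: "W \<ge> 0" by (simp add: W_def l1_norm_def sum_nonneg)
    \<comment> \<open>\<open>P\<close> is the size of an auxiliary grid, unrelated to the cubature
      grid: \<open>err P\<close> is the interpolation error there, and the second term comes from
      the truncation to total degree \<open>N\<close>.\<close>
    have bound: "cmod (cubature (grid X) w f - (LINT x:\<Gamma>|M. f x)) \<le> (1 + W) * (err P + T * (1 / \<zeta>) ^ (N div n))"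
      if P: "P \<ge> 1" for P
    proof -
      define Y where "Y = (\<lambda>i. cheb_nodes First_Kind P (a $ i) (b $ i))"
      define c where "c = (\<lambda>\<alpha>. tensor_sum (\<lambda>i. cheb_weight (a $ i) (b $ i) P (\<alpha> i)) Y UNIV f a)"
      define R where "R = {\<alpha> :: 'n \<Rightarrow> nat. (\<forall>i. \<alpha> i \<le> P) \<and> (\<Sum>i\<in>UNIV. \<alpha> i) \<le> N}"
      define p where "p x = (\<Sum>\<alpha>\<in>R. cheb_prod a b \<alpha> x *\<^sub>R c \<alpha>)" for x
      define e where "e = err P + T * (1 / \<zeta>) ^ (N div n)"
      have aK: "a \<in> cbox a b" using ab by (auto simp: mem_box_cart intro: less_imp_le)
      have fp: "cmod (f x - p x) \<le> e" if x: "x \<in> cbox a b" for x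
      proof -
        define I where "I = tensor_sum (\<lambda>i s. poly (lagr (Y i) s) (x $ i)) Y UNIV f x"
        have "cmod (f x - I) \<le> err P" using interp[OF P x, of "\<lambda>_. First_Kind"] by (simp add: I_def Y_def)
        moreover have "cmod (I - p x) \<le> T * (1 / \<zeta>) ^ (N div n)"
          using total_degree_truncation_error[OF P ab E \<zeta> x aK fE ap, of N]
          unfolding I_def p_def R_def c_def Y_def T_def n_def q_def .
        ultimately show ?thesis unfolding e_def by (rule norm_diff_triangle_le)
      qed
      have "cmod ((\<integral>x. p x \<partial>M) - (LINT x:\<Gamma>|M. f x)) \<le> e"
        by (rule diff) (use fp in \<open>auto simp: p_def intro!: continuous_intros continuous_on_cheb_prod\<close>)
      moreover have "(\<integral>x. p x \<partial>M) = (\<Sum>x\<in>grid X. w x *\<^sub>R p x)"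
      proof -
        have "(\<integral>x. cheb_prod a b \<alpha> x \<partial>M) = (\<Sum>x\<in>grid X. w x * cheb_prod a b \<alpha> x)" if "\<alpha> \<in> R" for \<alpha>
        proof (rule cubature_exact[OF inv \<mu> \<rho> X w[unfolded G], where V = "Collect (tdeg N)", symmetric])
          show "cheb_prod a b \<alpha> \<in> Collect (tdeg N)" using that by (simp add: R_def tdeg_cheb_prod)
        qed (auto simp: coord_poly_tdeg S_def tdeg_ruelle continuous_on_cheb_prod)
        hence "(\<Sum>\<alpha>\<in>R. (\<integral>x. cheb_prod a b \<alpha> x \<partial>M) *\<^sub>R c \<alpha>) = (\<Sum>\<alpha>\<in>R. \<Sum>x\<in>grid X. (w x * cheb_prod a b \<alpha> x) *\<^sub>R c \<alpha>)"
          by (simp add: scaleR_sum_left)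
        also have "\<dots> = (\<Sum>x\<in>grid X. \<Sum>\<alpha>\<in>R. (w x * cheb_prod a b \<alpha> x) *\<^sub>R c \<alpha>)" by (rule sum.swap)
        also have "\<dots> = (\<Sum>x\<in>grid X. w x *\<^sub>R p x)" by (simp add: p_def scaleR_sum_right)
        finally show ?thesis
          unfolding p_def using invariant_measure_integrable[OF inv continuous_on_cheb_prod]
          by (simp add: Bochner_Integration.integral_sum)
      qed
      ultimately have 1: "cmod ((\<Sum>x\<in>grid X. w x *\<^sub>R p x) - (LINT x:\<Gamma>|M. f x)) \<le> e" by simp
      have "cubature (grid X) w f - (\<Sum>x\<in>grid X. w x *\<^sub>R p x) = (\<Sum>x\<in>grid X. w x *\<^sub>R (f x - p x))"
        by (simp add: cubature_def scaleR_conv_of_real sum_subtractf right_diff_distrib)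
      also have "cmod \<dots> \<le> (\<Sum>x\<in>grid X. \<bar>w x\<bar> * e)"
        by (intro order_trans[OF norm_sum] sum_mono) (use fp sub in \<open>auto intro!: mult_left_mono\<close>)
      also have "\<dots> = W * e" by (simp add: W_def l1_norm_def sum_distrib_right)
      finally have "cmod (cubature (grid X) w f - (LINT x:\<Gamma>|M. f x)) \<le> W * e + e"
        using 1 by (rule norm_diff_triangle_le)
      thus ?thesis by (simp add: e_def algebra_simps)
    qed
    \<comment> \<open>The left-hand side of \<open>bound\<close> does not involve \<open>P\<close>,
      so letting \<open>P\<close> grow removes the logarithms.\<close>
    have "err \<longlonglongrightarrow> 0" unfolding err_def by (rule interpolation_bound_tendsto_0[OF \<zeta> n0])
    hence "(\<lambda>P. (1 + W) * (err P + T * (1 / \<zeta>) ^ (N div n))) \<longlonglongrightarrow> (1 + W) * (0 + T * (1 / \<zeta>) ^ (N div n))"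
      by (intro tendsto_intros)
    hence "cmod (cubature (grid X) w f - (LINT x:\<Gamma>|M. f x)) \<le> (1 + W) * (0 + T * (1 / \<zeta>) ^ (N div n))"
      by (rule LIMSEQ_le_const) (use bound in blast)
    thus ?thesis by (simp add: G W_def)
  qed

  have zp: "\<zeta> powi (- int m) = (1 / \<zeta>) ^ m" for m
    by (simp add: power_int_minus power_one_over inverse_eq_divide)
  show ?thesis
  proof (intro exI[of _ "C1 + C2"] conjI impI allI)
    show "0 < C1 + C2" using C1 C2 by simp
  next
    fix N :: nat and k w
    assume Q: "\<forall>N\<ge>1. ifs_invariant S \<mu> (Q_space N)" and N: "1 \<le> N"
      and w: "cubature_weights S \<mu> N (cheb_grid k N a b) w"
    define L where "L = ln (real (N + 1))"
    have "ln 2 \<le> L" using N unfolding L_def by (subst ln_le_cancel_iff) auto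
    hence L: "2 / 3 \<le> L" using ln2_ge_two_thirds by linarith
    have "2 * n - 1 = n + (n - 1)" using n0 by simp
    hence e: "L ^ (2 * n - 1) = L ^ n * L ^ (n - 1)" by (simp only: power_add)
    \<comment> \<open>As \<open>L\<close> is at least \<open>2 / 3\<close>, each of the
      \<open>n - 1\<close> surplus factors \<open>L\<close> costs at most
      \<open>3 / 2\<close>.\<close>
    have "1 = (3 / 2) ^ (n - 1) * (2 / 3 :: real) ^ (n - 1)"
      by (simp flip: power_mult_distrib)
    also have "\<dots> \<le> (3 / 2) ^ (n - 1) * L ^ (n - 1)"
      using L by (intro mult_left_mono power_mono) auto
    finally have L1: "1 \<le> (3 / 2) ^ (n - 1) * L ^ (n - 1)" .
    have "cmod (cubature (cheb_grid k N a b) w f - (LINT x:\<Gamma>|M. f x)) \<le> err N"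
      using invariant_case N Q w by blast
    also have "err N = real n * 36 ^ n * (2 * E) * (1 / \<zeta>) ^ N * L ^ n * 1"
      by (simp add: err_def L_def power_mult_distrib power_one_over)
    also have "\<dots> \<le> real n * 36 ^ n * (2 * E) * (1 / \<zeta>) ^ N * L ^ n * ((3 / 2) ^ (n - 1) * L ^ (n - 1))"
      using L1 L E \<zeta> by (intro mult_left_mono) auto
    also have "\<dots> = C1 * (1 / \<zeta>) ^ N / (\<zeta> - 1) * L ^ (2 * n - 1)"
      unfolding e using \<zeta> by (simp add: C1_def)
    also have "\<dots> \<le> (C1 + C2) * (1 / \<zeta>) ^ N / (\<zeta> - 1) * L ^ (2 * n - 1)"
      using C2 \<zeta> L by (intro mult_right_mono divide_right_mono) auto
    finally show "cmod (cubature (cheb_grid k N a b) w f - (LINT x:\<Gamma>|M. f x))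
        \<le> (C1 + C2) * \<zeta> powi (- int N) / (\<zeta> - 1) * ln (real (N + 1)) ^ (2 * CARD('n) - 1)"
      unfolding zp L_def n_def .
  next
    fix N :: nat and k w
    assume N: "1 \<le> N" and w: "cubature_weights S \<mu> N (cheb_grid k N a b) w"
    define W where "W = 1 + l1_norm (cheb_grid k N a b) w"
    have W: "W \<ge> 0" by (simp add: W_def l1_norm_def sum_nonneg)
    have "cmod (cubature (cheb_grid k N a b) w f - (LINT x:\<Gamma>|M. f x)) \<le> W * (T * (1 / \<zeta>) ^ (N div n))"
      unfolding W_def by (rule general_case[OF N w])
    also have "\<dots> = C2 * (1 / \<zeta>) ^ (N div n) / (\<zeta> - 1) * W"
      using \<zeta> by (simp add: C2_def)
    also have "\<dots> \<le> (C1 + C2) * (1 / \<zeta>) ^ (N div n) / (\<zeta> - 1) * W"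
      using C1 \<zeta> W by (intro mult_right_mono divide_right_mono) auto
    finally show "cmod (cubature (cheb_grid k N a b) w f - (LINT x:\<Gamma>|M. f x))
        \<le> (C1 + C2) * \<zeta> powi (- int (N div CARD('n))) / (\<zeta> - 1) * (1 + l1_norm (cheb_grid k N a b) w)"
      unfolding zp W_def n_def .
  qed
qed

end
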